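(* Suppose that $(X,d,\mu)$ is an unbounded geometrically doubling metric measure space with $\sup\{\mu(B(x,1)):x\in X\}<\infty$. Moreover, assume that $\mu$ is lower Ahlfors $Q(\cdot)$-regular for some $Q\in\mathcal{P}_b^{\log}(X)$. Let $H$ be a compact subgroup of $\mathrm{Iso}_\mu(X,d)$. Then the following statements are equivalent. (i) For every $x_0\in X$ and $r\in(0,1/3)$ we have $$\lim_{R\to\infty}\ \inf_{x\in X\setminus B(x_0,R)}M_H(x,r)=\infty.$$ (ii) For all $p\in\mathcal{P}_b^{\log}(X)\cap\mathcal{P}_H(X)$, $q\in\mathcal{P}(X)$, $s\in\mathcal{P}_b^{\log}(X)$ such that $s^+\le1$ and $sp\ll Q$ we have the compact embedding $$M^{s(\cdot),H}_{p(\cdot),q(\cdot)}(X,d,\mu)\hookrightarrow\hookrightarrow L^{\beta(\cdot)}(X,\mu)$$ for every $\beta\in\mathcal{P}_b(X)$ such that $p\ll\beta\ll\gamma$, where $\gamma=Qp/(Q-sp)$. (iii) There exist $s,p,\beta\in\mathcal{P}_b(X)$, $q\in\mathcal{P}(X)$, satisfying either $s^+<1$ and $q^-<\infty$, or $s^+\le1$ and $q^-=\infty$, such that we have the compact embedding $$M^{s(\cdot),H}_{p(\cdot),q(\cdot)}(X,d,\mu)\hookrightarrow\hookrightarrow L^{\beta(\cdot)}(X,\mu).$$ (iv) For all $p\in\mathcal{P}_b^{\log}(X)\cap\mathcal{P}_H(X)$, $q\in\mathcal{P}(X)$, $s\in\mathcal{P}_b^{\log}(X)$ such that $s^+\le1$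 and $sp\ll Q$, and for every $t\in\mathcal{P}_b^{\log}(X)$ such that $t\ll s$, we have the compact embedding $$N^{s(\cdot),H}_{p(\cdot),q(\cdot)}(X,d,\mu)\hookrightarrow\hookrightarrow L^{\beta(\cdot)}(X,\mu)$$ for every $\beta\in\mathcal{P}_b(X)$ such that $p\ll\beta\ll\sigma$, where $\sigma=Qp/(Q-tp)$. (v) There exist $s,p,\beta\in\mathcal{P}_b(X)$, $q\in\mathcal{P}(X)$, satisfying either $s^+<1$ and $q^-<\infty$, or $s^+\le1$ and $q^-=\infty$, such that we have the compact embedding $$N^{s(\cdot),H}_{p(\cdot),q(\cdot)}(X,d,\mu)\hookrightarrow\hookrightarrow L^{\beta(\cdot)}(X,\mu).$$
   Context: A metric measure space $(X,d,\mu)$ is a metric space $(X,d)$ with a Borel measure $\mu$ such that $0<\mu(B(x,r))<\infty$ for every open ball $B(x,r)$, $x\in X$, $r\in(0,\infty)$ (in particular $X$ is separable). $(X,d)$ is geometrically doubling if there is a constant $M$ such that every ball $B(x,r)$ can be covered by at most $M$ balls of radius $r/2$. Exponents: for measurable $p$ on $X$, $p^+=\operatorname{ess\,sup}_X p$, $p^-=\operatorname{ess\,inf}_X p$. $\mathcal{P}(X)$ is the set of measurable $p:X\to(0,\infty]$ with $p^->0$; $\mathcal{P}_b(X)=\mathcal{P}(X)\cap L^\infty(X,\mu)$. $p_1\ll p_2$ means $(p_2-p_1)^->0$. $\mathcal{P}_b^{\log}(X)$ is the set of $p\in\mathcal{P}_b(X)$ such that $1/p$ is locally log-Hölder continuous: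 there is $C\in(0,\infty)$ with $|1/p(x)-1/p(y)|\le C/\log(e+1/d(x,y))$ for all $x,y\in X$. $\mu$ is lower Ahlfors $Q(\cdot)$-regular if there is $b_1\in(0,\infty)$ such that $\mu(B(x,r))\ge b_1r^{Q(x)}$ for all $x\in X$, $r\in(0,1]$. Isometries: $\mathrm{Iso}_\mu(X,d)$ is the group of isometries $\varphi$ of $(X,d)$ (onto itself) with $\varphi_\#\mu=\mu$, where $\varphi_\#\mu(A)=\mu(\varphi^{-1}(A))$ for Borel $A$; compactness of subgroups refers to the usual compact-open topology (equivalently, pointwise convergence). For $H\subseteq\mathrm{Iso}_\mu(X,d)$, $H(x)=\{h(x):h\in H\}$ and $M_H(x,r)=\sup\{\#A: A\subseteq H(x),\ B(\xi,r)\cap B(\eta,r)=\emptyset\text{ for all distinct }\xi,\eta\in A\}$. $\mathcal{P}_H(X)=\{p\in\mathcal{P}(X):p\circ\varphi=p\ \text{for all }\varphi\in H\}$. Lebesgue spaces: for $p\in\mathcal{P}_b(X)$ let $\rho_{p(\cdot)}(u)=\int_X|u(x)|^{p(x)}\,d\mu(x)$. $L^{p(\cdot)}(X,\mu)$ is the space of measurable $u$ with $\rho_{p(\cdot)}(\lambda u)<\infty$ for some $\lambda>0$, with quasi-norm $\|u\|_{L^{p(\cdot)}}=\inf\{\lambda>0:\rho_{p(\cdot)}(u/\lambda)\le1\}$. Mixed spaces ($p\in\mathcal{P}_b(X)$, $q\in\mathcal{P}(X)$): for sequences $\{u_k\}_{k\in\mathbb{Z}}$ of measurable functions, $\|\{u_k\}\|_{L^{p(\cdot)}(\ell^{q(\cdot)})}=\big\|\,\|\{u_k(\cdot)\}_k\|_{\ell^{q(\cdot)}}\big\|_{L^{p(\cdot)}}$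 (pointwise $\ell^{q(x)}(\mathbb{Z})$ quasi-norm, supremum if $q(x)=\infty$). Let $\rho_{\ell^{q(\cdot)}(L^{p(\cdot)})}(\{u_k\})=\sum_{k\in\mathbb{Z}}\inf\{\lambda_k>0:\rho_{p(\cdot)}(u_k/\lambda_k^{1/q(\cdot)})\le1\}$ (with $\lambda^{1/\infty}=1$) and $\|\{u_k\}\|_{\ell^{q(\cdot)}(L^{p(\cdot)})}=\inf\{m>0:\rho_{\ell^{q(\cdot)}(L^{p(\cdot)})}(\{u_k\}/m)\le1\}$. Gradients: let $s\in\mathcal{P}_b(X)$ and $u:X\to\overline{\mathbb{R}}$ be measurable and finite a.e. A sequence $\{g_k\}_{k\in\mathbb{Z}}$ of non-negative measurable functions is a vector $s(\cdot)$-gradient of $u$ (written $\{g_k\}\in\mathbb{D}^{s(\cdot)}(u)$) if there is a $\mu$-null set $N_u$ such that $|u(x)-u(y)|\le d(x,y)^{s(x)}g_k(x)+d(x,y)^{s(y)}g_k(y)$ for all $k\in\mathbb{Z}$ and all $x,y\in X\setminus N_u$ with $2^{-k-1}\le d(x,y)<2^{-k}$. Function spaces: $\|u\|_{\dot M^{s(\cdot)}_{p(\cdot),q(\cdot)}}=\inf_{g\in\mathbb{D}^{s(\cdot)}(u)}\|g\|_{L^{p(\cdot)}(\ell^{q(\cdot)})}$ and $\|u\|_{\dot N^{s(\cdot)}_{p(\cdot),q(\cdot)}}=\inf_{g\in\mathbb{D}^{s(\cdot)}(u)}\|g\|_{\ell^{q(\cdot)}(L^{p(\cdot)})}$. For $A\in\{M,N\}$,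 $A^{s(\cdot)}_{p(\cdot),q(\cdot)}(X,d,\mu)$ is the space of $u\in L^{p(\cdot)}(X,\mu)$ with $\|u\|_{\dot A^{s(\cdot)}_{p(\cdot),q(\cdot)}}<\infty$, with quasi-norm $\|u\|_{L^{p(\cdot)}}+\|u\|_{\dot A^{s(\cdot)}_{p(\cdot),q(\cdot)}}$; $A^{s(\cdot),H}_{p(\cdot),q(\cdot)}(X,d,\mu)$ is its subspace of $u$ with $u\circ\varphi=u$ for all $\varphi\in H$. $Y\hookrightarrow\hookrightarrow Z$ (compact embedding) means $Y\subseteq Z$ with continuous inclusion mapping bounded subsets of $Y$ to totally bounded subsets of $Z$. *)

theory Defs
  imports "HOL-Analysis.Analysis" "HOL-Probability.Essential_Supremum"
begin

section \<open>Metric measure spaces\<close>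

text \<open>The metric space is the universe of a type of class \<^class>\<open>metric_space\<close>; measurability of
  functions is Borel measurability.\<close>

definition metric_measure_space :: "'a::metric_space measure \<Rightarrow> bool" where
  "metric_measure_space M \<longleftrightarrow>
     sets M = sets borel \<and>
     (\<forall>x r. 0 < r \<longrightarrow> 0 < emeasure M (ball x r) \<and> emeasure M (ball x r) < \<infinity>)"

definition geometrically_doubling :: "'a::metric_space itself \<Rightarrow> bool" where
  "geometrically_doubling _ \<longleftrightarrow>
     (\<exists>m::nat. \<forall>(x::'a) r. 0 < r \<longrightarrow>
        (\<exists>C. finite C \<and> card C \<le> m \<and> ball x r \<subseteq> (\<Union>c\<in>C. ball c (r / 2))))"

definition lower_Ahlfors_regular :: "'a::metric_space measure \<Rightarrow> ('a \<Rightarrow> real) \<Rightarrow> bool" where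
  "lower_Ahlfors_regular M Q \<longleftrightarrow>
     (\<exists>b>0. \<forall>x. \<forall>r\<in>{0<..1}. ennreal (b * r powr Q x) \<le> emeasure M (ball x r))"


section \<open>Groups of measure preserving isometries\<close>

definition Iso :: "'a::metric_space measure \<Rightarrow> ('a \<Rightarrow> 'a) set" where
  "Iso M = {\<phi>. surj \<phi> \<and> (\<forall>x y. dist (\<phi> x) (\<phi> y) = dist x y) \<and> distr M M \<phi> = M}"

definition compact_open_topology :: "('a::topological_space \<Rightarrow> 'b::topological_space) topology" where
  "compact_open_topology =
     topology_generated_by {{f. f ` K \<subseteq> U} | K U. compact K \<and> open U}"

definition compact_subgroup_Iso :: "'a::metric_space measure \<Rightarrow> ('a \<Rightarrow> 'a) set \<Rightarrow> bool" where
  "compact_subgroup_Iso M H \<longleftrightarrow>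
     H \<subseteq> Iso M \<and> id \<in> H \<and> (\<forall>\<phi>\<in>H. \<forall>\<psi>\<in>H. \<phi> \<circ> \<psi> \<in> H) \<and> (\<forall>\<phi>\<in>H. inv \<phi> \<in> H) \<and>
     compactin compact_open_topology H"

definition orbit :: "('a \<Rightarrow> 'a) set \<Rightarrow> 'a \<Rightarrow> 'a set" where
  "orbit H x = (\<lambda>h. h x) ` H"

definition packing_number :: "('a::metric_space \<Rightarrow> 'a) set \<Rightarrow> 'a \<Rightarrow> real \<Rightarrow> enat" where
  "packing_number H x r =
     (SUP A \<in> {A. A \<subseteq> orbit H x \<and> (\<forall>\<xi>\<in>A. \<forall>\<eta>\<in>A. \<xi> \<noteq> \<eta> \<longrightarrow> ball \<xi> r \<inter> ball \<eta> r = {})}.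
        if finite A then enat (card A) else \<infinity>)"


section \<open>Variable exponents\<close>

definition essinf :: "'a measure \<Rightarrow> ('a \<Rightarrow> ereal) \<Rightarrow> ereal" where
  "essinf M f = - esssup M (\<lambda>x. - f x)"

definition exponents :: "'a measure \<Rightarrow> ('a \<Rightarrow> ereal) set" where
  "exponents M = {p. p \<in> borel_measurable M \<and> (\<forall>x. 0 < p x) \<and> 0 < essinf M p}"

text \<open>Essentially bounded exponents are finite almost everywhere, and every notion below depends
  on them only up to null sets, so they are represented by real-valued functions.\<close>

definition bounded_exponents :: "'a measure \<Rightarrow> ('a \<Rightarrow> real) set" where
  "bounded_exponents M = {p. ereal \<circ> p \<in> exponents M \<and> esssup M (ereal \<circ> p) < \<infinity>}"

text \<open>For \<open>x = y\<close> the condition is trivial, also with the convention \<open>1 / 0 = 0\<close>.\<close>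

definition log_exponents :: "'a::metric_space measure \<Rightarrow> ('a \<Rightarrow> real) set" where
  "log_exponents M = {p \<in> bounded_exponents M.
     \<exists>C>0. \<forall>x y. \<bar>1 / p x - 1 / p y\<bar> \<le> C / ln (exp 1 + 1 / dist x y)}"

definition invariant_exponents :: "'a measure \<Rightarrow> ('a \<Rightarrow> 'a) set \<Rightarrow> ('a \<Rightarrow> ereal) set" where
  "invariant_exponents M H = {p \<in> exponents M. \<forall>\<phi>\<in>H. p \<circ> \<phi> = p}"

definition exp_less :: "'a measure \<Rightarrow> ('a \<Rightarrow> real) \<Rightarrow> ('a \<Rightarrow> real) \<Rightarrow> bool" where
  "exp_less M p1 p2 \<longleftrightarrow> 0 < essinf M (\<lambda>x. ereal (p2 x - p1 x))"


section \<open>Lebesgue and mixed Lebesgue-sequence spaces\<close>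

text \<open>Modulars and quasi-norms depend only on absolute values, so they are defined for functions
  with values in \<open>[0,\<infinity>]\<close>. The quasi-norm of a real function \<open>u\<close> is that of \<open>\<bar>u\<bar>\<close>.\<close>

definition ennreal_powr :: "ennreal \<Rightarrow> real \<Rightarrow> ennreal" where
  "ennreal_powr x a = (if x = \<infinity> then \<infinity> else ennreal (enn2real x powr a))"

definition modular :: "'a measure \<Rightarrow> ('a \<Rightarrow> real) \<Rightarrow> ('a \<Rightarrow> ennreal) \<Rightarrow> ennreal" where
  "modular M p f = (\<integral>\<^sup>+x. ennreal_powr (f x) (p x) \<partial>M)"

definition Lp_norm :: "'a measure \<Rightarrow> ('a \<Rightarrow> real) \<Rightarrow> ('a \<Rightarrow> ennreal) \<Rightarrow> ennreal" where
  "Lp_norm M p f = (INF l \<in> {l::real. 0 < l \<and> modular M p (\<lambda>x. f x / ennreal l) \<le> 1}. ennreal l)"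

definition Lp_space :: "'a measure \<Rightarrow> ('a \<Rightarrow> real) \<Rightarrow> ('a \<Rightarrow> real) set" where
  "Lp_space M p =
     {u \<in> borel_measurable M. \<exists>l>0. modular M p (\<lambda>x. ennreal \<bar>l * u x\<bar>) < \<infinity>}"

definition lq_norm :: "ereal \<Rightarrow> (int \<Rightarrow> ennreal) \<Rightarrow> ennreal" where
  "lq_norm q a =
     (if q = \<infinity> then (SUP k. a k)
      else ennreal_powr (\<Sum>\<^sub>\<infinity>k. ennreal_powr (a k) (real_of_ereal q)) (1 / real_of_ereal q))"

definition Lp_lq_norm ::
    "'a measure \<Rightarrow> ('a \<Rightarrow> real) \<Rightarrow> ('a \<Rightarrow> ereal) \<Rightarrow> (int \<Rightarrow> 'a \<Rightarrow> ennreal) \<Rightarrow> ennreal" where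
  "Lp_lq_norm M p q f = Lp_norm M p (\<lambda>x. lq_norm (q x) (\<lambda>k. f k x))"

text \<open>In \<^typ>\<open>ereal\<close> one has \<open>1 / \<infinity> = 0\<close>, hence \<open>l powr real_of_ereal (1 / q x)\<close> is \<open>1\<close> where
  \<open>q x = \<infinity>\<close>.\<close>

definition lq_Lp_modular ::
    "'a measure \<Rightarrow> ('a \<Rightarrow> real) \<Rightarrow> ('a \<Rightarrow> ereal) \<Rightarrow> (int \<Rightarrow> 'a \<Rightarrow> ennreal) \<Rightarrow> ennreal" where
  "lq_Lp_modular M p q f =
     (\<Sum>\<^sub>\<infinity>k. INF l \<in> {l::real. 0 < l \<and>
        modular M p (\<lambda>x. f k x / ennreal (l powr real_of_ereal (1 / q x))) \<le> 1}. ennreal l)"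

definition lq_Lp_norm ::
    "'a measure \<Rightarrow> ('a \<Rightarrow> real) \<Rightarrow> ('a \<Rightarrow> ereal) \<Rightarrow> (int \<Rightarrow> 'a \<Rightarrow> ennreal) \<Rightarrow> ennreal" where
  "lq_Lp_norm M p q f =
     (INF m \<in> {m::real. 0 < m \<and> lq_Lp_modular M p q (\<lambda>k x. f k x / ennreal m) \<le> 1}. ennreal m)"


section \<open>Gradients and the spaces M and N\<close>

definition vector_gradients ::
    "'a::metric_space measure \<Rightarrow> ('a \<Rightarrow> real) \<Rightarrow> ('a \<Rightarrow> real) \<Rightarrow> (int \<Rightarrow> 'a \<Rightarrow> ennreal) set" where
  "vector_gradients M s u =
     {g. (\<forall>k. g k \<in> borel_measurable M) \<and>
         (\<exists>N\<in>null_sets M. \<forall>k. \<forall>x\<in>-N. \<forall>y\<in>-N.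
            2 powi (-k-1) \<le> dist x y \<and> dist x y < 2 powi (-k) \<longrightarrow>
            ennreal \<bar>u x - u y\<bar> \<le>
              ennreal (dist x y powr s x) * g k x + ennreal (dist x y powr s y) * g k y)}"

definition M_seminorm ::
    "'a::metric_space measure \<Rightarrow> ('a \<Rightarrow> real) \<Rightarrow> ('a \<Rightarrow> real) \<Rightarrow> ('a \<Rightarrow> ereal) \<Rightarrow> ('a \<Rightarrow> real) \<Rightarrow> ennreal"
  where "M_seminorm M s p q u = (INF g \<in> vector_gradients M s u. Lp_lq_norm M p q g)"

definition N_seminorm ::
    "'a::metric_space measure \<Rightarrow> ('a \<Rightarrow> real) \<Rightarrow> ('a \<Rightarrow> real) \<Rightarrow> ('a \<Rightarrow> ereal) \<Rightarrow> ('a \<Rightarrow> real) \<Rightarrow> ennreal"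
  where "N_seminorm M s p q u = (INF g \<in> vector_gradients M s u. lq_Lp_norm M p q g)"

text \<open>A space is given by the set of its (representatives of) elements together with its quasi-norm;
  functions agreeing almost everywhere are at distance \<open>0\<close> instead of being identified.\<close>

type_synonym 'a fun_space = "('a \<Rightarrow> real) set \<times> (('a \<Rightarrow> real) \<Rightarrow> ennreal)"

definition L_fun_space :: "'a measure \<Rightarrow> ('a \<Rightarrow> real) \<Rightarrow> 'a fun_space" where
  "L_fun_space M p = (Lp_space M p, \<lambda>u. Lp_norm M p (\<lambda>x. ennreal \<bar>u x\<bar>))"

definition M_fun_space ::
    "'a::metric_space measure \<Rightarrow> ('a \<Rightarrow> real) \<Rightarrow> ('a \<Rightarrow> real) \<Rightarrow> ('a \<Rightarrow> ereal) \<Rightarrow> 'a fun_space" where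
  "M_fun_space M s p q =
     ({u \<in> Lp_space M p. M_seminorm M s p q u < \<infinity>},
      \<lambda>u. Lp_norm M p (\<lambda>x. ennreal \<bar>u x\<bar>) + M_seminorm M s p q u)"

definition N_fun_space ::
    "'a::metric_space measure \<Rightarrow> ('a \<Rightarrow> real) \<Rightarrow> ('a \<Rightarrow> real) \<Rightarrow> ('a \<Rightarrow> ereal) \<Rightarrow> 'a fun_space" where
  "N_fun_space M s p q =
     ({u \<in> Lp_space M p. N_seminorm M s p q u < \<infinity>},
      \<lambda>u. Lp_norm M p (\<lambda>x. ennreal \<bar>u x\<bar>) + N_seminorm M s p q u)"

definition invariant_subspace ::
    "'a measure \<Rightarrow> ('a \<Rightarrow> 'a) set \<Rightarrow> 'a fun_space \<Rightarrow> 'a fun_space" where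
  "invariant_subspace M H Y = ({u \<in> fst Y. \<forall>\<phi>\<in>H. AE x in M. u (\<phi> x) = u x}, snd Y)"


section \<open>Compact embeddings\<close>

definition continuous_inclusion :: "'a fun_space \<Rightarrow> 'a fun_space \<Rightarrow> bool" where
  "continuous_inclusion Y Z \<longleftrightarrow>
     fst Y \<subseteq> fst Z \<and>
     (\<forall>u\<in>fst Y. \<forall>\<epsilon>>0. \<exists>\<delta>>0. \<forall>v\<in>fst Y. snd Y (v - u) < ennreal \<delta> \<longrightarrow> snd Z (v - u) < ennreal \<epsilon>)"

definition norm_bounded :: "'a fun_space \<Rightarrow> ('a \<Rightarrow> real) set \<Rightarrow> bool" where
  "norm_bounded Y B \<longleftrightarrow> B \<subseteq> fst Y \<and> (\<exists>K::real. \<forall>u\<in>B. snd Y u \<le> ennreal K)"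

definition norm_totally_bounded :: "'a fun_space \<Rightarrow> ('a \<Rightarrow> real) set \<Rightarrow> bool" where
  "norm_totally_bounded Z B \<longleftrightarrow>
     B \<subseteq> fst Z \<and>
     (\<forall>\<epsilon>>0. \<exists>F. finite F \<and> F \<subseteq> fst Z \<and> (\<forall>u\<in>B. \<exists>v\<in>F. snd Z (u - v) < ennreal \<epsilon>))"

definition compactly_embedded :: "'a fun_space \<Rightarrow> 'a fun_space \<Rightarrow> bool"
    (infix \<open>\<hookrightarrow>\<hookrightarrow>\<close> 50) where
  "Y \<hookrightarrow>\<hookrightarrow> Z \<longleftrightarrow>
     continuous_inclusion Y Z \<and> (\<forall>B. norm_bounded Y B \<longrightarrow> norm_totally_bounded Z B)"


definition all_equivalent :: "bool list \<Rightarrow> bool" where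
  "all_equivalent Ps \<longleftrightarrow> (\<forall>P\<in>set Ps. \<forall>P'\<in>set Ps. P \<longleftrightarrow> P')"

end

theory Submission
  imports Defs
begin

text \<open>Only two implications have content: large orbits at infinity force every
subcritical embedding to be compact, and one compact embedding forces orbits to be large.

From orbits to compactness: bounded sets of both scales lie, after division by a constant,
in one class (\<open>hajlasz_class\<close>): functions \<open>u\<close> with \<open>\<integral>\<bar>u\<bar>^p \<le> K\<close> that satisfy
\<open>\<bar>u x - u y\<bar> \<le> d^t(x) g(x) + d^t(y) g(y)\<close> at distances \<open>d < 1\<close> for some \<open>g \<ge> 0\<close> with
\<open>\<integral>g^p \<le> K\<close>. For the scale M one takes \<open>t = s\<close> and the supremum of the gradient over the levels
(\<open>M_ball_scaled\<close>); for the scale N the room \<open>t \<lless> s\<close> makes the levels summable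
(\<open>N_ball_scaled\<close>). Compactness in \<open>L^\<beta>\<close> is then obtained in three moves.
First, the class is bounded in \<open>L^\<tau>\<close> for exponents \<open>\<tau>\<close> as close as wanted to \<open>Qp/(Q - tp)\<close>
(\<open>improved_integrability\<close>): a bound in \<open>L^\<beta>\<close> makes \<open>u\<close> small at some point of a ball
about \<open>x\<close> whose radius is a power of \<open>\<bar>u x\<bar>\<close>, so that \<open>g x\<close> has to be large there; this raises
\<open>\<beta>\<close> to \<open>p(1 + \<beta>t/Q)\<close>, an affine map with fixed point \<open>Qp/(Q - tp)\<close>. Log-Hoelder continuity
enters through the comparability of \<open>r^f(x)\<close> and \<open>r^f(y)\<close> when \<open>d(x,y) < r\<close>.
Second, by interpolation between \<open>p\<close> and \<open>\<tau>\<close>, smallness in measure of a difference gives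
smallness in \<open>L^\<beta>\<close> (\<open>interpolation_in_measure\<close>).
Third, the class is totally bounded in measure. Members are uniformly continuous off a set of small
measure, which settles bounded regions by recording rounded values on a finite net
(\<open>local_finite_colouring\<close>). Far away, if \<open>\<bar>u x\<bar> > \<eta>\<close> then \<open>\<bar>u\<bar> > \<eta>/2\<close> on most of
\<open>B(x,\<rho>)\<close> unless the exceptional set fills half of it. The former is excluded by invariance,
because the set \<open>{\<bar>u\<bar> > \<eta>/2}\<close> would have equal mass in each of the many disjoint translates of
the ball; the latter happens on a set of small measure by a covering argument (\<open>tightness\<close>).

From compactness to orbits: if orbits of points \<open>z_n\<close> tending to infinity had bounded packing
numbers, the bumps \<open>max 0 (1 - dist(y, H z_n)/r)\<close> would be invariant, supported in sets of bounded
measure, hence bounded in either space; compactness of \<open>H\<close> lets one choose them with disjoint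
supports, and lower regularity keeps them away from zero in \<open>L^\<beta>\<close>
(\<open>large_orbits_of_compact_embedding\<close>).\<close>

section \<open>Modulars, quasi-norms and essential bounds\<close>

lemma ennreal_powr_ennreal: "0 \<le> a \<Longrightarrow> ennreal_powr (ennreal a) e = ennreal (a powr e)"
  by (simp add: ennreal_powr_def)

lemma ennreal_powr_mono: "0 \<le> e \<Longrightarrow> x \<le> y \<Longrightarrow> ennreal_powr x e \<le> ennreal_powr y e"
  by (auto simp: ennreal_powr_def top_unique intro!: ennreal_leI powr_mono2 enn2real_mono)
     (use less_top in blast)

lemma ennreal_powr_inverse: "0 < e \<Longrightarrow> ennreal_powr (ennreal_powr x e) (1 / e) = x"
  by (cases x) (auto simp: ennreal_powr_def powr_powr)

lemma modular_mono:
  assumes "\<And>x. 0 \<le> p x" and "AE x in M. f x \<le> g x"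
  shows "modular M p f \<le> modular M p g"
  unfolding modular_def using assms by (auto intro!: nn_integral_mono_AE ennreal_powr_mono)

lemma modular_real:
  assumes "0 < l"
  shows "modular M p (\<lambda>x. ennreal \<bar>u x\<bar> / ennreal l) = (\<integral>\<^sup>+x. ennreal ((\<bar>u x\<bar> / l) powr p x) \<partial>M)"
  unfolding modular_def using assms
  by (auto intro!: nn_integral_cong simp: divide_ennreal ennreal_powr_ennreal)

lemma Lp_norm_le: "0 < l \<Longrightarrow> modular M p (\<lambda>x. f x / ennreal l) \<le> 1 \<Longrightarrow> Lp_norm M p f \<le> ennreal l"
  unfolding Lp_norm_def by (auto intro!: INF_lower)

lemma Lp_norm_lessD:
  assumes p: "\<And>x. 0 < p x" and "Lp_norm M p f < ennreal L"
  shows "modular M p (\<lambda>x. f x / ennreal L) \<le> 1"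
proof -
  obtain l where l: "0 < l" "modular M p (\<lambda>x. f x / ennreal l) \<le> 1" "ennreal l < ennreal L"
    using assms(2) unfolding Lp_norm_def INF_less_iff by auto
  have "modular M p (\<lambda>x. f x / ennreal L) \<le> modular M p (\<lambda>x. f x / ennreal l)"
    using p l
    by (intro modular_mono AE_I2)
       (auto simp: divide_ennreal_def inverse_ennreal ennreal_less_iff less_imp_le
          intro!: mult_left_mono ennreal_leI le_imp_inverse_le)
  with l show ?thesis by simp
qed

lemma essinf_geD:
  assumes "ereal c < essinf M f"
  shows "f \<in> borel_measurable M" and "AE x in M. ereal c \<le> f x"
proof -
  have lt: "esssup M (\<lambda>x. - f x) < - ereal c"
    using assms unfolding essinf_def using ereal_minus_less_minus by (metis ereal_uminus_uminus)
  then have m: "(\<lambda>x. - f x) \<in> borel_measurable M"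
    by (auto simp: esssup_def split: if_splits)
  then have "(\<lambda>x. - (- f x)) \<in> borel_measurable M"
    using borel_measurable_uminus_ereal by blast
  then show "f \<in> borel_measurable M" by simp
  show "AE x in M. ereal c \<le> f x"
    using esssup_AE[of "\<lambda>x. - f x" M] 
    by eventually_elim (metis ereal_minus_le_minus less_imp_le lt order_trans uminus_ereal.simps(1))
qed

lemma essinf_geI:
  assumes "f \<in> borel_measurable M" and "AE x in M. c \<le> f x"
  shows "c \<le> essinf M f"
proof -
  have "esssup M (\<lambda>x. - f x) \<le> - c" using assms by (intro esssup_I) auto
  then show ?thesis unfolding essinf_def by (metis ereal_minus_le_minus ereal_uminus_uminus)
qed

lemma essinf_posD:
  assumes "0 < essinf M f"
  obtains c where "0 < c" "c \<le> 1" "AE x in M. ereal c \<le> f x"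
proof -
  obtain c' where c': "0 < ereal c'" "ereal c' < essinf M f"
    using assms ereal_dense2 by blast
  have "AE x in M. ereal (min c' 1) \<le> f x"
    using essinf_geD(2)[OF c'(2)] by eventually_elim (metis ereal_min min.coboundedI1)
  with c' that[of "min c' 1"] show ?thesis by auto
qed

lemma esssup_leD:
  assumes "esssup M (ereal \<circ> f) \<le> ereal c" shows "AE x in M. f x \<le> c"
  using esssup_AE[of "ereal \<circ> f" M] by eventually_elim (use assms in \<open>auto dest: order_trans\<close>)

lemma exp_lessD:
  assumes "exp_less M f g"
  obtains e where "0 < e" "e \<le> 1" "AE x in M. f x + e \<le> g x"
proof -
  obtain e where e: "0 < e" "e \<le> 1" "AE x in M. ereal e \<le> ereal (g x - f x)"
    using essinf_posD assms unfolding exp_less_def by blast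
  have "AE x in M. f x + e \<le> g x" using e(3) by eventually_elim simp
  with e that show ?thesis by blast
qed

lemma bounded_exponentsD:
  assumes "p \<in> bounded_exponents M"
  shows "p \<in> borel_measurable M" and "\<And>x. 0 < p x"
    and "\<exists>a b. 0 < a \<and> a \<le> 1 \<and> 1 \<le> b \<and> (AE x in M. a \<le> p x \<and> p x \<le> b)"
proof -
  have *: "ereal \<circ> p \<in> borel_measurable M" "\<And>x. 0 < p x" "0 < essinf M (ereal \<circ> p)"
      "esssup M (ereal \<circ> p) < \<infinity>"
    using assms by (auto simp: bounded_exponents_def exponents_def)
  show "p \<in> borel_measurable M" using *(1) borel_measurable_real_of_ereal[OF *(1)] by (simp add: comp_def)
  show "\<And>x. 0 < p x" by fact
  obtain a where a: "0 < a" "a \<le> 1" "AE x in M. ereal a \<le> (ereal \<circ> p) x"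
    using essinf_posD[OF *(3)] by blast
  obtain b where b: "esssup M (ereal \<circ> p) \<le> ereal b"
    using *(4) by (metis less_imp_le ereal_dense2)
  have "AE x in M. a \<le> p x \<and> p x \<le> max b 1"
    using a(3) esssup_leD[OF b] by eventually_elim auto
  with a show "\<exists>a b. 0 < a \<and> a \<le> 1 \<and> 1 \<le> b \<and> (AE x in M. a \<le> p x \<and> p x \<le> b)"
    by (metis max.cobounded2)
qed

section \<open>Log-Hoelder continuous exponents\<close>

text \<open>The modulus is stated through a scale \<open>r\<close> above the distance, so that the case \<open>x = y\<close> needs no
convention and the estimate \<open>r^f(y) \<le> D r^f(x)\<close> is its exponential form.\<close>

definition log_holder :: "('a::metric_space \<Rightarrow> real) \<Rightarrow> bool" where
  "log_holder f \<longleftrightarrow> (\<exists>C\<ge>0. \<forall>x y r. 0 < r \<and> r \<le> 1 \<and> dist x y < r \<longrightarrow> \<bar>f x - f y\<bar> * ln (1 / r) \<le> C)"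

lemma log_holderI:
  assumes C: "0 < C" "\<And>x y. \<bar>f x - f y\<bar> \<le> C / ln (exp 1 + 1 / dist x y)"
  shows "log_holder f"
  unfolding log_holder_def
proof (intro exI[of _ C] conjI allI impI)
  fix x y :: 'a and r :: real
  assume r: "0 < r \<and> r \<le> 1 \<and> dist x y < r"
  show "\<bar>f x - f y\<bar> * ln (1 / r) \<le> C"
  proof (cases "x = y")
    case False
    have pos: "0 < dist x y" using False by simp
    have e: "exp 1 + 1 / dist x y > 1" using pos by (smt (verit) divide_pos_pos exp_gt_one)
    have "1 / r \<le> 1 / dist x y" using r pos by (simp add: frac_le)
    then have "ln (1 / r) \<le> ln (exp 1 + 1 / dist x y)"
      using r pos by (subst ln_le_cancel_iff) (auto intro: add_nonneg_pos order_trans less_imp_le simp: add_pos_pos)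
    then have "\<bar>f x - f y\<bar> * ln (1 / r) \<le> C / ln (exp 1 + 1 / dist x y) * ln (exp 1 + 1 / dist x y)"
      using C(2)[of x y] r C(1) e by (intro mult_mono) auto
    also have "\<dots> = C" using e by simp
    finally show ?thesis .
  qed (use C in simp)
qed (use C in simp)

lemma log_holder_add:
  assumes "log_holder f" "log_holder g" shows "log_holder (\<lambda>x. f x + g x)"
proof -
  obtain C D where C: "C \<ge> 0" "\<And>x y r. 0 < r \<Longrightarrow> r \<le> 1 \<Longrightarrow> dist x y < r \<Longrightarrow> \<bar>f x - f y\<bar> * ln (1 / r) \<le> C"
    and D: "D \<ge> 0" "\<And>x y r. 0 < r \<Longrightarrow> r \<le> 1 \<Longrightarrow> dist x y < r \<Longrightarrow> \<bar>g x - g y\<bar> * ln (1 / r) \<le> D"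
    using assms unfolding log_holder_def by metis
  show ?thesis unfolding log_holder_def
  proof (intro exI[of _ "C + D"] conjI allI impI)
    fix x y :: 'a and r :: real
    assume r: "0 < r \<and> r \<le> 1 \<and> dist x y < r"
    have "\<bar>f x + g x - (f y + g y)\<bar> * ln (1 / r) \<le> (\<bar>f x - f y\<bar> + \<bar>g x - g y\<bar>) * ln (1 / r)"
      using r by (intro mult_right_mono) auto
    also have "\<dots> \<le> C + D" using C(2)[of r x y] D(2)[of r x y] r by (simp add: distrib_right)
    finally show "\<bar>f x + g x - (f y + g y)\<bar> * ln (1 / r) \<le> C + D" .
  qed (use C D in simp)
qed

lemma log_holder_const: "log_holder (\<lambda>x. c)"
  unfolding log_holder_def by auto

lemma log_holder_mult:
  assumes "log_holder f" "log_holder g" and f: "\<And>x. \<bar>f x\<bar> \<le> F" and g: "\<And>x. \<bar>g x\<bar> \<le> G"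
  shows "log_holder (\<lambda>x. f x * g x)"
proof -
  obtain C D where C: "C \<ge> 0" "\<And>x y r. 0 < r \<Longrightarrow> r \<le> 1 \<Longrightarrow> dist x y < r \<Longrightarrow> \<bar>f x - f y\<bar> * ln (1 / r) \<le> C"
    and D: "D \<ge> 0" "\<And>x y r. 0 < r \<Longrightarrow> r \<le> 1 \<Longrightarrow> dist x y < r \<Longrightarrow> \<bar>g x - g y\<bar> * ln (1 / r) \<le> D"
    using assms(1,2) unfolding log_holder_def by metis
  have F: "0 \<le> F" and G: "0 \<le> G" using f g by (meson abs_ge_zero order_trans)+
  show ?thesis unfolding log_holder_def
  proof (intro exI[of _ "C * G + F * D"] conjI allI impI)
    fix x y :: 'a and r :: real
    assume r: "0 < r \<and> r \<le> 1 \<and> dist x y < r"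
    have "\<bar>f x * g x - f y * g y\<bar> = \<bar>(f x - f y) * g x + f y * (g x - g y)\<bar>" by (simp add: algebra_simps)
    also have "\<dots> \<le> \<bar>f x - f y\<bar> * G + F * \<bar>g x - g y\<bar>"
      by (intro order_trans[OF abs_triangle_ineq] add_mono)
         (auto simp: abs_mult intro!: mult_mono f g F G)
    finally have "\<bar>f x * g x - f y * g y\<bar> * ln (1 / r) \<le> (\<bar>f x - f y\<bar> * G + F * \<bar>g x - g y\<bar>) * ln (1 / r)"
      using r by (intro mult_right_mono) auto
    also have "\<dots> = (\<bar>f x - f y\<bar> * ln (1 / r)) * G + F * (\<bar>g x - g y\<bar> * ln (1 / r))"
      by (simp add: algebra_simps)
    also have "\<dots> \<le> C * G + F * D"
      using C(2)[of r x y] D(2)[of r x y] r F G by (intro add_mono mult_right_mono mult_left_mono) auto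
    finally show "\<bar>f x * g x - f y * g y\<bar> * ln (1 / r) \<le> C * G + F * D" .
  qed (use C D F G in simp)
qed

lemma log_holder_inverse:
  assumes "log_holder f" and a: "0 < a" "\<And>x. a \<le> f x"
  shows "log_holder (\<lambda>x. 1 / f x)"
proof -
  obtain C where C: "C \<ge> 0" "\<And>x y r. 0 < r \<Longrightarrow> r \<le> 1 \<Longrightarrow> dist x y < r \<Longrightarrow> \<bar>f x - f y\<bar> * ln (1 / r) \<le> C"
    using assms(1) unfolding log_holder_def by metis
  show ?thesis unfolding log_holder_def
  proof (intro exI[of _ "C / (a * a)"] conjI allI impI)
    fix x y :: 'a and r :: real
    assume r: "0 < r \<and> r \<le> 1 \<and> dist x y < r"
    have fp: "0 < f x" "0 < f y" using a less_le_trans by blast+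
    have "\<bar>1 / f x - 1 / f y\<bar> = \<bar>f x - f y\<bar> / (f x * f y)"
      using fp by (simp add: field_simps abs_minus_commute)
    also have "\<dots> \<le> \<bar>f x - f y\<bar> / (a * a)"
      using a fp by (intro divide_left_mono mult_mono) (auto intro: less_imp_le)
    finally have "\<bar>1 / f x - 1 / f y\<bar> * ln (1 / r) \<le> \<bar>f x - f y\<bar> / (a * a) * ln (1 / r)"
      using r by (intro mult_right_mono) auto
    also have "\<dots> = \<bar>f x - f y\<bar> * ln (1 / r) / (a * a)" by simp
    also have "\<dots> \<le> C / (a * a)" using C(2)[of r x y] r a by (intro divide_right_mono) auto
    finally show "\<bar>1 / f x - 1 / f y\<bar> * ln (1 / r) \<le> C / (a * a)" .
  qed (use C a in simp)
qed

text \<open>The form in which log-Hoelder continuity is applied: on a ball of radius \<open>r\<close> a power of \<open>r\<close>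
with variable exponent is constant up to a factor.\<close>

lemma log_holderD_powr:
  assumes "log_holder f"
  obtains D where "1 \<le> D" "\<And>x y r. 0 < r \<Longrightarrow> r \<le> 1 \<Longrightarrow> dist x y < r \<Longrightarrow> r powr f y \<le> D * r powr f x"
proof -
  obtain C where C: "C \<ge> 0" "\<And>x y r. 0 < r \<Longrightarrow> r \<le> 1 \<Longrightarrow> dist x y < r \<Longrightarrow> \<bar>f x - f y\<bar> * ln (1 / r) \<le> C"
    using assms(1) unfolding log_holder_def by metis
  show ?thesis
  proof (rule that[of "exp C"])
    fix x y :: 'a and r :: real
    assume r: "0 < r" "r \<le> 1" "dist x y < r"
    have "(f x - f y) * ln (1 / r) \<le> \<bar>f x - f y\<bar> * ln (1 / r)" using r by (intro mult_right_mono) auto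
    also have "\<dots> \<le> C" using C r by auto
    finally have "f y * ln r \<le> C + f x * ln r" using r by (simp add: ln_div algebra_simps)
    then show "r powr f y \<le> exp C * r powr f x" using r by (simp add: powr_def flip: exp_add)
  qed (use C in simp)
qed

lemma continuous_of_log_modulus:
  fixes f :: "'a::metric_space \<Rightarrow> real"
  assumes C: "0 < C" "\<And>x y. \<bar>f x - f y\<bar> \<le> C / ln (exp 1 + 1 / dist x y)"
  shows "continuous_on UNIV f"
  unfolding continuous_on_iff
proof (intro ballI allI impI)
  fix x :: 'a and e :: real assume e: "0 < e"
  define \<delta> where "\<delta> = 1 / exp (C / e)"
  show "\<exists>d>0. \<forall>x'\<in>UNIV. dist x' x < d \<longrightarrow> dist (f x') (f x) < e"
  proof (intro exI[of _ \<delta>] conjI ballI impI)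
    fix y assume y: "dist y x < \<delta>"
    show "dist (f y) (f x) < e"
    proof (cases "x = y")
      case False
      then have pos: "0 < dist y x" by simp
      have "exp (C / e) < 1 / dist y x" using y pos unfolding \<delta>_def by (simp add: field_simps)
      then have "exp (C / e) < exp 1 + 1 / dist y x" by (simp add: add_strict_increasing)
      then have "C / e < ln (exp 1 + 1 / dist y x)"
        by (metis exp_gt_zero ln_exp ln_less_cancel_iff order_less_trans)
      moreover have "0 < C / e" using C e by simp
      ultimately have "C / ln (exp 1 + 1 / dist y x) < e" using e C
        by (metis divide_less_eq mult.commute order_less_trans)
      with C(2)[of y x] show ?thesis by (simp add: dist_real_def)
    qed (use e in simp)
  qed (simp add: \<delta>_def)
qed

text \<open>A null set contains no ball, so it cannot hide a point where a continuous function is too small.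
This turns essential bounds on continuous exponents into bounds at every point.\<close>

lemma AE_ge_imp_ge:
  fixes f :: "'a::metric_space \<Rightarrow> real"
  assumes M: "metric_measure_space M" and f: "continuous_on UNIV f" and ae: "AE x in M. c \<le> f x"
  shows "c \<le> f x"
proof (rule ccontr)
  assume "\<not> c \<le> f x"
  then have "0 < c - f x" by simp
  then obtain d where d: "d > 0" "\<And>y. dist y x < d \<Longrightarrow> dist (f y) (f x) < c - f x"
    using f unfolding continuous_on_iff by (metis UNIV_I)
  have "f y < c" if "y \<in> ball x d" for y
    using d(2)[of y] that by (auto simp: dist_real_def dist_commute)
  then have "AE y in M. y \<notin> ball x d" using ae by (auto elim!: eventually_mono dest: leD)
  then have "emeasure M (ball x d) = 0"
    using M by (subst (asm) AE_iff_measurable[of "ball x d"])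
       (auto simp: metric_measure_space_def sets_eq_imp_space_eq)
  moreover have "0 < emeasure M (ball x d)" using M d(1) by (simp add: metric_measure_space_def)
  ultimately show False by simp
qed

lemma log_exponentsD:
  fixes M :: "'a::metric_space measure"
  assumes M: "metric_measure_space M" and p: "p \<in> log_exponents M"
  shows "continuous_on UNIV p" and "log_holder p"
    and "\<exists>a b. 0 < a \<and> a \<le> 1 \<and> 1 \<le> b \<and> (\<forall>x. a \<le> p x \<and> p x \<le> b)"
proof -
  have bp: "p \<in> bounded_exponents M" using p by (simp add: log_exponents_def)
  obtain C where C: "0 < C" "\<And>x y. \<bar>1 / p x - 1 / p y\<bar> \<le> C / ln (exp 1 + 1 / dist x y)"
    using p unfolding log_exponents_def by auto
  have pos: "0 < p x" for x using bounded_exponentsD[OF bp] by auto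
  have nz: "p x \<noteq> 0" for x using pos[of x] by simp
  have "continuous_on UNIV (\<lambda>x. 1 / p x)" using continuous_of_log_modulus[OF C] .
  then have "continuous_on UNIV (\<lambda>x. 1 / (1 / p x))"
    by (rule continuous_on_divide[OF continuous_on_const]) (simp add: nz)
  then show cont: "continuous_on UNIV p" by simp
  obtain a b where ab: "0 < a" "a \<le> 1" "1 \<le> b" "AE x in M. a \<le> p x \<and> p x \<le> b"
    using bounded_exponentsD(3)[OF bp] by blast
  have ae: "AE x in M. a \<le> p x" "AE x in M. - b \<le> - p x" using ab(4) by (eventually_elim, simp)+
  have "a \<le> p x" for x by (rule AE_ge_imp_ge[OF M cont ae(1)])
  moreover have "- b \<le> - p x" for x by (rule AE_ge_imp_ge[OF M continuous_on_minus[OF cont] ae(2)])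
  ultimately have bd: "\<forall>x. a \<le> p x \<and> p x \<le> b" by simp
  then show "\<exists>a b. 0 < a \<and> a \<le> 1 \<and> 1 \<le> b \<and> (\<forall>x. a \<le> p x \<and> p x \<le> b)" using ab by blast
  have "log_holder (\<lambda>x. 1 / (1 / p x))"
  proof (rule log_holder_inverse)
    show "log_holder (\<lambda>x. 1 / p x)" by (rule log_holderI[OF C])
    show "0 < 1 / b" using ab by simp
    show "1 / b \<le> 1 / p x" for x using bd ab pos by (simp add: frac_le)
  qed
  then show "log_holder p" by simp
qed

section \<open>The local Hajlasz class and self-improving integrability\<close>

lemma one_le_mult: "1 \<le> a \<Longrightarrow> 1 \<le> b \<Longrightarrow> 1 \<le> a * (b::real)"
  using mult_mono[of 1 a 1 b] by simp

lemma log_holder_minus: "log_holder f \<Longrightarrow> log_holder (\<lambda>x. - f x)"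
  unfolding log_holder_def by (simp add: abs_minus_commute)

text \<open>If at almost every point of \<open>B\<close> one of the two functions exceeded \<open>3K/m\<close>, their integrals would
add up to at least \<open>3K\<close>.\<close>

lemma exists_point_below_average:
  fixes f g :: "'a \<Rightarrow> real"
  assumes [measurable]: "f \<in> borel_measurable M" "g \<in> borel_measurable M" "B \<in> sets M"
    and nonneg: "\<And>x. 0 \<le> f x" "\<And>x. 0 \<le> g x"
    and K: "0 < K" "(\<integral>\<^sup>+x. ennreal (f x) \<partial>M) \<le> ennreal K" "(\<integral>\<^sup>+x. ennreal (g x) \<partial>M) \<le> ennreal K"
    and N: "N \<in> null_sets M" and m: "0 < m" "ennreal m \<le> emeasure M B"
  shows "\<exists>y\<in>B - N. f y \<le> 3 * K / m \<and> g y \<le> 3 * K / m"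
proof (rule ccontr)
  assume neg: "\<not> ?thesis"
  have *: "ennreal (3 * K / m) * indicator B y \<le> ennreal (f y) + ennreal (g y)" if "y \<notin> N" for y
  proof (cases "y \<in> B")
    case True
    then have "3 * K / m < f y \<or> 3 * K / m < g y" using that neg by (auto simp: not_le)
    then have "3 * K / m \<le> f y + g y" using nonneg[of y] by auto
    then show ?thesis using True nonneg[of y] by (simp add: ennreal_leI flip: ennreal_plus)
  qed simp
  have "ennreal (3 * K) = ennreal (3 * K / m) * ennreal m"
    using K m by (simp flip: ennreal_mult'')
  also have "\<dots> \<le> ennreal (3 * K / m) * emeasure M B" by (intro mult_left_mono m) auto
  also have "\<dots> = (\<integral>\<^sup>+y. ennreal (3 * K / m) * indicator B y \<partial>M)"
    by (simp add: nn_integral_cmult_indicator)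
  also have "\<dots> \<le> (\<integral>\<^sup>+y. ennreal (f y) + ennreal (g y) \<partial>M)"
    using AE_not_in[OF N] * by (intro nn_integral_mono_AE) auto
  also have "\<dots> = (\<integral>\<^sup>+y. ennreal (f y) \<partial>M) + (\<integral>\<^sup>+y. ennreal (g y) \<partial>M)"
    by (rule nn_integral_add) auto
  also have "\<dots> \<le> ennreal K + ennreal K" by (intro add_mono K)
  also have "\<dots> = ennreal (2 * K)" using K by (simp flip: ennreal_plus)
  finally show False using K by (simp add: ennreal_le_iff)
qed

text \<open>Extracts \<open>v\<close> from a bound on \<open>v^e\<close> by an average over a ball of measure about \<open>\<rho>^q\<close>, and moves
the variable exponent from \<open>e\<close>, its value at the chosen point, to \<open>e'\<close>, its value at the centre.\<close>

lemma le_powr_of_powr_le: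
  fixes v :: real
  assumes \<rho>: "0 < \<rho>" and v: "0 \<le> v" "v powr e \<le> A / \<rho> powr q" and A: "0 < A"
    and e: "0 < el" "el \<le> e" and q: "0 \<le> q" "q \<le> qu"
    and D: "1 \<le> D" "\<rho> powr (- (1 / e)) \<le> D * \<rho> powr (- (1 / e'))"
  shows "v \<le> max 1 A powr (1 / el) * D powr qu * \<rho> powr (- (q / e'))"
proof -
  have e0: "0 < e" using e by simp
  have "v = (v powr e) powr (1 / e)" using e0 v by (simp add: powr_powr)
  also have "\<dots> \<le> (A * \<rho> powr (- q)) powr (1 / e)"
    using v e0 by (intro powr_mono2) (auto simp: powr_minus divide_inverse)
  also have "\<dots> = A powr (1 / e) * (\<rho> powr (- (1 / e))) powr q"
    using A by (simp add: powr_mult powr_powr mult.commute)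
  also have "\<dots> \<le> max 1 A powr (1 / el) * (D * \<rho> powr (- (1 / e'))) powr q"
  proof (intro mult_mono)
    have "A powr (1 / e) \<le> max 1 A powr (1 / e)" using A e0 by (intro powr_mono2) auto
    also have "\<dots> \<le> max 1 A powr (1 / el)" using e e0 by (intro powr_mono) (auto simp: frac_le)
    finally show "A powr (1 / e) \<le> max 1 A powr (1 / el)" .
    show "(\<rho> powr (- (1 / e))) powr q \<le> (D * \<rho> powr (- (1 / e'))) powr q"
      using D q by (intro powr_mono2) auto
  qed auto
  also have "\<dots> = max 1 A powr (1 / el) * (D powr q * \<rho> powr (- (q / e')))"
    using D by (simp add: powr_mult powr_powr)
  also have "\<dots> \<le> max 1 A powr (1 / el) * (D powr qu * \<rho> powr (- (q / e')))"
    using D q by (intro mult_left_mono mult_right_mono powr_mono) auto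
  finally show ?thesis by (simp add: mult.assoc)
qed

text \<open>A local version of the Hajlasz gradient with variable smoothness: one function \<open>g\<close> serves all
distances below \<open>1\<close>. Both scales of spaces are reduced to this class.\<close>

definition hajlasz_class :: "'a::metric_space measure \<Rightarrow> ('a \<Rightarrow> real) \<Rightarrow> ('a \<Rightarrow> real) \<Rightarrow> real \<Rightarrow> ('a \<Rightarrow> real) set" where
  "hajlasz_class M p t K = {u \<in> borel_measurable M.
     (\<integral>\<^sup>+x. ennreal (\<bar>u x\<bar> powr p x) \<partial>M) \<le> ennreal K \<and>
     (\<exists>g\<in>borel_measurable M. (\<forall>x. 0 \<le> g x) \<and> (\<integral>\<^sup>+x. ennreal (g x powr p x) \<partial>M) \<le> ennreal K \<and>
       (\<exists>N\<in>null_sets M. \<forall>x\<in>-N. \<forall>y\<in>-N. dist x y < 1 \<longrightarrow>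
          \<bar>u x - u y\<bar> \<le> dist x y powr t x * g x + dist x y powr t y * g y))}"

text \<open>All exponents are bounded at every point, and \<open>\<theta>\<close> measures how far \<open>tp\<close> stays below \<open>Q\<close>.\<close>

locale subcritical =
  fixes M :: "'a::metric_space measure" and p t Q :: "'a \<Rightarrow> real" and pl pu tl Ql Qu b \<theta> :: real
  assumes mms: "metric_measure_space M"
    and p_cont: "continuous_on UNIV p" and p_log: "log_holder p"
    and t_cont: "continuous_on UNIV t" and t_log: "log_holder t"
    and Q_cont: "continuous_on UNIV Q" and Q_log: "log_holder Q"
    and p_bounds: "0 < pl" "\<And>x. pl \<le> p x" "\<And>x. p x \<le> pu"
    and t_bounds: "0 < tl" "\<And>x. tl \<le> t x"
    and Q_bounds: "0 < Ql" "\<And>x. Ql \<le> Q x" "\<And>x. Q x \<le> Qu"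
    and \<theta>: "0 < \<theta>" "\<theta> \<le> 1" "\<And>x. t x * p x \<le> (1 - \<theta>) * Q x"
    and lower_regular: "0 < b" "\<And>x r. 0 < r \<Longrightarrow> r \<le> 1 \<Longrightarrow> ennreal (b * r powr Q x) \<le> emeasure M (ball x r)"
begin

lemma sets_M [measurable_cong, simp]: "sets M = sets borel"
  using mms by (simp add: metric_measure_space_def)

lemma space_M [simp]: "space M = UNIV"
  using sets_eq_imp_space_eq[OF sets_M] by simp

lemma continuous_imp_measurable: "continuous_on UNIV f \<Longrightarrow> f \<in> borel_measurable M"
  using borel_measurable_continuous_onI measurable_cong_sets[OF sets_M] by blast

lemma measurable_exponents [measurable]:
  "p \<in> borel_measurable M" "t \<in> borel_measurable M" "Q \<in> borel_measurable M"
  using p_cont t_cont Q_cont by (auto intro: continuous_imp_measurable)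

lemma p_pos: "0 < p x" and Q_pos: "0 < Q x" and t_pos: "0 < t x"
  using p_bounds(1) p_bounds(2)[of x] Q_bounds(1) Q_bounds(2)[of x] t_bounds(1) t_bounds(2)[of x] by auto

text \<open>A Chebyshev-type form of the Sobolev argument. Where \<open>v = \<bar>u x\<bar>\<close> is large, let \<open>\<rho>^Q = C v^-\<beta>\<close>.
Some \<open>y\<close> in \<open>B(x,\<rho>)\<close> has \<open>\<bar>u y\<bar>^\<beta>\<close> and \<open>g(y)^p\<close> bounded by averages, which makes both
\<open>\<bar>u y\<bar>\<close> and \<open>\<rho>^t g(y)\<close> at most \<open>v/4\<close> if \<open>C\<close> is large; the second bound is where
\<open>1/p - t/Q \<le> 1/\<beta>\<close> is needed. Hence \<open>v/2 \<le> \<rho>^t g(x)\<close>, and inserting \<open>\<rho>\<close> gives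
\<open>v^(p(1 + \<beta>t/Q)) \<le> const g(x)^p\<close>.\<close>

lemma self_improvement_step:
  assumes \<beta>_meas [measurable]: "\<beta> \<in> borel_measurable M" and \<beta>_log: "log_holder \<beta>"
    and \<beta>: "\<And>x. p x \<le> \<beta> x" "\<And>x. \<beta> x \<le> \<beta>u" and sub: "\<And>x. 1 / p x - t x / Q x \<le> 1 / \<beta> x"
    and K: "0 < K"
  shows "\<exists>K'. \<forall>u\<in>hajlasz_class M p t K. (\<integral>\<^sup>+x. ennreal (\<bar>u x\<bar> powr \<beta> x) \<partial>M) \<le> ennreal K \<longrightarrow>
           (\<integral>\<^sup>+x. ennreal (\<bar>u x\<bar> powr (p x * (1 + \<beta> x * t x / Q x))) \<partial>M) \<le> ennreal K'"
proof -
  have \<beta>l: "pl \<le> \<beta> x" for x using \<beta>(1)[of x] p_bounds(2)[of x] by simp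
  have \<beta>0: "0 < \<beta> x" for x using \<beta>l[of x] p_bounds(1) by simp
  have \<beta>u0: "0 < \<beta>u" using \<beta>0[of undefined] \<beta>(2)[of undefined] by linarith
  have log\<beta>: "log_holder (\<lambda>x. - (1 / \<beta> x))" and logp: "log_holder (\<lambda>x. - (1 / p x))"
    using \<beta>l p_bounds p_log \<beta>_log by (auto intro!: log_holder_minus log_holder_inverse)
  obtain D1 where D1: "1 \<le> D1" "\<And>x y r. 0 < r \<Longrightarrow> r \<le> 1 \<Longrightarrow> dist x y < r \<Longrightarrow>
      r powr (- (1 / \<beta> y)) \<le> D1 * r powr (- (1 / \<beta> x))" using log_holderD_powr[OF log\<beta>] by blast
  obtain D2 where D2: "1 \<le> D2" "\<And>x y r. 0 < r \<Longrightarrow> r \<le> 1 \<Longrightarrow> dist x y < r \<Longrightarrow>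
      r powr (- (1 / p y)) \<le> D2 * r powr (- (1 / p x))" using log_holderD_powr[OF logp] by blast
  obtain D3 where D3: "1 \<le> D3" "\<And>x y r. 0 < r \<Longrightarrow> r \<le> 1 \<Longrightarrow> dist x y < r \<Longrightarrow>
      r powr t y \<le> D3 * r powr t x" using log_holderD_powr[OF t_log] by blast
  define D where "D = max D1 (max D2 D3)"
  have D: "1 \<le> D" "D1 \<le> D" "D2 \<le> D" "D3 \<le> D" using D1 by (auto simp: D_def)
  define A where "A = 3 * K / b"
  have A: "0 < A" using K lower_regular(1) by (simp add: A_def)
  define K1 where "K1 = max 1 A powr (1 / pl) * D powr Qu"
  have Qu0: "0 < Qu" using Q_bounds(1) Q_bounds(2)[of undefined] Q_bounds(3)[of undefined] by linarith
  have K1: "1 \<le> K1" unfolding K1_def using D p_bounds(1) Qu0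
    by (intro one_le_mult ge_one_powr_ge_zero) auto
  \<comment> \<open>This \<open>C\<close> makes the two error terms at the nearby point at most a quarter of \<open>\<bar>u x\<bar>\<close> each.\<close>
  define C where "C = (4 * D * K1) powr \<beta>u"
  have C: "1 \<le> C" unfolding C_def using D K1 \<beta>u0
    by (intro ge_one_powr_ge_zero) (auto intro: one_le_mult)
  have Croot: "D * K1 * C powr (- (1 / \<beta> x)) \<le> 1 / 4" for x
  proof -
    have "C powr (- (1 / \<beta> x)) \<le> C powr (- (1 / \<beta>u))"
      using C \<beta>0 \<beta>(2) by (intro powr_mono) (auto simp: frac_le)
    also have "\<dots> = 1 / (4 * D * K1)"
      using \<beta>u0 D K1 by (simp add: C_def powr_powr powr_minus_divide)
    finally have "D * K1 * C powr (- (1 / \<beta> x)) \<le> D * K1 * (1 / (4 * D * K1))"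
      using D K1 by (intro mult_left_mono) auto
    then show ?thesis using D K1 by simp
  qed
  define \<beta>' where "\<beta>' x = p x * (1 + \<beta> x * t x / Q x)" for x
  \<comment> \<open>Above \<open>\<Lambda>\<close> the radius \<open>\<rho>\<close> is at most \<open>1\<close>, as lower regularity and the gradient inequality require.\<close>
  define \<Lambda> where "\<Lambda> = C powr (1 / pl)"
  have \<Lambda>: "1 \<le> \<Lambda>" unfolding \<Lambda>_def using C p_bounds(1) by (intro ge_one_powr_ge_zero) auto
  have \<beta>'_ge: "p x \<le> \<beta>' x" for x
    using p_pos[of x] \<beta>0[of x] t_pos[of x] Q_pos[of x] by (simp add: \<beta>'_def mult_le_cancel_left1)
  have \<beta>'_le: "\<beta>' x \<le> pu + \<beta>u" for x
  proof -
    have "\<beta>' x = p x + \<beta> x * (t x * p x / Q x)" by (simp add: \<beta>'_def field_simps)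
    moreover have "t x * p x / Q x \<le> 1"
      using \<theta>(3)[of x] \<theta>(1) Q_pos[of x] by (auto simp: divide_le_eq intro: order_trans)
    then have "\<beta> x * (t x * p x / Q x) \<le> \<beta> x" using mult_left_mono[of "t x * p x / Q x" 1 "\<beta> x"] \<beta>0[of x] by simp
    ultimately show ?thesis using p_bounds(3)[of x] \<beta>(2)[of x] by linarith
  qed
  define L where "L = \<Lambda> powr (pu + \<beta>u)"
  define G where "G = 2 powr pu * C"
  have L0: "0 \<le> L" and G0: "0 \<le> G" using C by (auto simp: L_def G_def)
  show ?thesis
  proof (intro exI[of _ "L * K + G * K"] ballI impI)
    fix u assume u: "u \<in> hajlasz_class M p t K"
      and u\<beta>: "(\<integral>\<^sup>+x. ennreal (\<bar>u x\<bar> powr \<beta> x) \<partial>M) \<le> ennreal K"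
    from u have um [measurable]: "u \<in> borel_measurable M"
      and up: "(\<integral>\<^sup>+x. ennreal (\<bar>u x\<bar> powr p x) \<partial>M) \<le> ennreal K" by (auto simp: hajlasz_class_def)
    from u obtain g N where g [measurable]: "g \<in> borel_measurable M" and g0: "\<And>x. 0 \<le> g x"
      and gp: "(\<integral>\<^sup>+x. ennreal (g x powr p x) \<partial>M) \<le> ennreal K" and N: "N \<in> null_sets M"
      and grad: "\<And>x y. x \<notin> N \<Longrightarrow> y \<notin> N \<Longrightarrow> dist x y < 1 \<Longrightarrow>
          \<bar>u x - u y\<bar> \<le> dist x y powr t x * g x + dist x y powr t y * g y"
      unfolding hajlasz_class_def by fastforce
    have large: "\<bar>u x\<bar> powr \<beta>' x \<le> G * g x powr p x" if xN: "x \<notin> N" and xL: "\<Lambda> < \<bar>u x\<bar>" for x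
    proof -
      define v where "v = \<bar>u x\<bar>"
      have v1: "1 < v" using xL \<Lambda> by (simp add: v_def)
      have "C = \<Lambda> powr pl" using C p_bounds(1) by (simp add: \<Lambda>_def powr_powr)
      also have "\<dots> \<le> v powr pl" using xL \<Lambda> p_bounds(1) by (intro powr_mono2) (auto simp: v_def)
      also have "\<dots> \<le> v powr \<beta> x" using v1 \<beta>l by (intro powr_mono) auto
      finally have Cv: "C \<le> v powr \<beta> x" .
      define \<rho> where "\<rho> = (C * v powr (- \<beta> x)) powr (1 / Q x)"
      have \<rho>0: "0 < \<rho>" using C v1 by (simp add: \<rho>_def)
      have "C * v powr (- \<beta> x) \<le> 1" using Cv v1 by (simp add: powr_minus field_simps)
      then have \<rho>1: "\<rho> \<le> 1" using Q_pos[of x] C unfolding \<rho>_def by (intro powr_le1) auto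
      have \<rho>p: "\<rho> powr (Q x * e) = C powr e * v powr (- (\<beta> x * e))" for e
        using Q_pos[of x] C v1 by (simp add: \<rho>_def powr_powr powr_mult)
      obtain y where y: "y \<in> ball x \<rho> - N"
          "\<bar>u y\<bar> powr \<beta> y \<le> 3 * K / (b * \<rho> powr Q x)" "g y powr p y \<le> 3 * K / (b * \<rho> powr Q x)"
        using exists_point_below_average[of "\<lambda>y. \<bar>u y\<bar> powr \<beta> y" M "\<lambda>y. g y powr p y" "ball x \<rho>" K N
            "b * \<rho> powr Q x"] K N up u\<beta> gp lower_regular \<rho>0 \<rho>1 by auto
      then have d: "dist x y < \<rho>" "dist x y < 1" "y \<notin> N" using \<rho>1 by auto
      have y': "\<bar>u y\<bar> powr \<beta> y \<le> A / \<rho> powr Q x" "g y powr p y \<le> A / \<rho> powr Q x"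
        using y by (simp_all add: A_def)
      have D1': "\<rho> powr (- (1 / \<beta> y)) \<le> D * \<rho> powr (- (1 / \<beta> x))"
        using D1(2)[OF \<rho>0 \<rho>1 d(1)] D(2) by (meson mult_right_mono order_trans powr_ge_zero)
      have D2': "\<rho> powr (- (1 / p y)) \<le> D * \<rho> powr (- (1 / p x))"
        using D2(2)[OF \<rho>0 \<rho>1 d(1)] D(3) by (meson mult_right_mono order_trans powr_ge_zero)
      have D3': "\<rho> powr t y \<le> D * \<rho> powr t x"
        using D3(2)[OF \<rho>0 \<rho>1 d(1)] D(4) by (meson mult_right_mono order_trans powr_ge_zero)
      have uy: "\<bar>u y\<bar> \<le> K1 * \<rho> powr (- (Q x / \<beta> x))"
        unfolding K1_def using \<rho>0 y'(1) A p_bounds(1) \<beta>l Q_pos[of x] Q_bounds(3) D(1) D1'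
        by (intro le_powr_of_powr_le) auto
      have gy: "g y \<le> K1 * \<rho> powr (- (Q x / p x))"
        unfolding K1_def using \<rho>0 g0 y'(2) A p_bounds Q_pos[of x] Q_bounds(3) D(1) D2'
        by (intro le_powr_of_powr_le) auto
      have \<rho>\<beta>: "D * K1 * \<rho> powr (- (Q x / \<beta> x)) \<le> v / 4"
      proof -
        have "\<rho> powr (- (Q x / \<beta> x)) = C powr (- (1 / \<beta> x)) * v"
          using \<rho>p[of "- (1 / \<beta> x)"] \<beta>0[of x] v1 by simp
        then show ?thesis using mult_right_mono[OF Croot[of x], of v] v1 by (simp add: mult.assoc)
      qed
      have uy': "\<bar>u y\<bar> \<le> v / 4"
      proof -
        have "K1 * \<rho> powr (- (Q x / \<beta> x)) \<le> D * (K1 * \<rho> powr (- (Q x / \<beta> x)))"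
          using mult_right_mono[of 1 D "K1 * \<rho> powr (- (Q x / \<beta> x))"] D(1) K1 by simp
        then show ?thesis using uy \<rho>\<beta> by (simp add: mult.assoc)
      qed
      have "dist x y powr t y * g y \<le> \<rho> powr t y * g y"
        using d t_pos[of y] g0[of y] by (intro mult_right_mono powr_mono2) auto
      also have "\<dots> \<le> (D * \<rho> powr t x) * (K1 * \<rho> powr (- (Q x / p x)))"
        using D3' gy g0[of y] D(1) by (intro mult_mono) auto
      also have "\<dots> = D * K1 * \<rho> powr (t x - Q x / p x)"
        using \<rho>0 by (simp add: powr_diff powr_minus_divide)
      also have "\<dots> \<le> D * K1 * \<rho> powr (- (Q x / \<beta> x))"
      proof -
        have "Q x * (1 / p x - t x / Q x) \<le> Q x * (1 / \<beta> x)"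
          using sub[of x] Q_pos[of x] by (intro mult_left_mono) auto
        then have "- (Q x / \<beta> x) \<le> t x - Q x / p x"
          using Q_pos[of x] by (simp add: right_diff_distrib)
        then have "\<rho> powr (t x - Q x / p x) \<le> \<rho> powr (- (Q x / \<beta> x))"
          using \<rho>0 \<rho>1 by (intro powr_mono') auto
        then show ?thesis using D(1) K1 by (intro mult_left_mono) auto
      qed
      finally have gy': "dist x y powr t y * g y \<le> v / 4" using \<rho>\<beta> by simp
      have gx: "dist x y powr t x * g x \<le> \<rho> powr t x * g x"
        using d t_pos[of x] g0[of x] by (intro mult_right_mono powr_mono2) auto
      have "v \<le> \<bar>u y\<bar> + \<bar>u x - u y\<bar>" unfolding v_def by simp
      also have "\<dots> \<le> v / 4 + (\<rho> powr t x * g x + v / 4)"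
        using grad[OF xN d(3,2)] uy' gy' gx by simp
      finally have "v \<le> 2 * (\<rho> powr t x * g x)" by simp
      also have "\<rho> powr t x = C powr (t x / Q x) * v powr (- (\<beta> x * t x / Q x))"
        using \<rho>p[of "t x / Q x"] Q_pos[of x] by simp
      finally have "v * v powr (\<beta> x * t x / Q x) \<le> 2 * (C powr (t x / Q x) * g x)"
        using v1 by (simp add: powr_minus field_simps)
      then have "(v powr (1 + \<beta> x * t x / Q x)) powr p x \<le> (2 * (C powr (t x / Q x) * g x)) powr p x"
        using v1 p_pos[of x] by (intro powr_mono2) (auto simp: powr_add)
      then have "v powr \<beta>' x \<le> 2 powr p x * (C powr (t x * p x / Q x) * g x powr p x)"
        using C g0[of x] by (simp add: powr_powr powr_mult \<beta>'_def mult.commute)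
      also have "\<dots> \<le> 2 powr pu * (C powr 1 * g x powr p x)"
      proof -
        have "t x * p x / Q x \<le> 1"
          using \<theta>(3)[of x] \<theta>(1) Q_pos[of x] by (auto simp: divide_le_eq intro: order_trans)
        then have "C powr (t x * p x / Q x) \<le> C powr 1" using C by (intro powr_mono)
        moreover have "(2::real) powr p x \<le> 2 powr pu" using p_bounds(3) by (intro powr_mono) auto
        ultimately show ?thesis by (intro mult_mono) auto
      qed
      finally show ?thesis using C by (simp add: v_def G_def mult.assoc)
    qed
    have small: "\<bar>u x\<bar> powr \<beta>' x \<le> L * \<bar>u x\<bar> powr p x" if "\<bar>u x\<bar> \<le> \<Lambda>" for x
    proof (cases "u x = 0")
      case False
      have "\<bar>u x\<bar> powr \<beta>' x = \<bar>u x\<bar> powr (\<beta>' x - p x) * \<bar>u x\<bar> powr p x"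
        by (simp flip: powr_add)
      also have "\<bar>u x\<bar> powr (\<beta>' x - p x) \<le> \<Lambda> powr (\<beta>' x - p x)"
        using that \<beta>'_ge[of x] by (intro powr_mono2) auto
      also have "\<Lambda> powr (\<beta>' x - p x) \<le> L"
        unfolding L_def using \<Lambda> \<beta>'_le[of x] p_pos[of x] by (intro powr_mono) auto
      finally show ?thesis by (simp add: mult_right_mono)
    qed simp
    have "(\<integral>\<^sup>+x. ennreal (\<bar>u x\<bar> powr \<beta>' x) \<partial>M)
        \<le> (\<integral>\<^sup>+x. ennreal L * ennreal (\<bar>u x\<bar> powr p x) + ennreal G * ennreal (g x powr p x) \<partial>M)"
    proof (intro nn_integral_mono_AE)
      show "AE x in M. ennreal (\<bar>u x\<bar> powr \<beta>' x)
          \<le> ennreal L * ennreal (\<bar>u x\<bar> powr p x) + ennreal G * ennreal (g x powr p x)"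
        using AE_not_in[OF N]
      proof eventually_elim
        case (elim x)
        have "\<bar>u x\<bar> powr \<beta>' x \<le> L * \<bar>u x\<bar> powr p x + G * g x powr p x"
          using large[OF elim] small[of x] L0 G0
          by (cases "\<bar>u x\<bar> \<le> \<Lambda>") (auto intro: add_increasing2 add_increasing)
        then show ?case using L0 G0
          by (simp add: ennreal_leI flip: ennreal_mult ennreal_plus)
      qed
    qed
    also have "\<dots> = ennreal L * (\<integral>\<^sup>+x. ennreal (\<bar>u x\<bar> powr p x) \<partial>M) + ennreal G * (\<integral>\<^sup>+x. ennreal (g x powr p x) \<partial>M)"
      by (simp add: nn_integral_add nn_integral_cmult)
    also have "\<dots> \<le> ennreal L * ennreal K + ennreal G * ennreal K"
      by (intro add_mono mult_left_mono up gp) auto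
    also have "\<dots> = ennreal (L * K + G * K)" using L0 G0 K by (simp add: ennreal_mult)
    finally show "(\<integral>\<^sup>+x. ennreal (\<bar>u x\<bar> powr (p x * (1 + \<beta> x * t x / Q x))) \<partial>M) \<le> ennreal (L * K + G * K)"
      by (simp add: \<beta>'_def)
  qed
qed

end

lemma hajlasz_class_mono: "K \<le> K' \<Longrightarrow> hajlasz_class M p t K \<subseteq> hajlasz_class M p t K'"
proof (rule subsetI)
  fix u assume "K \<le> K'" and u: "u \<in> hajlasz_class M p t K"
  then have le: "I \<le> ennreal K \<Longrightarrow> I \<le> ennreal K'" for I by (meson ennreal_leI order_trans)
  from u le show "u \<in> hajlasz_class M p t K'" unfolding hajlasz_class_def by blast
qed

text \<open>The map \<open>\<beta> \<mapsto> p(1 + \<beta>t/Q)\<close> contracts towards its fixed point \<open>\<sigma> = Qp/(Q - tp)\<close> with factor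
\<open>tp/Q \<le> 1 - \<theta>\<close>, so finitely many steps starting from \<open>p\<close> come within \<open>e\<close> of \<open>\<sigma>\<close>
uniformly in \<open>x\<close>.\<close>

lemma (in subcritical) improved_integrability:
  assumes e: "0 < e"
  shows "\<exists>\<tau> \<tau>u. \<tau> \<in> borel_measurable M \<and> (\<forall>x. p x \<le> \<tau> x \<and> \<tau> x \<le> \<tau>u) \<and>
     (\<forall>x. Q x * p x / (Q x - t x * p x) - e \<le> \<tau> x) \<and>
     (\<forall>K>0. \<exists>K'. \<forall>u\<in>hajlasz_class M p t K. (\<integral>\<^sup>+x. ennreal (\<bar>u x\<bar> powr \<tau> x) \<partial>M) \<le> ennreal K')"
proof -
  define \<sigma> where "\<sigma> x = Q x * p x / (Q x - t x * p x)" for x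
  define k where "k x = t x * p x / Q x" for x
  have k: "0 \<le> k x" "k x \<le> 1 - \<theta>" for x
    using t_pos[of x] p_pos[of x] Q_pos[of x] \<theta>(3)[of x] by (auto simp: k_def divide_le_eq)
  have gap: "\<theta> * Q x \<le> Q x - t x * p x" for x using \<theta>(3)[of x] by (simp add: algebra_simps)
  have gap0: "0 < Q x - t x * p x" for x using gap[of x] \<theta>(1) Q_pos[of x] by (smt (verit) mult_pos_pos)
  have \<sigma>_fix: "\<sigma> x = p x + k x * \<sigma> x" for x
    using gap0[of x] Q_pos[of x] by (simp add: \<sigma>_def k_def field_simps)
  have \<sigma>_le: "\<sigma> x \<le> pu / \<theta>" for x
  proof -
    have "\<sigma> x \<le> Q x * p x / (\<theta> * Q x)"
      unfolding \<sigma>_def using gap[of x] gap0[of x] \<theta>(1) Q_pos[of x] p_pos[of x] by (intro divide_left_mono) auto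
    also have "\<dots> = p x / \<theta>" using Q_pos[of x] by simp
    also have "\<dots> \<le> pu / \<theta>" using p_bounds(3) \<theta>(1) by (intro divide_right_mono) auto
    finally show ?thesis .
  qed
  have \<sigma>0: "0 < \<sigma> x" for x using gap0[of x] p_pos[of x] Q_pos[of x] by (simp add: \<sigma>_def)
  have inv\<sigma>: "1 / \<sigma> x = 1 / p x - t x / Q x" for x
    using gap0[of x] p_pos[of x] Q_pos[of x] by (simp add: \<sigma>_def field_simps)
  define F where "F \<beta> x = p x * (1 + \<beta> x * t x / Q x)" for \<beta> x
  have F_eq: "F \<beta> x = p x + k x * \<beta> x" for \<beta> x by (simp add: F_def k_def field_simps)
  define B where "B n = (F ^^ n) p" for n
  have B0: "B 0 = p" and BS: "B (Suc n) = F (B n)" for n by (simp_all add: B_def)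
  have pu0: "0 < pu" using p_pos[of undefined] p_bounds(3)[of undefined] by linarith
  have bds: "p x \<le> B n x \<and> B n x \<le> \<sigma> x \<and> \<sigma> x - B n x \<le> (1 - \<theta>) ^ n * (pu / \<theta>)" for n x
  proof (induction n)
    case 0
    have "0 \<le> k x * \<sigma> x" using k[of x] \<sigma>0[of x] by simp
    then show ?case using \<sigma>_fix[of x] \<sigma>_le[of x] p_pos[of x] by (simp add: B0)
  next
    case (Suc n)
    have "0 \<le> k x * B n x" using k[of x] Suc p_pos[of x] by (intro mult_nonneg_nonneg) auto
    moreover have "k x * B n x \<le> k x * \<sigma> x" using k[of x] Suc by (intro mult_left_mono) auto
    moreover have "k x * (\<sigma> x - B n x) \<le> (1 - \<theta>) * ((1 - \<theta>) ^ n * (pu / \<theta>))"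
      using k[of x] Suc \<theta> by (intro mult_mono) auto
    ultimately show ?case using \<sigma>_fix[of x] by (simp add: BS F_eq right_diff_distrib mult.assoc)
  qed
  have Bu: "B n x \<le> pu / \<theta>" for n x using bds[of x n] \<sigma>_le[of x] by simp
  have B_pos: "0 < B n x" for n x using bds[of x n] p_pos[of x] by simp
  have meas: "B n \<in> borel_measurable M" for n
  proof (induction n)
    case 0 show ?case by (simp add: B0)
  next
    case (Suc n)
    note [measurable] = Suc
    have "(\<lambda>x. p x * (1 + B n x * t x / Q x)) \<in> borel_measurable M" by measurable
    then show ?case by (simp add: BS F_def[abs_def])
  qed
  have t_le: "t x \<le> Qu / pl" for x
  proof -
    have "t x * pl \<le> t x * p x" using t_pos[of x] p_bounds by (intro mult_left_mono) auto
    also have "\<dots> \<le> Q x" using gap0[of x] by simp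
    also have "\<dots> \<le> Qu" by (rule Q_bounds)
    finally show ?thesis using p_bounds(1) by (simp add: field_simps)
  qed
  have log: "log_holder (B n)" for n
  proof (induction n)
    case 0 show ?case using p_log by (simp add: B0)
  next
    case (Suc n)
    have 1: "log_holder (\<lambda>x. 1 / Q x)" by (rule log_holder_inverse[OF Q_log Q_bounds(1,2)])
    have Qi: "\<bar>1 / Q x\<bar> \<le> 1 / Ql" for x using Q_bounds(1) Q_bounds(2)[of x] Q_pos[of x] by (simp add: frac_le)
    have 2: "log_holder (\<lambda>x. t x * (1 / Q x))"
      using t_pos t_le Qi by (intro log_holder_mult[where F = "Qu / pl" and G = "1 / Ql"] t_log 1) (auto simp: less_imp_le abs_of_pos)
    have kk: "\<bar>t x * (1 / Q x)\<bar> \<le> Qu / pl * (1 / Ql)" for x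
      unfolding abs_mult using t_pos[of x] t_le[of x] Qi[of x] by (intro mult_mono) auto
    have 3: "log_holder (\<lambda>x. B n x * (t x * (1 / Q x)))"
      using B_pos Bu kk by (intro log_holder_mult[where F = "pu / \<theta>" and G = "Qu / pl * (1 / Ql)"] Suc 2)
         (auto simp: less_imp_le abs_of_pos)
    have 4: "log_holder (\<lambda>x. 1 + B n x * (t x * (1 / Q x)))" by (intro log_holder_add log_holder_const 3)
    have b4: "\<bar>1 + B n x * (t x * (1 / Q x))\<bar> \<le> 1 + pu / \<theta> * (Qu / pl * (1 / Ql))" for x
    proof -
      have "\<bar>B n x * (t x * (1 / Q x))\<bar> \<le> pu / \<theta> * (Qu / pl * (1 / Ql))"
        unfolding abs_mult[of "B n x"] using B_pos[of n x] Bu[of n x] kk[of x] by (intro mult_mono) auto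
      then show ?thesis by linarith
    qed
    have "log_holder (\<lambda>x. p x * (1 + B n x * (t x * (1 / Q x))))"
      by (rule log_holder_mult[OF p_log 4 _ b4, where F = pu]) (use p_pos p_bounds in \<open>auto simp: abs_of_pos\<close>)
    then show ?case by (simp add: BS F_def[abs_def])
  qed
  have int: "\<forall>K>0. \<exists>K'. \<forall>u\<in>hajlasz_class M p t K. (\<integral>\<^sup>+x. ennreal (\<bar>u x\<bar> powr B n x) \<partial>M) \<le> ennreal K'" for n
  proof (induction n)
    case 0 show ?case by (auto simp: B0 hajlasz_class_def)
  next
    case (Suc n)
    show ?case
    proof (intro allI impI)
      fix K :: real assume K: "0 < K"
      obtain K1 where K1: "\<And>u. u \<in> hajlasz_class M p t K \<Longrightarrow> (\<integral>\<^sup>+x. ennreal (\<bar>u x\<bar> powr B n x) \<partial>M) \<le> ennreal K1"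
        using Suc K by blast
      have "\<exists>K'. \<forall>u\<in>hajlasz_class M p t (max K K1). (\<integral>\<^sup>+x. ennreal (\<bar>u x\<bar> powr B n x) \<partial>M) \<le> ennreal (max K K1) \<longrightarrow>
           (\<integral>\<^sup>+x. ennreal (\<bar>u x\<bar> powr (p x * (1 + B n x * t x / Q x))) \<partial>M) \<le> ennreal K'"
      proof (rule self_improvement_step[OF meas log _ Bu])
        show "p x \<le> B n x" for x using bds by blast
        show "1 / p x - t x / Q x \<le> 1 / B n x" for x
          using bds[of x n] B_pos[of n x] by (simp add: frac_le flip: inv\<sigma>)
        show "0 < max K K1" using K by simp
      qed
      then obtain K' where K': "\<forall>u\<in>hajlasz_class M p t (max K K1). (\<integral>\<^sup>+x. ennreal (\<bar>u x\<bar> powr B n x) \<partial>M) \<le> ennreal (max K K1) \<longrightarrow>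
           (\<integral>\<^sup>+x. ennreal (\<bar>u x\<bar> powr (p x * (1 + B n x * t x / Q x))) \<partial>M) \<le> ennreal K'" by blast
      have "(\<integral>\<^sup>+x. ennreal (\<bar>u x\<bar> powr B (Suc n) x) \<partial>M) \<le> ennreal K'"
        if u: "u \<in> hajlasz_class M p t K" for u
      proof -
        have "u \<in> hajlasz_class M p t (max K K1)" using u hajlasz_class_mono[of K "max K K1"] by auto
        moreover have "(\<integral>\<^sup>+x. ennreal (\<bar>u x\<bar> powr B n x) \<partial>M) \<le> ennreal (max K K1)"
          using K1[OF u] by (rule order_trans) (auto intro: ennreal_leI)
        ultimately show ?thesis using K' by (simp add: BS F_def)
      qed
      then show "\<exists>K'. \<forall>u\<in>hajlasz_class M p t K. (\<integral>\<^sup>+x. ennreal (\<bar>u x\<bar> powr B (Suc n) x) \<partial>M) \<le> ennreal K'" by blast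
    qed
  qed
  have "(\<lambda>n. (1 - \<theta>) ^ n * (pu / \<theta>)) \<longlonglongrightarrow> 0 * (pu / \<theta>)"
    using \<theta> by (intro tendsto_mult LIMSEQ_realpow_zero tendsto_const) auto
  then have "eventually (\<lambda>n. (1 - \<theta>) ^ n * (pu / \<theta>) < e) sequentially"
    using e by (intro order_tendstoD) auto
  then obtain n where n: "(1 - \<theta>) ^ n * (pu / \<theta>) < e" by (auto simp: eventually_sequentially)
  show ?thesis
  proof (intro exI[of _ "B n"] exI[of _ "pu / \<theta>"] conjI allI int[rule_format])
    show "Q x * p x / (Q x - t x * p x) - e \<le> B n x" for x
      using bds[of x n] n unfolding \<sigma>_def[symmetric] by linarith
  qed (use bds Bu meas int in auto)
qed

section \<open>Interpolation in measure\<close>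

text \<open>Small values are controlled by the \<open>p\<close>-integral, large ones by the \<open>\<tau>\<close>-integral, and those in
between by the measure of the set where they occur.\<close>

lemma interpolation_in_measure:
  fixes M :: "'a measure"
  assumes [measurable]: "p \<in> borel_measurable M" "\<tau> \<in> borel_measurable M"
    and e: "0 < e" and \<beta>: "AE x in M. 0 \<le> p x \<and> p x + e \<le> \<beta> x \<and> \<beta> x \<le> \<tau> x - e \<and> \<beta> x \<le> \<beta>u"
    and K: "0 < K" and \<epsilon>: "0 < \<epsilon>"
  shows "\<exists>\<eta>>0. \<exists>\<delta>>0. \<forall>w\<in>borel_measurable M.
     (\<integral>\<^sup>+x. ennreal (\<bar>w x\<bar> powr p x) \<partial>M) \<le> ennreal K \<longrightarrow> (\<integral>\<^sup>+x. ennreal (\<bar>w x\<bar> powr \<tau> x) \<partial>M) \<le> ennreal K \<longrightarrow>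
     emeasure M {x\<in>space M. \<eta> < \<bar>w x\<bar>} \<le> ennreal \<delta> \<longrightarrow> (\<integral>\<^sup>+x. ennreal (\<bar>w x\<bar> powr \<beta> x) \<partial>M) \<le> ennreal \<epsilon>"
proof -
  \<comment> \<open>Values count as small below \<open>\<eta>\<close> and as large above \<open>1/\<eta>\<close>; both outer parts then gain the factor \<open>\<eta>^e\<close>.\<close>
  define \<eta> where "\<eta> = min 1 ((\<epsilon> / (3 * K)) powr (1 / e))"
  have \<eta>: "0 < \<eta>" "\<eta> \<le> 1" using K \<epsilon> by (auto simp: \<eta>_def)
  have "\<eta> powr e \<le> ((\<epsilon> / (3 * K)) powr (1 / e)) powr e" using e \<eta> by (intro powr_mono2) (auto simp: \<eta>_def)
  also have "\<dots> = \<epsilon> / (3 * K)" using e K \<epsilon> by (simp add: powr_powr)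
  finally have \<eta>e: "\<eta> powr e * K \<le> \<epsilon> / 3" using K by (simp add: field_simps)
  define S where "S = (1 / \<eta>) powr \<bar>\<beta>u\<bar>"
  have S: "0 < S" using \<eta> by (simp add: S_def)
  have pw: "a powr \<beta>' \<le> \<eta> powr e * a powr p' + \<eta> powr e * a powr \<tau>' + (if \<eta> < a then S else 0)"
    if a: "0 \<le> a" and ex: "0 \<le> p'" "p' + e \<le> \<beta>'" "\<beta>' \<le> \<tau>' - e" "\<beta>' \<le> \<beta>u" for a p' \<beta>' \<tau>' :: real
  proof (cases "a = 0")
    case a0: False
    consider "a \<le> \<eta>" | "1 / \<eta> \<le> a" | "\<eta> < a" "a < 1 / \<eta>" by linarith
    then show ?thesis
    proof cases
      case 1
      have "a powr \<beta>' = a powr (\<beta>' - p') * a powr p'" using a0 by (simp flip: powr_add)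
      also have "a powr (\<beta>' - p') \<le> \<eta> powr (\<beta>' - p')" using a ex e 1 by (intro powr_mono2) auto
      also have "\<dots> \<le> \<eta> powr e" using \<eta> ex by (intro powr_mono') auto
      finally show ?thesis using S by (simp add: mult_right_mono add_increasing2)
    next
      case 2
      have "a powr \<beta>' = a powr (- (\<tau>' - \<beta>')) * a powr \<tau>'" using a0 by (simp flip: powr_add)
      also have "a powr (- (\<tau>' - \<beta>')) \<le> (1 / \<eta>) powr (- (\<tau>' - \<beta>'))" using \<eta> ex e 2 by (intro powr_mono2') auto
      also have "\<dots> = \<eta> powr (\<tau>' - \<beta>')" using \<eta> by (simp add: powr_divide powr_minus flip: powr_minus_divide)
      also have "\<dots> \<le> \<eta> powr e" using \<eta> ex by (intro powr_mono') auto
      finally have "a powr \<beta>' \<le> \<eta> powr e * a powr \<tau>'" by (simp add: mult_right_mono)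
      moreover have "0 \<le> \<eta> powr e * a powr p'" by simp
      moreover have "0 \<le> (if \<eta> < a then S else 0)" using S by simp
      ultimately show ?thesis by linarith
    next
      case 3
      have "a powr \<beta>' \<le> (1 / \<eta>) powr \<beta>'" using 3 a ex e by (intro powr_mono2) auto
      also have "\<dots> \<le> S" unfolding S_def using \<eta> ex by (intro powr_mono) auto
      finally show ?thesis using 3 by (auto intro: add_increasing)
    qed
  qed (use S in auto)
  show ?thesis
  proof (rule exI[of _ \<eta>], rule conjI[OF \<eta>(1)], rule exI[of _ "\<epsilon> / (3 * S)"], intro conjI ballI impI)
    fix w assume [measurable]: "w \<in> borel_measurable M"
      and wp: "(\<integral>\<^sup>+x. ennreal (\<bar>w x\<bar> powr p x) \<partial>M) \<le> ennreal K"
      and w\<tau>: "(\<integral>\<^sup>+x. ennreal (\<bar>w x\<bar> powr \<tau> x) \<partial>M) \<le> ennreal K"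
      and w\<eta>: "emeasure M {x\<in>space M. \<eta> < \<bar>w x\<bar>} \<le> ennreal (\<epsilon> / (3 * S))"
    have "(\<integral>\<^sup>+x. ennreal (\<bar>w x\<bar> powr \<beta> x) \<partial>M)
       \<le> (\<integral>\<^sup>+x. ennreal (\<eta> powr e) * ennreal (\<bar>w x\<bar> powr p x) + ennreal (\<eta> powr e) * ennreal (\<bar>w x\<bar> powr \<tau> x)
            + ennreal S * indicator {x\<in>space M. \<eta> < \<bar>w x\<bar>} x \<partial>M)"
    proof (rule nn_integral_mono_AE, use \<beta> AE_space in eventually_elim)
      case (elim x)
      then have "\<bar>w x\<bar> powr \<beta> x \<le> \<eta> powr e * \<bar>w x\<bar> powr p x + \<eta> powr e * \<bar>w x\<bar> powr \<tau> x + (if \<eta> < \<bar>w x\<bar> then S else 0)"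
        by (intro pw) auto
      then show ?case using elim S
        by (auto simp: ennreal_leI indicator_def simp flip: ennreal_mult ennreal_plus split: if_splits)
    qed
    also have "\<dots> = ennreal (\<eta> powr e) * (\<integral>\<^sup>+x. ennreal (\<bar>w x\<bar> powr p x) \<partial>M)
         + ennreal (\<eta> powr e) * (\<integral>\<^sup>+x. ennreal (\<bar>w x\<bar> powr \<tau> x) \<partial>M) + ennreal S * emeasure M {x\<in>space M. \<eta> < \<bar>w x\<bar>}"
      by (simp add: nn_integral_add nn_integral_cmult nn_integral_cmult_indicator)
    also have "\<dots> \<le> ennreal (\<eta> powr e) * ennreal K + ennreal (\<eta> powr e) * ennreal K + ennreal S * ennreal (\<epsilon> / (3 * S))"
      by (intro add_mono mult_left_mono wp w\<tau> w\<eta>) auto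
    also have "\<dots> = ennreal (\<eta> powr e * K + \<eta> powr e * K + \<epsilon> / 3)"
      using S K \<epsilon> by (simp flip: ennreal_mult ennreal_plus)
    also have "\<dots> \<le> ennreal \<epsilon>" using \<eta>e by (intro ennreal_leI) linarith
    finally show "(\<integral>\<^sup>+x. ennreal (\<bar>w x\<bar> powr \<beta> x) \<partial>M) \<le> ennreal \<epsilon>" .
  qed (use \<eta> S \<epsilon> in auto)
qed

lemma integral_diff_powr_le:
  fixes M :: "'a measure"
  assumes [measurable]: "u \<in> borel_measurable M" "v \<in> borel_measurable M" "p \<in> borel_measurable M"
    and p: "\<And>x. 0 \<le> p x" "\<And>x. p x \<le> pu"
    and K: "0 \<le> K" "(\<integral>\<^sup>+x. ennreal (\<bar>u x\<bar> powr p x) \<partial>M) \<le> ennreal K" "(\<integral>\<^sup>+x. ennreal (\<bar>v x\<bar> powr p x) \<partial>M) \<le> ennreal K"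
  shows "(\<integral>\<^sup>+x. ennreal (\<bar>(u - v) x\<bar> powr p x) \<partial>M) \<le> ennreal (2 powr pu * (K + K))"
proof -
  have pw: "\<bar>a - c\<bar> powr e \<le> 2 powr pu * (\<bar>a\<bar> powr e + \<bar>c\<bar> powr e)" if e: "0 \<le> e" "e \<le> pu" for a c e :: real
  proof -
    have "\<bar>a - c\<bar> powr e \<le> (2 * max \<bar>a\<bar> \<bar>c\<bar>) powr e" using e by (intro powr_mono2) auto
    also have "\<dots> = 2 powr e * max \<bar>a\<bar> \<bar>c\<bar> powr e" by (simp add: powr_mult)
    also have "\<dots> \<le> 2 powr pu * (\<bar>a\<bar> powr e + \<bar>c\<bar> powr e)"
      using e by (intro mult_mono powr_mono) (auto simp: max_def)
    finally show ?thesis .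
  qed
  have "(\<integral>\<^sup>+x. ennreal (\<bar>(u - v) x\<bar> powr p x) \<partial>M)
      \<le> (\<integral>\<^sup>+x. ennreal (2 powr pu) * (ennreal (\<bar>u x\<bar> powr p x) + ennreal (\<bar>v x\<bar> powr p x)) \<partial>M)"
    using pw[OF p] by (intro nn_integral_mono) (auto simp: ennreal_leI simp flip: ennreal_mult ennreal_plus)
  also have "\<dots> = ennreal (2 powr pu) * ((\<integral>\<^sup>+x. ennreal (\<bar>u x\<bar> powr p x) \<partial>M) + (\<integral>\<^sup>+x. ennreal (\<bar>v x\<bar> powr p x) \<partial>M))"
    by (simp add: nn_integral_add nn_integral_cmult)
  also have "\<dots> \<le> ennreal (2 powr pu) * (ennreal K + ennreal K)" by (intro mult_left_mono add_mono K) auto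
  also have "\<dots> = ennreal (2 powr pu * (K + K))" using K(1) by (simp add: ennreal_mult flip: ennreal_plus)
  finally show ?thesis .
qed

section \<open>Coverings in geometrically doubling spaces\<close>

lemma doubling_cover:
  assumes "geometrically_doubling TYPE('a::metric_space)"
  obtains m :: nat where "\<And>n (x::'a) r. 0 < r \<Longrightarrow> \<exists>C. finite C \<and> card C \<le> m ^ n \<and> ball x r \<subseteq> (\<Union>c\<in>C. ball c (r / 2 ^ n))"
proof -
  obtain m :: nat where m: "\<And>(x::'a) r. 0 < r \<Longrightarrow> \<exists>C. finite C \<and> card C \<le> m \<and> ball x r \<subseteq> (\<Union>c\<in>C. ball c (r / 2))"
    using assms unfolding geometrically_doubling_def by blast
  show ?thesis
  proof (rule that[of m])
    fix n and x :: 'a and r :: real assume r: "0 < r"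
    show "\<exists>C. finite C \<and> card C \<le> m ^ n \<and> ball x r \<subseteq> (\<Union>c\<in>C. ball c (r / 2 ^ n))"
    proof (induction n)
      case 0 show ?case by (intro exI[of _ "{x}"]) auto
    next
      case (Suc n)
      then obtain C where C: "finite C" "card C \<le> m ^ n" "ball x r \<subseteq> (\<Union>c\<in>C. ball c (r / 2 ^ n))" by blast
      have "\<exists>D. finite D \<and> card D \<le> m \<and> ball c (r / 2 ^ n) \<subseteq> (\<Union>d\<in>D. ball d (r / 2 ^ n / 2))" for c :: 'a
        by (rule m) (use r in simp)
      then have "\<forall>c::'a. \<exists>D. finite D \<and> card D \<le> m \<and> ball c (r / 2 ^ n) \<subseteq> (\<Union>d\<in>D. ball d (r / 2 ^ n / 2))"
        by blast
      from choice[OF this] obtain D where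
        D': "\<forall>c::'a. finite (D c) \<and> card (D c) \<le> m \<and> ball c (r / 2 ^ n) \<subseteq> (\<Union>d\<in>D c. ball d (r / 2 ^ n / 2))"
        ..
      have D: "finite (D c)" "card (D c) \<le> m" "ball c (r / 2 ^ n) \<subseteq> (\<Union>d\<in>D c. ball d (r / 2 ^ n / 2))" for c
        using D'[rule_format, of c] by simp_all
      have "card (\<Union>c\<in>C. D c) \<le> (\<Sum>c\<in>C. card (D c))" by (rule card_UN_le[OF C(1)])
      also have "\<dots> \<le> card C * m" using sum_bounded_above[of C "\<lambda>c. card (D c)" m] D(2) by simp
      also have "\<dots> \<le> m ^ n * m" using C(2) by simp
      finally have "card (\<Union>c\<in>C. D c) \<le> m ^ Suc n" by (simp add: mult.commute)
      moreover have "ball x r \<subseteq> (\<Union>c\<in>(\<Union>c\<in>C. D c). ball c (r / 2 ^ Suc n))"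
      proof
        fix y assume "y \<in> ball x r"
        then obtain c where "c \<in> C" "y \<in> ball c (r / 2 ^ n)" using C(3) by auto
        then obtain d where "d \<in> D c" "y \<in> ball d (r / 2 ^ n / 2)" using D(3)[of c] by auto
        then show "y \<in> (\<Union>c\<in>(\<Union>c\<in>C. D c). ball c (r / 2 ^ Suc n))"
          using \<open>c \<in> C\<close> by (auto simp: mult.commute)
      qed
      ultimately show ?case using C(1) D(1) by (intro exI[of _ "\<Union>c\<in>C. D c"]) auto
    qed
  qed
qed

lemma separated_subset_finite:
  fixes A :: "'a::metric_space set"
  assumes C: "finite C" "S \<subseteq> (\<Union>c\<in>C. ball c (\<rho> / 2))"
    and sep: "\<And>a a'. a \<in> A \<Longrightarrow> a' \<in> A \<Longrightarrow> a \<noteq> a' \<Longrightarrow> \<rho> \<le> dist a a'" and A: "A \<subseteq> S"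
  shows "finite A \<and> card A \<le> card C"
proof -
  have "\<forall>a\<in>A. \<exists>c\<in>C. dist c a < \<rho> / 2" using A C(2) by (force simp: mem_ball)
  then obtain f where f: "\<And>a. a \<in> A \<Longrightarrow> f a \<in> C \<and> dist (f a) a < \<rho> / 2" by metis
  have "inj_on f A"
  proof (rule inj_onI, rule ccontr)
    fix a a' assume *: "a \<in> A" "a' \<in> A" "f a = f a'" "a \<noteq> a'"
    have "dist a a' \<le> dist (f a) a + dist (f a) a'" by (rule dist_triangle3)
    with f[OF *(1)] f[OF *(2)] *(3) sep[OF *(1,2,4)] show False by simp
  qed
  moreover have "f ` A \<subseteq> C" using f by auto
  ultimately show ?thesis using C(1) by (metis card_inj_on_le finite_imageD finite_subset)
qed

text \<open>A maximal \<open>\<rho>\<close>-separated subset of \<open>S\<close> provides the centres. Doubling bounds the number of centres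
in a ball of radius \<open>\<rho>\<close>, hence the overlap, independently of \<open>\<rho>\<close>; it also makes the set of
centres countable.\<close>

lemma bounded_overlap_cover:
  assumes "geometrically_doubling TYPE('a::metric_space)"
  obtains N :: nat where "\<And>(S :: 'a set) \<rho>. 0 < \<rho> \<Longrightarrow> \<exists>A\<subseteq>S. countable A \<and> S \<subseteq> (\<Union>a\<in>A. ball a \<rho>) \<and>
      (\<forall>y. finite {a\<in>A. y \<in> ball a \<rho>} \<and> card {a\<in>A. y \<in> ball a \<rho>} \<le> N)"
proof -
  obtain m :: nat where m: "\<And>n (x::'a) r. 0 < r \<Longrightarrow>
      \<exists>C. finite C \<and> card C \<le> m ^ n \<and> ball x r \<subseteq> (\<Union>c\<in>C. ball c (r / 2 ^ n))"
    using doubling_cover[OF assms] by blast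
  show ?thesis
  proof (rule that[of "m ^ 1"])
    fix S :: "'a set" and \<rho> :: real assume \<rho>: "0 < \<rho>"
    let ?sep = "{A. A \<subseteq> S \<and> (\<forall>a\<in>A. \<forall>a'\<in>A. a \<noteq> a' \<longrightarrow> \<rho> \<le> dist a a')}"
    have "\<exists>A\<in>?sep. \<forall>X\<in>?sep. A \<subseteq> X \<longrightarrow> X = A"
    proof (rule subset_Zorn')
      fix \<C> assume ch: "subset.chain ?sep \<C>"
      have "\<rho> \<le> dist a a'" if "a \<in> X" "X \<in> \<C>" "a' \<in> X'" "X' \<in> \<C>" "a \<noteq> a'" for a a' X X'
      proof -
        have "X \<subseteq> X' \<or> X' \<subseteq> X" using ch that unfolding subset_chain_def by blast
        then have "\<exists>Y\<in>\<C>. a \<in> Y \<and> a' \<in> Y" using that by blast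
        then obtain Y where "Y \<in> \<C>" "a \<in> Y" "a' \<in> Y" by blast
        with ch that(5) show ?thesis by (auto simp: subset_chain_def)
      qed
      moreover have "\<Union>\<C> \<subseteq> S" using ch by (auto simp: subset_chain_def)
      ultimately show "\<Union>\<C> \<in> ?sep" by auto
    qed
    then obtain A where A: "A \<subseteq> S" and sep: "\<And>a a'. a \<in> A \<Longrightarrow> a' \<in> A \<Longrightarrow> a \<noteq> a' \<Longrightarrow> \<rho> \<le> dist a a'"
      and maximal: "\<And>X. X \<in> ?sep \<Longrightarrow> A \<subseteq> X \<Longrightarrow> X = A" by auto
    have fin: "finite (A \<inter> ball x r)" if "0 < r" for x r
    proof -
      obtain n where "r / (\<rho> / 2) < 2 ^ n" using real_arch_pow[of 2 "r / (\<rho> / 2)"] by auto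
      then have n: "r / 2 ^ n \<le> \<rho> / 2" using \<rho> by (simp add: field_simps)
      have "\<exists>C. finite C \<and> card C \<le> m ^ n \<and> ball x r \<subseteq> (\<Union>c\<in>C. ball c (r / 2 ^ n))" by (rule m) fact
      then obtain C where C: "finite C" "ball x r \<subseteq> (\<Union>c\<in>C. ball c (r / 2 ^ n))"
        by (elim exE conjE) (rule that)
      have "ball x r \<subseteq> (\<Union>c\<in>C. ball c (\<rho> / 2))"
      proof
        fix z assume "z \<in> ball x r"
        then obtain c where "c \<in> C" "z \<in> ball c (r / 2 ^ n)" using C(2) by auto
        then have "dist c z < \<rho> / 2" using n unfolding mem_ball by linarith
        with \<open>c \<in> C\<close> show "z \<in> (\<Union>c\<in>C. ball c (\<rho> / 2))" by auto
      qed
      from separated_subset_finite[OF C(1) this, of "A \<inter> ball x r"] sep show ?thesis by auto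
    qed
    have "A = (\<Union>n::nat. A \<inter> ball undefined (real n + 1))"
      by auto (metis add.commute less_add_one linear order_le_less_trans real_arch_simple)
    moreover have "countable (\<Union>n::nat. A \<inter> ball undefined (real n + 1))"
      by (intro countable_UN) (auto intro!: countable_finite fin)
    ultimately have "countable A" by metis
    moreover have "S \<subseteq> (\<Union>a\<in>A. ball a \<rho>)"
    proof
      fix x assume x: "x \<in> S"
      show "x \<in> (\<Union>a\<in>A. ball a \<rho>)"
      proof (rule ccontr)
        assume "x \<notin> (\<Union>a\<in>A. ball a \<rho>)"
        then have far: "\<And>a. a \<in> A \<Longrightarrow> \<rho> \<le> dist a x" by (auto simp: not_less)
        then have "insert x A \<in> ?sep" using x A sep by (auto simp: dist_commute)
        then have "x \<in> A" using maximal[of "insert x A"] by auto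
        from far[OF this] \<rho> show False by simp
      qed
    qed
    moreover have "finite {a\<in>A. y \<in> ball a \<rho>} \<and> card {a\<in>A. y \<in> ball a \<rho>} \<le> m ^ 1" for y
    proof -
      obtain C where C: "finite C" "card C \<le> m ^ 1" "ball y \<rho> \<subseteq> (\<Union>c\<in>C. ball c (\<rho> / 2 ^ 1))"
        using m[OF \<rho>, of 1 y] by (elim exE conjE) (rule that)
      have "{a\<in>A. y \<in> ball a \<rho>} \<subseteq> ball y \<rho>" by (auto simp: dist_commute)
      with separated_subset_finite[OF C(1), of "ball y \<rho>" \<rho> "{a\<in>A. y \<in> ball a \<rho>}"] C sep show ?thesis
        by fastforce
    qed
    ultimately show "\<exists>A\<subseteq>S. countable A \<and> S \<subseteq> (\<Union>a\<in>A. ball a \<rho>) \<and>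
        (\<forall>y. finite {a\<in>A. y \<in> ball a \<rho>} \<and> card {a\<in>A. y \<in> ball a \<rho>} \<le> m ^ 1)"
      using A by blast
  qed
qed

text \<open>A substitute for the weak-type estimate of the maximal function at a fixed scale: sum the density
inequality over a cover of \<open>E\<close> with overlap at most \<open>N\<close> and exchange sum and integral.\<close>

lemma measure_le_of_density:
  assumes "geometrically_doubling TYPE('a::metric_space)"
  shows "\<exists>N::nat. \<forall>(M::'a measure) E G \<rho>. sets M = sets borel \<longrightarrow> 0 < \<rho> \<longrightarrow> E \<in> sets M \<longrightarrow> G \<in> sets M \<longrightarrow>
     (\<forall>x\<in>E. emeasure M (ball x \<rho>) \<le> 2 * emeasure M (G \<inter> ball x \<rho>)) \<longrightarrow> emeasure M E \<le> ennreal (2 * real N) * emeasure M G"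
proof -
  obtain N :: nat where N: "\<And>(S :: 'a set) \<rho>. 0 < \<rho> \<Longrightarrow> \<exists>A\<subseteq>S. countable A \<and> S \<subseteq> (\<Union>a\<in>A. ball a \<rho>) \<and>
      (\<forall>y. finite {a\<in>A. y \<in> ball a \<rho>} \<and> card {a\<in>A. y \<in> ball a \<rho>} \<le> N)"
    using bounded_overlap_cover[OF assms] by blast
  have "emeasure M E \<le> ennreal (2 * real N) * emeasure M G"
    if M: "sets M = sets borel" and \<rho>: "0 < \<rho>" and [measurable]: "E \<in> sets M" "G \<in> sets M"
      and dens: "\<And>x. x \<in> E \<Longrightarrow> emeasure M (ball x \<rho>) \<le> 2 * emeasure M (G \<inter> ball x \<rho>)"
    for M :: "'a measure" and E G \<rho>
  proof -
    have [measurable]: "ball a r \<in> sets M" for a r by (simp add: M)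
    have "\<exists>A\<subseteq>E. countable A \<and> E \<subseteq> (\<Union>a\<in>A. ball a \<rho>) \<and>
      (\<forall>y. finite {a\<in>A. y \<in> ball a \<rho>} \<and> card {a\<in>A. y \<in> ball a \<rho>} \<le> N)" by (rule N) fact
    then obtain A where A: "A \<subseteq> E" "countable A" "E \<subseteq> (\<Union>a\<in>A. ball a \<rho>)"
      "\<And>y. finite {a\<in>A. y \<in> ball a \<rho>}" "\<And>y. card {a\<in>A. y \<in> ball a \<rho>} \<le> N" by auto
    have count: "(\<integral>\<^sup>+a. indicator (ball a \<rho>) y \<partial>count_space A) = ennreal (card {a\<in>A. y \<in> ball a \<rho>})" for y
    proof -
      have "(\<integral>\<^sup>+a. indicator (ball a \<rho>) y \<partial>count_space A) = (\<integral>\<^sup>+a. indicator {a\<in>A. y \<in> ball a \<rho>} a \<partial>count_space A)"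
        by (intro nn_integral_cong) (auto simp: indicator_def)
      also have "\<dots> = emeasure (count_space A) {a\<in>A. y \<in> ball a \<rho>}" by (rule nn_integral_indicator) auto
      also have "\<dots> = ennreal (card {a\<in>A. y \<in> ball a \<rho>})"
        using A(4) by (subst emeasure_count_space_finite) (auto simp: ennreal_of_nat_eq_real_of_nat)
      finally show ?thesis .
    qed
    have "emeasure M E = (\<integral>\<^sup>+y. indicator E y \<partial>M)" by simp
    also have "\<dots> \<le> (\<integral>\<^sup>+y. (\<integral>\<^sup>+a. indicator (ball a \<rho>) y \<partial>count_space A) \<partial>M)"
    proof (intro nn_integral_mono)
      fix y
      show "indicator E y \<le> (\<integral>\<^sup>+a. indicator (ball a \<rho>) y \<partial>count_space A)"
      proof (cases "y \<in> E")
        case True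
        then obtain a where "a \<in> A" "y \<in> ball a \<rho>" using A(3) by blast
        then have "{a\<in>A. y \<in> ball a \<rho>} \<noteq> {}" by blast
        then have "1 \<le> card {a\<in>A. y \<in> ball a \<rho>}" using A(4)[of y] by (simp add: Suc_le_eq card_gt_0_iff)
        then show ?thesis unfolding count using True by simp
      qed simp
    qed
    also have "\<dots> = (\<integral>\<^sup>+a. (\<integral>\<^sup>+y. indicator (ball a \<rho>) y \<partial>M) \<partial>count_space A)"
      by (intro nn_integral_count_space_nn_integral A) measurable
    also have "\<dots> \<le> (\<integral>\<^sup>+a. (\<integral>\<^sup>+y. 2 * (indicator G y * indicator (ball a \<rho>) y) \<partial>M) \<partial>count_space A)"
    proof (rule nn_integral_mono)
      fix a assume "a \<in> space (count_space A)"
      then have "a \<in> E" using A(1) by auto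
      have "(\<integral>\<^sup>+y. 2 * (indicator G y * indicator (ball a \<rho>) y) \<partial>M) = 2 * emeasure M (G \<inter> ball a \<rho>)"
        by (simp add: nn_integral_cmult flip: indicator_inter_arith)
      then show "(\<integral>\<^sup>+y. indicator (ball a \<rho>) y \<partial>M) \<le> (\<integral>\<^sup>+y. 2 * (indicator G y * indicator (ball a \<rho>) y) \<partial>M)"
        using dens[OF \<open>a \<in> E\<close>] by simp
    qed
    also have "\<dots> = (\<integral>\<^sup>+y. (\<integral>\<^sup>+a. 2 * (indicator G y * indicator (ball a \<rho>) y) \<partial>count_space A) \<partial>M)"
      by (intro nn_integral_count_space_nn_integral[symmetric] A) measurable
    also have "\<dots> \<le> (\<integral>\<^sup>+y. ennreal (2 * real N) * indicator G y \<partial>M)"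
    proof (intro nn_integral_mono)
      fix y
      have "(\<integral>\<^sup>+a. 2 * (indicator G y * indicator (ball a \<rho>) y) \<partial>count_space A)
          = 2 * indicator G y * (\<integral>\<^sup>+a. indicator (ball a \<rho>) y \<partial>count_space A)"
        by (simp add: nn_integral_cmult mult.assoc)
      also have "\<dots> \<le> 2 * indicator G y * ennreal (real N)"
        unfolding count using A(5)[of y] by (intro mult_left_mono ennreal_leI) auto
      also have "\<dots> = ennreal (2 * real N) * indicator G y" by (simp add: ennreal_mult mult_ac)
      finally show "(\<integral>\<^sup>+a. 2 * (indicator G y * indicator (ball a \<rho>) y) \<partial>count_space A) \<le> ennreal (2 * real N) * indicator G y" .
    qed
    also have "\<dots> = ennreal (2 * real N) * emeasure M G" by (simp add: nn_integral_cmult_indicator)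
    finally show ?thesis .
  qed
  then show ?thesis by (intro exI[of _ N] allI impI) auto
qed

section \<open>Invariance and mass of packings\<close>

lemma isometry_measurable:
  assumes "sets M = sets borel" "\<phi> \<in> Iso M" shows "\<phi> \<in> measurable M M"
proof -
  have "continuous_on UNIV \<phi>"
    unfolding continuous_on_iff using assms(2) by (auto simp: Iso_def)
  then show ?thesis using borel_measurable_continuous_onI measurable_cong_sets[OF assms(1) assms(1)] by blast
qed

text \<open>The balls about points of one orbit are translates of each other, so an invariant set has the same
mass in each of them; disjoint ones share the total mass.\<close>

lemma packing_measure_le:
  fixes M :: "'a::metric_space measure"
  assumes M: "sets M = sets borel" and H: "H \<subseteq> Iso M" and S [measurable]: "S \<in> sets M"
    and inv: "\<And>\<phi>. \<phi> \<in> H \<Longrightarrow> AE x in M. \<phi> x \<in> S \<longleftrightarrow> x \<in> S"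
    and A: "finite A" "A \<subseteq> orbit H x" "\<And>a a'. a \<in> A \<Longrightarrow> a' \<in> A \<Longrightarrow> a \<noteq> a' \<Longrightarrow> ball a \<rho> \<inter> ball a' \<rho> = {}"
  shows "ennreal (card A) * emeasure M (S \<inter> ball x \<rho>) \<le> emeasure M S"
proof -
  have [measurable]: "ball a r \<in> sets M" for a r by (simp add: M)
  have sp: "space M = UNIV" using sets_eq_imp_space_eq[OF M] by simp
  have eq: "emeasure M (S \<inter> ball a \<rho>) = emeasure M (S \<inter> ball x \<rho>)" if a: "a \<in> A" for a
  proof -
    have "a \<in> (\<lambda>h. h x) ` H" using a A(2) unfolding orbit_def by blast
    then obtain h where h: "h \<in> H" "a = h x" by blast
    have hI: "h \<in> Iso M" using h H by auto
    have [measurable]: "h \<in> measurable M M" by (rule isometry_measurable[OF M hI])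
    have "emeasure M (S \<inter> ball a \<rho>) = emeasure (distr M M h) (S \<inter> ball a \<rho>)"
      using hI by (simp add: Iso_def)
    also have "\<dots> = emeasure M (h -` (S \<inter> ball a \<rho>))"
      by (subst emeasure_distr) (auto simp: sp)
    also have "\<dots> = emeasure M (S \<inter> ball x \<rho>)"
    proof (rule emeasure_eq_AE)
      show "AE y in M. (y \<in> h -` (S \<inter> ball a \<rho>)) = (y \<in> S \<inter> ball x \<rho>)"
        using inv[OF h(1)] by eventually_elim (use hI h in \<open>auto simp: Iso_def\<close>)
      show "h -` (S \<inter> ball a \<rho>) \<in> sets M"
        using measurable_sets[of h M M "S \<inter> ball a \<rho>"] by (auto simp: sp)
    qed auto
    finally show ?thesis .
  qed
  have "ennreal (card A) * emeasure M (S \<inter> ball x \<rho>) = (\<Sum>a\<in>A. emeasure M (S \<inter> ball a \<rho>))"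
    using eq by (simp add: ennreal_of_nat_eq_real_of_nat)
  also have "\<dots> = emeasure M (\<Union>a\<in>A. S \<inter> ball a \<rho>)"
  proof (rule sum_emeasure)
    show "disjoint_family_on (\<lambda>a. S \<inter> ball a \<rho>) A" using A(3) unfolding disjoint_family_on_def by blast
  qed (use A(1) in auto)
  also have "\<dots> \<le> emeasure M S" using A(1) by (intro emeasure_mono) auto
  finally show ?thesis .
qed

lemma packing_number_greaterD:
  assumes "enat n < packing_number H x r"
  obtains A where "finite A" "n \<le> card A" "A \<subseteq> orbit H x"
    "\<And>a a'. a \<in> A \<Longrightarrow> a' \<in> A \<Longrightarrow> a \<noteq> a' \<Longrightarrow> ball a r \<inter> ball a' r = {}"
proof -
  obtain A where A: "A \<subseteq> orbit H x" "\<forall>a\<in>A. \<forall>a'\<in>A. a \<noteq> a' \<longrightarrow> ball a r \<inter> ball a' r = {}"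
    "enat n < (if finite A then enat (card A) else \<infinity>)"
    using assms unfolding packing_number_def less_SUP_iff by auto
  show ?thesis
  proof (cases "finite A")
    case True
    with A that[of A] show ?thesis by auto
  next
    case False
    then obtain A' where "A' \<subseteq> A" "finite A'" "card A' = n" using infinite_arbitrarily_large by blast
    with A show ?thesis by (intro that[of A']) auto
  qed
qed

context subcritical
begin

text \<open>Chebyshev's inequality with a variable exponent; \<open>L\<close> bounds \<open>a^-p\<close> for all \<open>a \<ge> c\<close>, whether \<open>c\<close>
lies above \<open>1\<close> or below.\<close>

lemma emeasure_superlevel_le:
  assumes [measurable]: "f \<in> borel_measurable M" and f: "\<And>x. 0 \<le> f x"
    and K: "0 \<le> K" "(\<integral>\<^sup>+x. ennreal (f x powr p x) \<partial>M) \<le> ennreal K" and c: "0 < c"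
    and L: "\<And>x a. c \<le> a \<Longrightarrow> 1 \<le> L * a powr p x" and L0: "0 \<le> L"
  shows "emeasure M {x. c < f x} \<le> ennreal (L * K)"
proof -
  have "emeasure M {x. c < f x} = (\<integral>\<^sup>+x. indicator {x\<in>space M. c < f x} x \<partial>M)" by simp
  also have "\<dots> \<le> (\<integral>\<^sup>+x. ennreal L * ennreal (f x powr p x) \<partial>M)"
    using L L0 by (intro nn_integral_mono) (auto simp: indicator_def simp flip: ennreal_mult)
  also have "\<dots> = ennreal L * (\<integral>\<^sup>+x. ennreal (f x powr p x) \<partial>M)" by (simp add: nn_integral_cmult)
  also have "\<dots> \<le> ennreal L * ennreal K" by (intro mult_left_mono K) auto
  finally show ?thesis using L0 K by (simp add: ennreal_mult)
qed

text \<open>Off the set where \<open>g\<close> or \<open>\<bar>u\<bar>\<close> exceeds a large constant \<open>c\<close>, the gradient inequality is a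
Hoelder estimate with fixed constants, and the measure of that set is controlled by \<open>c\<close> alone.\<close>

lemma almost_uniformly_continuous:
  assumes K: "0 < K" and \<eta>: "0 < \<eta>" and \<delta>: "0 < \<delta>"
  shows "\<exists>\<rho> T. 0 < \<rho> \<and> \<rho> < 1 / 3 \<and> (\<forall>u\<in>hajlasz_class M p t K. \<exists>W\<in>sets M. emeasure M W \<le> ennreal \<delta> \<and>
     (\<forall>x\<in>-W. \<bar>u x\<bar> \<le> T) \<and> (\<forall>x\<in>-W. \<forall>y\<in>-W. dist x y < \<rho> \<longrightarrow> \<bar>u x - u y\<bar> \<le> \<eta>))"
proof -
  define c where "c = max 1 ((2 * K / \<delta>) powr (1 / pl))"
  have c: "1 \<le> c" by (simp add: c_def)
  have "2 * K / \<delta> = ((2 * K / \<delta>) powr (1 / pl)) powr pl" using K \<delta> p_bounds(1) by (simp add: powr_powr)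
  also have "\<dots> \<le> c powr pl" using p_bounds(1) by (intro powr_mono2) (auto simp: c_def)
  finally have cK: "c powr (- pl) * K \<le> \<delta> / 2" using \<delta> c by (simp add: powr_minus field_simps)
  define \<rho> where "\<rho> = min (1 / 4) ((\<eta> / (2 * c)) powr (1 / tl))"
  have \<rho>: "0 < \<rho>" "\<rho> < 1 / 3" using \<eta> c by (auto simp: \<rho>_def)
  have "\<rho> powr tl \<le> ((\<eta> / (2 * c)) powr (1 / tl)) powr tl"
    using t_bounds(1) \<rho> by (intro powr_mono2) (auto simp: \<rho>_def)
  also have "\<dots> = \<eta> / (2 * c)" using t_bounds(1) \<eta> c by (simp add: powr_powr)
  finally have \<rho>c: "\<rho> powr tl * c \<le> \<eta> / 2" using c by (simp add: field_simps)
  have level: "emeasure M {x. c < f x} \<le> ennreal (\<delta> / 2)"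
    if [measurable]: "f \<in> borel_measurable M" and f: "\<And>x. 0 \<le> f x"
      "(\<integral>\<^sup>+x. ennreal (f x powr p x) \<partial>M) \<le> ennreal K" for f
  proof -
    have "1 \<le> c powr (- pl) * a powr p x" if "c \<le> a" for a x
    proof -
      have "c powr pl \<le> a powr pl" using that c p_bounds(1) by (intro powr_mono2) auto
      also have "\<dots> \<le> a powr p x" using that c p_bounds(2) by (intro powr_mono) auto
      finally show ?thesis using c by (simp add: powr_minus field_simps)
    qed
    then have "emeasure M {x. c < f x} \<le> ennreal (c powr (- pl) * K)"
      using f K c by (intro emeasure_superlevel_le) auto
    also have "\<dots> \<le> ennreal (\<delta> / 2)" by (intro ennreal_leI cK)
    finally show ?thesis .
  qed
  have "\<exists>W\<in>sets M. emeasure M W \<le> ennreal \<delta> \<and>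
     (\<forall>x\<in>-W. \<bar>u x\<bar> \<le> c) \<and> (\<forall>x\<in>-W. \<forall>y\<in>-W. dist x y < \<rho> \<longrightarrow> \<bar>u x - u y\<bar> \<le> \<eta>)"
    if u: "u \<in> hajlasz_class M p t K" for u
  proof -
    from u have [measurable]: "u \<in> borel_measurable M"
      and up: "(\<integral>\<^sup>+x. ennreal (\<bar>u x\<bar> powr p x) \<partial>M) \<le> ennreal K" by (auto simp: hajlasz_class_def)
    from u obtain g N where [measurable]: "g \<in> borel_measurable M" and g0: "\<And>x. 0 \<le> g x"
      and gp: "(\<integral>\<^sup>+x. ennreal (g x powr p x) \<partial>M) \<le> ennreal K" and N: "N \<in> null_sets M"
      and grad: "\<And>x y. x \<notin> N \<Longrightarrow> y \<notin> N \<Longrightarrow> dist x y < 1 \<Longrightarrow>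
          \<bar>u x - u y\<bar> \<le> dist x y powr t x * g x + dist x y powr t y * g y"
      unfolding hajlasz_class_def by fastforce
    have [measurable]: "N \<in> sets M" by (rule null_setsD2[OF N])
    have lev [measurable]: "{x. c < g x} \<in> sets M" "{x. c < \<bar>u x\<bar>} \<in> sets M"
      using borel_measurable_less[of "\<lambda>_. c" M g] borel_measurable_less[of "\<lambda>_. c" M "\<lambda>x. \<bar>u x\<bar>"] by simp_all
    define W where "W = {x. c < g x} \<union> {x. c < \<bar>u x\<bar>} \<union> N"
    have "emeasure M W \<le> emeasure M ({x. c < g x} \<union> {x. c < \<bar>u x\<bar>}) + emeasure M N"
      unfolding W_def by (intro emeasure_subadditive) measurable
    also have "\<dots> \<le> emeasure M {x. c < g x} + emeasure M {x. c < \<bar>u x\<bar>} + 0"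
      using null_setsD1[OF N] lev by (intro add_mono emeasure_subadditive) simp_all
    also have "\<dots> \<le> ennreal (\<delta> / 2) + ennreal (\<delta> / 2) + 0"
      using level[of g] level[of "\<lambda>x. \<bar>u x\<bar>"] g0 gp up by (intro add_mono) auto
    also have "\<dots> = ennreal \<delta>" using \<delta> by (simp flip: ennreal_plus)
    finally have "emeasure M W \<le> ennreal \<delta>" .
    moreover have "\<bar>u x - u y\<bar> \<le> \<eta>" if "x \<notin> W" "y \<notin> W" "dist x y < \<rho>" for x y
    proof -
      have b: "dist x y powr t z * g z \<le> \<eta> / 2" if "z \<notin> W" for z
      proof -
        have "dist x y powr t z \<le> \<rho> powr t z" using \<open>dist x y < \<rho>\<close> t_pos[of z] by (intro powr_mono2) auto
        also have "\<dots> \<le> \<rho> powr tl" using \<rho> t_bounds(2)[of z] by (intro powr_mono') auto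
        finally have "dist x y powr t z * g z \<le> \<rho> powr tl * c"
          using that g0[of z] by (intro mult_mono) (auto simp: W_def)
        with \<rho>c show ?thesis by simp
      qed
      show ?thesis using grad[of x y] b[of x] b[of y] that \<rho>(2) by (auto simp: W_def)
    qed
    moreover have "W \<in> sets M" unfolding W_def by measurable
    moreover have "\<bar>u x\<bar> \<le> c" if "x \<notin> W" for x using that by (auto simp: W_def)
    ultimately show ?thesis by blast
  qed
  with \<rho> show ?thesis by blast
qed

text \<open>Let \<open>W\<close> be the exceptional set of a scale \<open>\<rho>\<close>. If \<open>\<bar>u x\<bar> > \<eta>\<close> and \<open>x\<close> is outside \<open>W\<close>, then
\<open>B(x,\<rho>)\<close> is covered by \<open>W\<close> and \<open>S = {\<bar>u\<bar> > \<eta>/2}\<close>. Far out the orbit of \<open>x\<close> is so large that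
\<open>S\<close> fills at most half of the ball, whose measure is bounded below; so \<open>W\<close> fills the other half,
and the set of such \<open>x\<close> is not much larger than \<open>W\<close>. The order of choices matters: first \<open>\<rho>\<close>,
then the number \<open>n\<close> of translates, then \<open>R\<close>.\<close>

lemma tightness:
  assumes dbl: "geometrically_doubling TYPE('a)" and H: "H \<subseteq> Iso M"
    and pack: "\<And>r n. 0 < r \<Longrightarrow> r < 1 / 3 \<Longrightarrow> \<exists>R. \<forall>x. x \<notin> ball x0 R \<longrightarrow> enat n < packing_number H x r"
    and K: "0 < K" and \<eta>: "0 < \<eta>" and \<delta>: "0 < \<delta>"
  shows "\<exists>R. \<forall>u\<in>hajlasz_class M p t K. (\<forall>\<phi>\<in>H. AE x in M. u (\<phi> x) = u x) \<longrightarrow>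
     emeasure M ({x. \<eta> < \<bar>u x\<bar>} - ball x0 R) \<le> ennreal \<delta>"
proof -
  obtain N :: nat where N: "\<And>E G \<rho>. 0 < \<rho> \<Longrightarrow> E \<in> sets M \<Longrightarrow> G \<in> sets M \<Longrightarrow>
     (\<forall>x\<in>E. emeasure M (ball x \<rho>) \<le> 2 * emeasure M (G \<inter> ball x \<rho>)) \<Longrightarrow> emeasure M E \<le> ennreal (2 * real N) * emeasure M G"
    using measure_le_of_density[OF dbl] sets_M by blast
  define \<delta>' where "\<delta>' = \<delta> / (2 * real N + 1)"
  have \<delta>': "0 < \<delta>'" using \<delta> by (simp add: \<delta>'_def)
  obtain \<rho> T where \<rho>: "0 < \<rho>" "\<rho> < 1 / 3" and W: "\<And>u. u \<in> hajlasz_class M p t K \<Longrightarrow> \<exists>W\<in>sets M. emeasure M W \<le> ennreal \<delta>' \<and>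
     (\<forall>x\<in>-W. \<bar>u x\<bar> \<le> T) \<and> (\<forall>x\<in>-W. \<forall>y\<in>-W. dist x y < \<rho> \<longrightarrow> \<bar>u x - u y\<bar> \<le> \<eta> / 2)"
    using almost_uniformly_continuous[OF K, of "\<eta> / 2" \<delta>'] \<eta> \<delta>' by auto
  define L where "L = max 1 (2 / \<eta>) powr pu"
  have L: "1 \<le> L * a powr p x" if "\<eta> / 2 \<le> a" for a x
  proof -
    have "1 \<le> (max 1 (2 / \<eta>) * a) powr p x"
    proof (rule ge_one_powr_ge_zero)
      have "1 = (2 / \<eta>) * (\<eta> / 2)" using \<eta> by simp
      also have "\<dots> \<le> max 1 (2 / \<eta>) * a" using that \<eta> by (intro mult_mono) auto
      finally show "1 \<le> max 1 (2 / \<eta>) * a" .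
    qed (use p_pos[of x] in simp)
    also have "\<dots> = max 1 (2 / \<eta>) powr p x * a powr p x" using that \<eta> by (simp add: powr_mult)
    also have "\<dots> \<le> L * a powr p x" unfolding L_def using p_bounds(3) by (intro mult_right_mono powr_mono) auto
    finally show ?thesis .
  qed
  have L0: "0 \<le> L" by (simp add: L_def)
  define m where "m = b * \<rho> powr Qu"
  have m: "0 < m" using lower_regular(1) \<rho> by (simp add: m_def)
  obtain n :: nat where n: "2 * (L * K) / m \<le> real n" using real_arch_simple by blast
  then have n': "2 * (L * K) \<le> real n * m" using m by (simp add: field_simps)
  obtain R where R: "\<And>x. x \<notin> ball x0 R \<Longrightarrow> enat (Suc n) < packing_number H x \<rho>"
    using pack[OF \<rho>, of "Suc n"] by blast
  show ?thesis
  proof (intro exI[of _ R] ballI impI)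
    fix u assume u: "u \<in> hajlasz_class M p t K" and inv: "\<forall>\<phi>\<in>H. AE x in M. u (\<phi> x) = u x"
    from u have [measurable]: "u \<in> borel_measurable M"
      and up: "(\<integral>\<^sup>+x. ennreal (\<bar>u x\<bar> powr p x) \<partial>M) \<le> ennreal K" by (auto simp: hajlasz_class_def)
    obtain W where Wm [measurable]: "W \<in> sets M" and W\<delta>: "emeasure M W \<le> ennreal \<delta>'"
      and Wc: "\<And>x y. x \<notin> W \<Longrightarrow> y \<notin> W \<Longrightarrow> dist x y < \<rho> \<Longrightarrow> \<bar>u x - u y\<bar> \<le> \<eta> / 2"
      using W[OF u] by auto
    have lev [measurable]: "{x. c < \<bar>u x\<bar>} \<in> sets M" for c
      using borel_measurable_less[of "\<lambda>_. c" M "\<lambda>x. \<bar>u x\<bar>"] by simp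
    have [measurable]: "ball x r \<in> sets M" for x r by simp
    define S where "S = {x. \<eta> / 2 < \<bar>u x\<bar>}"
    have Sm [measurable]: "S \<in> sets M" unfolding S_def by (rule lev)
    have S\<mu>: "emeasure M S \<le> ennreal (L * K)"
      unfolding S_def using up K L L0 \<eta> by (intro emeasure_superlevel_le) auto
    define E where "E = {x. \<eta> < \<bar>u x\<bar>} - ball x0 R - W"
    have [measurable]: "E \<in> sets M" unfolding E_def by measurable
    have dens: "emeasure M (ball x \<rho>) \<le> 2 * emeasure M (W \<inter> ball x \<rho>)" if x: "x \<in> E" for x
    proof -
      have sub: "ball x \<rho> \<subseteq> (S \<inter> ball x \<rho>) \<union> (W \<inter> ball x \<rho>)"
      proof
        fix y assume y: "y \<in> ball x \<rho>"
        show "y \<in> (S \<inter> ball x \<rho>) \<union> (W \<inter> ball x \<rho>)"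
        proof (cases "y \<in> W")
          case False
          then have "\<bar>u x - u y\<bar> \<le> \<eta> / 2" using x y by (intro Wc) (auto simp: E_def)
          moreover have "\<eta> < \<bar>u x\<bar>" using x by (simp add: E_def)
          ultimately have "\<eta> / 2 < \<bar>u y\<bar>" by linarith
          then show ?thesis using y by (simp add: S_def)
        qed (use y in simp)
      qed
      have "enat (Suc n) < packing_number H x \<rho>" using x by (intro R) (auto simp: E_def)
      then obtain A where A: "finite A" "Suc n \<le> card A" "A \<subseteq> orbit H x"
        "\<And>a a'. a \<in> A \<Longrightarrow> a' \<in> A \<Longrightarrow> a \<noteq> a' \<Longrightarrow> ball a \<rho> \<inter> ball a' \<rho> = {}"
        using packing_number_greaterD by blast
      have "AE x in M. \<phi> x \<in> S \<longleftrightarrow> x \<in> S" if "\<phi> \<in> H" for \<phi>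
        using inv[rule_format, OF that] by eventually_elim (simp add: S_def)
      then have "ennreal (card A) * emeasure M (S \<inter> ball x \<rho>) \<le> emeasure M S"
        by (rule packing_measure_le[OF sets_M H Sm _ A(1,3,4)])
      then have cA: "ennreal (card A) * emeasure M (S \<inter> ball x \<rho>) \<le> ennreal (L * K)" using S\<mu> by simp
      have half: "2 * emeasure M (S \<inter> ball x \<rho>) \<le> ennreal m"
      proof (cases "emeasure M (S \<inter> ball x \<rho>)")
        case (real s)
        have "ennreal (card A * s) \<le> ennreal (L * K)" using cA real by (simp add: ennreal_mult)
        then have "card A * s \<le> L * K" using L0 K by (subst (asm) ennreal_le_iff) auto
        moreover have "real n * s \<le> card A * s" using A(2) real by (intro mult_right_mono) auto
        ultimately have "real (Suc n) * (2 * s) \<le> real (Suc n) * m"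
          using n' m A(2) mult_right_mono[of "real (Suc n)" "card A" s] real by (simp add: algebra_simps)
        then have "2 * s \<le> m" by (simp del: of_nat_Suc)
        then have "ennreal (2 * s) \<le> ennreal m" by (rule ennreal_leI)
        then show ?thesis using real by (simp add: ennreal_mult)
      next
        case top
        then show ?thesis using cA A(2) by (simp add: ennreal_mult_top top_unique)
      qed
      also have "ennreal m \<le> ennreal (b * \<rho> powr Q x)"
        unfolding m_def using \<rho> Q_bounds(3)[of x] lower_regular(1) by (intro ennreal_leI mult_left_mono powr_mono') auto
      also have "\<dots> \<le> emeasure M (ball x \<rho>)" using \<rho> by (intro lower_regular) auto
      finally have half': "2 * emeasure M (S \<inter> ball x \<rho>) \<le> emeasure M (ball x \<rho>)" .
      have fin: "emeasure M (ball x \<rho>) \<noteq> \<infinity>" using mms \<rho> by (auto simp: metric_measure_space_def less_top)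
      have "emeasure M (ball x \<rho>) \<le> emeasure M ((S \<inter> ball x \<rho>) \<union> (W \<inter> ball x \<rho>))"
        by (intro emeasure_mono sub) auto
      also have "\<dots> \<le> emeasure M (S \<inter> ball x \<rho>) + emeasure M (W \<inter> ball x \<rho>)" by (intro emeasure_subadditive) auto
      finally have "2 * emeasure M (ball x \<rho>) \<le> 2 * (emeasure M (S \<inter> ball x \<rho>) + emeasure M (W \<inter> ball x \<rho>))"
        by (intro mult_left_mono) auto
      also have "\<dots> \<le> emeasure M (ball x \<rho>) + 2 * emeasure M (W \<inter> ball x \<rho>)"
        using half' by (simp add: distrib_left add_right_mono)
      finally have "emeasure M (ball x \<rho>) + emeasure M (ball x \<rho>) \<le> emeasure M (ball x \<rho>) + 2 * emeasure M (W \<inter> ball x \<rho>)"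
        by (simp add: mult_2)
      then show ?thesis using fin by (simp add: ennreal_add_left_cancel_le)
    qed
    have "emeasure M ({x. \<eta> < \<bar>u x\<bar>} - ball x0 R) \<le> emeasure M (E \<union> W)"
    proof (rule emeasure_mono)
      show "E \<union> W \<in> sets M" by measurable
    qed (auto simp: E_def)
    also have "\<dots> \<le> emeasure M E + emeasure M W" by (intro emeasure_subadditive) measurable
    also have "\<dots> \<le> ennreal (2 * real N) * emeasure M W + emeasure M W"
    proof (rule add_right_mono)
      have "E \<in> sets M" by measurable
      then show "emeasure M E \<le> ennreal (2 * real N) * emeasure M W"
        by (intro N[OF \<rho>(1) _ Wm]) (use dens in blast)+
    qed
    also have "\<dots> = ennreal (2 * real N + 1) * emeasure M W"
      by (simp add: distrib_right)
    also have "\<dots> \<le> ennreal (2 * real N + 1) * ennreal \<delta>'" by (intro mult_left_mono W\<delta>) auto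
    also have "\<dots> = ennreal \<delta>" using \<delta> unfolding \<delta>'_def by (subst ennreal_mult[symmetric]) (auto simp del: ennreal_plus)
    finally show "emeasure M ({x. \<eta> < \<bar>u x\<bar>} - ball x0 R) \<le> ennreal \<delta>" .
  qed
qed

text \<open>A function is coloured by its rounded values at one good point in each cell of a finite cover of the
ball. Colours take the place of approximating step functions, since the representatives of the
colours can be chosen within the given family and thus satisfy the same integral bounds.\<close>

lemma local_finite_colouring:
  assumes dbl: "geometrically_doubling TYPE('a)"
    and K: "0 < K" and \<eta>: "0 < \<eta>" and \<delta>: "0 < \<delta>"
  shows "\<exists>c :: ('a \<Rightarrow> real) \<Rightarrow> 'a \<Rightarrow> int. finite (c ` hajlasz_class M p t K) \<and>
     (\<forall>u\<in>hajlasz_class M p t K. \<forall>v\<in>hajlasz_class M p t K. c u = c v \<longrightarrow>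
        emeasure M ({x. \<eta> < \<bar>u x - v x\<bar>} \<inter> ball x0 R) \<le> ennreal \<delta>)"
proof -
  let ?C = "hajlasz_class M p t K"
  obtain \<rho> T where \<rho>: "0 < \<rho>" "\<rho> < 1 / 3" and W: "\<And>u. u \<in> ?C \<Longrightarrow> \<exists>W\<in>sets M. emeasure M W \<le> ennreal (\<delta> / 2) \<and>
     (\<forall>x\<in>-W. \<bar>u x\<bar> \<le> T) \<and> (\<forall>x\<in>-W. \<forall>y\<in>-W. dist x y < \<rho> \<longrightarrow> \<bar>u x - u y\<bar> \<le> \<eta> / 4)"
    using almost_uniformly_continuous[OF K, of "\<eta> / 4" "\<delta> / 2"] \<eta> \<delta> by auto
  have "\<forall>u\<in>?C. \<exists>W. W \<in> sets M \<and> emeasure M W \<le> ennreal (\<delta> / 2) \<and>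
     (\<forall>x\<in>-W. \<bar>u x\<bar> \<le> T) \<and> (\<forall>x\<in>-W. \<forall>y\<in>-W. dist x y < \<rho> \<longrightarrow> \<bar>u x - u y\<bar> \<le> \<eta> / 4)"
    using W by blast
  from bchoice[OF this] obtain W where W': "\<forall>u\<in>?C. W u \<in> sets M \<and> emeasure M (W u) \<le> ennreal (\<delta> / 2) \<and>
     (\<forall>x\<in>-W u. \<bar>u x\<bar> \<le> T) \<and> (\<forall>x\<in>-W u. \<forall>y\<in>-W u. dist x y < \<rho> \<longrightarrow> \<bar>u x - u y\<bar> \<le> \<eta> / 4)" ..
  have Wm: "W u \<in> sets M" and W\<delta>: "emeasure M (W u) \<le> ennreal (\<delta> / 2)" and WT: "\<And>x. x \<notin> W u \<Longrightarrow> \<bar>u x\<bar> \<le> T"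
    and Wc: "\<And>x y. x \<notin> W u \<Longrightarrow> y \<notin> W u \<Longrightarrow> dist x y < \<rho> \<Longrightarrow> \<bar>u x - u y\<bar> \<le> \<eta> / 4" if "u \<in> ?C" for u
    using W'[rule_format, OF that] by auto
  obtain m :: nat where m: "\<And>n (x::'a) r. 0 < r \<Longrightarrow>
      \<exists>C. finite C \<and> card C \<le> m ^ n \<and> ball x r \<subseteq> (\<Union>c\<in>C. ball c (r / 2 ^ n))"
    using doubling_cover[OF dbl] by blast
  have "\<exists>C. finite C \<and> ball x0 R \<subseteq> (\<Union>c\<in>C. ball c (\<rho> / 2))"
  proof -
    define R' where "R' = max R 1"
    obtain n where "R' / (\<rho> / 2) < 2 ^ n" using real_arch_pow[of 2 "R' / (\<rho> / 2)"] by auto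
    then have n: "R' / 2 ^ n \<le> \<rho> / 2" using \<rho> by (simp add: field_simps)
    have "\<exists>C. finite C \<and> card C \<le> m ^ n \<and> ball x0 R' \<subseteq> (\<Union>c\<in>C. ball c (R' / 2 ^ n))"
      by (rule m) (simp add: R'_def)
    then obtain C where C: "finite C" "ball x0 R' \<subseteq> (\<Union>c\<in>C. ball c (R' / 2 ^ n))" by (elim exE conjE) (rule that)
    have "ball x0 R \<subseteq> (\<Union>c\<in>C. ball c (\<rho> / 2))"
    proof
      fix z assume "z \<in> ball x0 R"
      then have "z \<in> ball x0 R'" by (auto simp: R'_def)
      then obtain c where "c \<in> C" "z \<in> ball c (R' / 2 ^ n)" using C(2) by auto
      then have "dist c z < \<rho> / 2" using n unfolding mem_ball by linarith
      with \<open>c \<in> C\<close> show "z \<in> (\<Union>c\<in>C. ball c (\<rho> / 2))" by auto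
    qed
    with C(1) show ?thesis by blast
  qed
  then obtain C where C: "finite C" "ball x0 R \<subseteq> (\<Union>c\<in>C. ball c (\<rho> / 2))" by (elim exE conjE) (rule that)
  \<comment> \<open>If the whole cell is exceptional there is no good point and the colour is \<open>0\<close> there; such cells never matter.\<close>
  define pt where "pt u a = (SOME z. z \<in> ball a (\<rho> / 2) - W u)" for u a
  have pt: "pt u a \<in> ball a (\<rho> / 2)" "pt u a \<notin> W u" if "z \<in> ball a (\<rho> / 2)" "z \<notin> W u" for u a z
    using someI[of "\<lambda>z. z \<in> ball a (\<rho> / 2) - W u" z] that unfolding pt_def by auto
  define c where "c u a = (if a \<in> C \<and> pt u a \<notin> W u then \<lfloor>4 / \<eta> * u (pt u a)\<rfloor> else 0)" for u a
  define n where "n = \<lceil>4 / \<eta> * \<bar>T\<bar>\<rceil> + 1"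
  have c_range: "c u a \<in> {-n..n}" if "u \<in> ?C" for u a
  proof (cases "a \<in> C \<and> pt u a \<notin> W u")
    case True
    have "\<bar>u (pt u a)\<bar> \<le> \<bar>T\<bar>" using WT[OF that, of "pt u a"] True by simp
    then have "\<bar>4 / \<eta> * u (pt u a)\<bar> \<le> 4 / \<eta> * \<bar>T\<bar>" using \<eta> by (simp add: abs_mult divide_right_mono)
    then have "4 / \<eta> * u (pt u a) \<le> 4 / \<eta> * \<bar>T\<bar>" "- (4 / \<eta> * \<bar>T\<bar>) \<le> 4 / \<eta> * u (pt u a)"
      by linarith+
    moreover have "4 / \<eta> * \<bar>T\<bar> \<le> of_int (n - 1)"
      unfolding n_def using le_of_int_ceiling[of "4 / \<eta> * \<bar>T\<bar>"] by simp
    ultimately have "4 / \<eta> * u (pt u a) \<le> of_int (n - 1)" "of_int (1 - n) \<le> 4 / \<eta> * u (pt u a)"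
      by (linarith, simp)
    then have "\<lfloor>4 / \<eta> * u (pt u a)\<rfloor> \<le> n - 1" "1 - n \<le> \<lfloor>4 / \<eta> * u (pt u a)\<rfloor>"
      by (linarith, simp add: le_floor_iff)
    then show ?thesis using True by (simp add: c_def)
  next
    case False
    have "0 \<le> n" proof -
      have "0 \<le> 4 / \<eta> * \<bar>T\<bar>" using \<eta> by simp
      then show ?thesis unfolding n_def by linarith
    qed
    then show ?thesis using False by (auto simp: c_def)
  qed
  have c_out: "c u a = 0" if "a \<notin> C" for u a using that by (simp add: c_def)
  have "finite {f. \<forall>x. (x \<in> C \<longrightarrow> f x \<in> {-n..n}) \<and> (x \<notin> C \<longrightarrow> f x = 0)}"
    using C(1) by (rule finite_set_of_finite_funs) simp
  moreover have "c ` ?C \<subseteq> {f. \<forall>x. (x \<in> C \<longrightarrow> f x \<in> {-n..n}) \<and> (x \<notin> C \<longrightarrow> f x = 0)}"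
    using c_range c_out by auto
  ultimately have "finite (c ` ?C)" using finite_subset by blast
  moreover have "emeasure M ({x. \<eta> < \<bar>u x - v x\<bar>} \<inter> ball x0 R) \<le> ennreal \<delta>"
    if uv: "u \<in> ?C" "v \<in> ?C" and eq: "c u = c v" for u v
  proof -
    have "{x. \<eta> < \<bar>u x - v x\<bar>} \<inter> ball x0 R \<subseteq> W u \<union> W v"
    proof (rule subsetI, rule ccontr)
      fix x assume x: "x \<in> {x. \<eta> < \<bar>u x - v x\<bar>} \<inter> ball x0 R" and nW: "x \<notin> W u \<union> W v"
      obtain a where a: "a \<in> C" "x \<in> ball a (\<rho> / 2)" using x C(2) by auto
      have pu: "pt u a \<in> ball a (\<rho> / 2)" "pt u a \<notin> W u" using pt[OF a(2)] nW by auto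
      have pv: "pt v a \<in> ball a (\<rho> / 2)" "pt v a \<notin> W v" using pt[OF a(2)] nW by auto
      have d: "dist x z < \<rho>" if "z \<in> ball a (\<rho> / 2)" for z
        using dist_triangle3[of x z a] a(2) that unfolding mem_ball by linarith
      have "\<bar>u x - u (pt u a)\<bar> \<le> \<eta> / 4" using Wc[OF uv(1), of x "pt u a"] nW pu d[OF pu(1)] by auto
      moreover have "\<bar>v x - v (pt v a)\<bar> \<le> \<eta> / 4" using Wc[OF uv(2), of x "pt v a"] nW pv d[OF pv(1)] by auto
      moreover have "\<bar>u (pt u a) - v (pt v a)\<bar> \<le> \<eta> / 4"
      proof -
        have "\<lfloor>4 / \<eta> * u (pt u a)\<rfloor> = \<lfloor>4 / \<eta> * v (pt v a)\<rfloor>"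
          using fun_cong[OF eq, of a] a(1) pu(2) pv(2) by (simp add: c_def)
        then have "\<bar>4 / \<eta> * u (pt u a) - 4 / \<eta> * v (pt v a)\<bar> \<le> 1" by linarith
        then have "\<bar>4 / \<eta> * (u (pt u a) - v (pt v a))\<bar> \<le> 1" by (subst right_diff_distrib)
        moreover have "\<bar>4 / \<eta>\<bar> = 4 / \<eta>" using \<eta> by simp
        ultimately have "4 / \<eta> * \<bar>u (pt u a) - v (pt v a)\<bar> \<le> 1" by (simp only: abs_mult)
        then show ?thesis using \<eta> by (simp add: field_simps)
      qed
      ultimately have "\<bar>u x - v x\<bar> \<le> \<eta>" using \<eta> by linarith
      with x show False by auto
    qed
    then have "emeasure M ({x. \<eta> < \<bar>u x - v x\<bar>} \<inter> ball x0 R) \<le> emeasure M (W u \<union> W v)"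
      using Wm uv by (intro emeasure_mono) auto
    also have "\<dots> \<le> emeasure M (W u) + emeasure M (W v)" using Wm uv by (intro emeasure_subadditive) auto
    also have "\<dots> \<le> ennreal (\<delta> / 2) + ennreal (\<delta> / 2)" using W\<delta> uv by (intro add_mono) auto
    also have "\<dots> = ennreal \<delta>" using \<delta> by (simp flip: ennreal_plus)
    finally show ?thesis .
  qed
  ultimately show ?thesis by blast
qed

end

section \<open>From finite colourings to compact embeddings\<close>

text \<open>Tightness and the local colouring make differences of equally coloured functions small in measure;
interpolation between \<open>p\<close> and an exponent \<open>\<tau>\<close> above \<open>\<beta>\<close> does the rest.\<close>

lemma (in subcritical) subcritical_compactness:
  assumes dbl: "geometrically_doubling TYPE('a)" and H: "H \<subseteq> Iso M"
    and pack: "\<And>r n. 0 < r \<Longrightarrow> r < 1 / 3 \<Longrightarrow> \<exists>R. \<forall>x. x \<notin> ball x0 R \<longrightarrow> enat n < packing_number H x r"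
    and [measurable]: "\<beta> \<in> borel_measurable M" and e: "0 < e"
    and \<beta>: "AE x in M. p x + e \<le> \<beta> x \<and> \<beta> x + e \<le> Q x * p x / (Q x - t x * p x)"
    and K: "0 < K"
    and C: "C = {u \<in> hajlasz_class M p t K. \<forall>\<phi>\<in>H. AE x in M. u (\<phi> x) = u x}"
  shows "\<exists>K'. \<forall>u\<in>C. (\<integral>\<^sup>+x. ennreal (\<bar>u x\<bar> powr \<beta> x) \<partial>M) \<le> ennreal K'"
    and "0 < \<epsilon> \<Longrightarrow> \<exists>c :: ('a \<Rightarrow> real) \<Rightarrow> 'a \<Rightarrow> int. finite (c ` C) \<and> (\<forall>u\<in>C. \<forall>v\<in>C. c u = c v \<longrightarrow>
           (\<integral>\<^sup>+x. ennreal (\<bar>(u - v) x\<bar> powr \<beta> x) \<partial>M) \<le> ennreal \<epsilon>)"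
proof -
  obtain \<tau> \<tau>u where \<tau>m [measurable]: "\<tau> \<in> borel_measurable M" and \<tau>: "\<And>x. p x \<le> \<tau> x" "\<And>x. \<tau> x \<le> \<tau>u"
    "\<And>x. Q x * p x / (Q x - t x * p x) - e / 2 \<le> \<tau> x"
    and \<tau>K: "\<And>K. 0 < K \<Longrightarrow> \<exists>K'. \<forall>u\<in>hajlasz_class M p t K. (\<integral>\<^sup>+x. ennreal (\<bar>u x\<bar> powr \<tau> x) \<partial>M) \<le> ennreal K'"
    using improved_integrability[of "e / 2"] e by auto
  obtain K1 where K1: "\<And>u. u \<in> hajlasz_class M p t K \<Longrightarrow> (\<integral>\<^sup>+x. ennreal (\<bar>u x\<bar> powr \<tau> x) \<partial>M) \<le> ennreal K1"
    using \<tau>K[OF K] by auto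
  define K2 where "K2 = max K K1"
  have K2: "0 < K2" using K by (simp add: K2_def)
  have cls: "u \<in> borel_measurable M" "(\<integral>\<^sup>+x. ennreal (\<bar>u x\<bar> powr p x) \<partial>M) \<le> ennreal K2"
    "(\<integral>\<^sup>+x. ennreal (\<bar>u x\<bar> powr \<tau> x) \<partial>M) \<le> ennreal K2" if "u \<in> hajlasz_class M p t K" for u
  proof -
    have le: "ennreal K \<le> ennreal K2" "ennreal K1 \<le> ennreal K2" unfolding K2_def by (auto intro!: ennreal_leI)
    show "(\<integral>\<^sup>+x. ennreal (\<bar>u x\<bar> powr \<tau> x) \<partial>M) \<le> ennreal K2" using K1[OF that] le(2) by (rule order_trans)
    have "(\<integral>\<^sup>+x. ennreal (\<bar>u x\<bar> powr p x) \<partial>M) \<le> ennreal K" using that by (simp add: hajlasz_class_def)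
    then show "(\<integral>\<^sup>+x. ennreal (\<bar>u x\<bar> powr p x) \<partial>M) \<le> ennreal K2" using le(1) by (rule order_trans)
    show "u \<in> borel_measurable M" using that by (simp add: hajlasz_class_def)
  qed
  have \<tau>0: "0 < \<tau> x" for x using \<tau>(1)[of x] p_pos[of x] by simp
  have \<beta>': "AE x in M. 0 \<le> p x \<and> p x + e / 2 \<le> \<beta> x \<and> \<beta> x \<le> \<tau> x - e / 2 \<and> \<beta> x \<le> \<tau>u"
    using \<beta>
  proof eventually_elim
    case (elim x)
    show ?case using elim \<tau>(2)[of x] \<tau>(3)[of x] e p_pos[of x] by linarith
  qed
  show "\<exists>K'. \<forall>u\<in>C. (\<integral>\<^sup>+x. ennreal (\<bar>u x\<bar> powr \<beta> x) \<partial>M) \<le> ennreal K'"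
  proof (intro exI[of _ "K2 + K2"] ballI)
    fix u assume "u \<in> C"
    then have u: "u \<in> hajlasz_class M p t K" by (simp add: C)
    note [measurable] = cls(1)[OF u]
    have "(\<integral>\<^sup>+x. ennreal (\<bar>u x\<bar> powr \<beta> x) \<partial>M) \<le> (\<integral>\<^sup>+x. ennreal (\<bar>u x\<bar> powr p x) + ennreal (\<bar>u x\<bar> powr \<tau> x) \<partial>M)"
    proof (rule nn_integral_mono_AE, use \<beta>' in eventually_elim)
      case (elim x)
      have "\<bar>u x\<bar> powr \<beta> x \<le> \<bar>u x\<bar> powr p x + \<bar>u x\<bar> powr \<tau> x"
      proof (cases "\<bar>u x\<bar> \<le> 1")
        case True
        then have "\<bar>u x\<bar> powr \<beta> x \<le> \<bar>u x\<bar> powr p x" using elim e by (intro powr_mono') auto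
        then show ?thesis by (simp add: add_increasing2)
      next
        case False
        then have "\<bar>u x\<bar> powr \<beta> x \<le> \<bar>u x\<bar> powr \<tau> x" using elim e by (intro powr_mono) auto
        then show ?thesis by (simp add: add_increasing)
      qed
      then show ?case by (simp add: ennreal_leI flip: ennreal_plus)
    qed
    also have "\<dots> = (\<integral>\<^sup>+x. ennreal (\<bar>u x\<bar> powr p x) \<partial>M) + (\<integral>\<^sup>+x. ennreal (\<bar>u x\<bar> powr \<tau> x) \<partial>M)"
      by (rule nn_integral_add) auto
    also have "\<dots> \<le> ennreal K2 + ennreal K2" by (intro add_mono cls u)
    finally show "(\<integral>\<^sup>+x. ennreal (\<bar>u x\<bar> powr \<beta> x) \<partial>M) \<le> ennreal (K2 + K2)" using K2 by (simp only: ennreal_plus)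
  qed
  assume \<epsilon>: "0 < \<epsilon>"
  define K3 where "K3 = max (2 powr pu * (K2 + K2)) (2 powr \<tau>u * (K2 + K2))"
  have K3: "0 < K3" using K2 by (simp add: K3_def less_max_iff_disj)
  obtain \<eta> \<delta> where \<eta>\<delta>: "0 < \<eta>" "0 < \<delta>" and interp: "\<And>w. w \<in> borel_measurable M \<Longrightarrow>
     (\<integral>\<^sup>+x. ennreal (\<bar>w x\<bar> powr p x) \<partial>M) \<le> ennreal K3 \<Longrightarrow> (\<integral>\<^sup>+x. ennreal (\<bar>w x\<bar> powr \<tau> x) \<partial>M) \<le> ennreal K3 \<Longrightarrow>
     emeasure M {x\<in>space M. \<eta> < \<bar>w x\<bar>} \<le> ennreal \<delta> \<Longrightarrow> (\<integral>\<^sup>+x. ennreal (\<bar>w x\<bar> powr \<beta> x) \<partial>M) \<le> ennreal \<epsilon>"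
    using interpolation_in_measure[OF measurable_exponents(1) \<tau>m _ \<beta>' K3 \<epsilon>] e by auto
  obtain R where R: "\<And>u. u \<in> C \<Longrightarrow> emeasure M ({x. \<eta> / 2 < \<bar>u x\<bar>} - ball x0 R) \<le> ennreal (\<delta> / 3)"
    using tightness[OF dbl H pack K, where \<eta> = "\<eta> / 2" and \<delta> = "\<delta> / 3"] \<eta>\<delta> unfolding C by auto
  obtain c :: "('a \<Rightarrow> real) \<Rightarrow> 'a \<Rightarrow> int" where c: "finite (c ` hajlasz_class M p t K)"
    "\<And>u v. u \<in> hajlasz_class M p t K \<Longrightarrow> v \<in> hajlasz_class M p t K \<Longrightarrow> c u = c v \<Longrightarrow>
        emeasure M ({x. \<eta> < \<bar>u x - v x\<bar>} \<inter> ball x0 R) \<le> ennreal (\<delta> / 3)"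
    using local_finite_colouring[OF dbl K \<eta>\<delta>(1), where \<delta> = "\<delta> / 3" and R = R and ?x0.0 = x0] \<eta>\<delta> by auto
  show "\<exists>c :: ('a \<Rightarrow> real) \<Rightarrow> 'a \<Rightarrow> int. finite (c ` C) \<and> (\<forall>u\<in>C. \<forall>v\<in>C. c u = c v \<longrightarrow>
           (\<integral>\<^sup>+x. ennreal (\<bar>(u - v) x\<bar> powr \<beta> x) \<partial>M) \<le> ennreal \<epsilon>)"
  proof (intro exI[of _ c] conjI ballI impI)
    show "finite (c ` C)" using c(1) by (rule finite_subset[rotated]) (auto simp: C)
    fix u v assume uv: "u \<in> C" "v \<in> C" and eq: "c u = c v"
    then have u: "u \<in> hajlasz_class M p t K" and v: "v \<in> hajlasz_class M p t K" by (auto simp: C)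
    note [measurable] = cls(1)[OF u] cls(1)[OF v]
    have lev [measurable]: "{x. r < \<bar>f x\<bar>} \<in> sets M" if "f \<in> borel_measurable M" for r and f :: "'a \<Rightarrow> real"
      using borel_measurable_less[of "\<lambda>_. r" M "\<lambda>x. \<bar>f x\<bar>"] that by simp
    have B [measurable]: "ball x0 R \<in> sets M" by simp
    let ?D = "{x. \<eta> < \<bar>u x - v x\<bar>} \<inter> ball x0 R"
    let ?U = "{x. \<eta> / 2 < \<bar>u x\<bar>} - ball x0 R" and ?V = "{x. \<eta> / 2 < \<bar>v x\<bar>} - ball x0 R"
    have [measurable]: "?D \<in> sets M" "?U \<in> sets M" "?V \<in> sets M"
      using lev[of "\<lambda>x. u x - v x" \<eta>] lev[of u "\<eta> / 2"] lev[of v "\<eta> / 2"] B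
      by (intro sets.Int sets.Diff; measurable)+
    have wm: "u - v \<in> borel_measurable M" unfolding fun_diff_def by measurable
    show "(\<integral>\<^sup>+x. ennreal (\<bar>(u - v) x\<bar> powr \<beta> x) \<partial>M) \<le> ennreal \<epsilon>"
    proof (rule interp[OF wm])
      show "(\<integral>\<^sup>+x. ennreal (\<bar>(u - v) x\<bar> powr p x) \<partial>M) \<le> ennreal K3"
      proof (rule order_trans)
        show "(\<integral>\<^sup>+x. ennreal (\<bar>(u - v) x\<bar> powr p x) \<partial>M) \<le> ennreal (2 powr pu * (K2 + K2))"
          using K2 p_pos[THEN less_imp_le] p_bounds(3)
          by (intro integral_diff_powr_le[OF cls(1)[OF u] cls(1)[OF v] measurable_exponents(1) _ _ _ cls(2)[OF u] cls(2)[OF v]]) auto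
      qed (auto simp: K3_def intro!: ennreal_leI)
      show "(\<integral>\<^sup>+x. ennreal (\<bar>(u - v) x\<bar> powr \<tau> x) \<partial>M) \<le> ennreal K3"
      proof (rule order_trans)
        show "(\<integral>\<^sup>+x. ennreal (\<bar>(u - v) x\<bar> powr \<tau> x) \<partial>M) \<le> ennreal (2 powr \<tau>u * (K2 + K2))"
          using K2 \<tau>0[THEN less_imp_le] \<tau>(2)
          by (intro integral_diff_powr_le[OF cls(1)[OF u] cls(1)[OF v] \<tau>m _ _ _ cls(3)[OF u] cls(3)[OF v]]) auto
      qed (auto simp: K3_def intro!: ennreal_leI)
      have "emeasure M {x\<in>space M. \<eta> < \<bar>(u - v) x\<bar>} \<le> emeasure M (?D \<union> (?U \<union> ?V))"
      proof (rule emeasure_mono)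
        show "{x\<in>space M. \<eta> < \<bar>(u - v) x\<bar>} \<subseteq> ?D \<union> (?U \<union> ?V)"
          by (auto simp: not_less)
        show "?D \<union> (?U \<union> ?V) \<in> sets M" by measurable
      qed
      also have "\<dots> \<le> emeasure M ?D + emeasure M (?U \<union> ?V)" by (intro emeasure_subadditive) measurable
      also have "\<dots> \<le> emeasure M ?D + (emeasure M ?U + emeasure M ?V)"
        by (intro add_left_mono emeasure_subadditive) measurable
      also have "\<dots> \<le> ennreal (\<delta> / 3) + (ennreal (\<delta> / 3) + ennreal (\<delta> / 3))"
        by (intro add_mono c(2) R u v uv eq)
      also have "\<dots> = ennreal \<delta>" using \<eta>\<delta> by (simp flip: ennreal_plus)
      finally show "emeasure M {x\<in>space M. \<eta> < \<bar>(u - v) x\<bar>} \<le> ennreal \<delta>" .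
    qed
  qed
qed

text \<open>\<open>J\<close> bounds \<open>l^-\<beta>\<close>. Two choices of it are used: \<open>l^-a\<close> for \<open>l \<ge> 1\<close> and \<open>l^-b\<close> for
\<open>l \<le> 1\<close>, where \<open>a \<le> \<beta> \<le> b\<close>.\<close>

lemma Lp_norm_scaled_le:
  assumes L: "0 < L" and l: "0 < l"
    and J: "AE x in M. (1 / l) powr \<beta> x \<le> J" "0 \<le> J" "J * I \<le> 1"
    and u: "(\<integral>\<^sup>+x. ennreal (\<bar>u x / L\<bar> powr \<beta> x) \<partial>M) \<le> ennreal I"
    and m: "u \<in> borel_measurable M" "\<beta> \<in> borel_measurable M"
  shows "Lp_norm M \<beta> (\<lambda>x. ennreal \<bar>u x\<bar>) \<le> ennreal (L * l)"
proof (rule Lp_norm_le)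
  note [measurable] = m
  have "modular M \<beta> (\<lambda>x. ennreal \<bar>u x\<bar> / ennreal (L * l)) = (\<integral>\<^sup>+x. ennreal ((\<bar>u x\<bar> / (L * l)) powr \<beta> x) \<partial>M)"
    using L l by (intro modular_real) auto
  also have "\<dots> \<le> (\<integral>\<^sup>+x. ennreal J * ennreal (\<bar>u x / L\<bar> powr \<beta> x) \<partial>M)"
  proof (rule nn_integral_mono_AE, use J(1) in eventually_elim)
    case (elim x)
    have "(\<bar>u x\<bar> / (L * l)) powr \<beta> x = (1 / l) powr \<beta> x * \<bar>u x / L\<bar> powr \<beta> x"
      using L l by (simp add: mult.commute flip: powr_mult)
    also have "\<dots> \<le> J * \<bar>u x / L\<bar> powr \<beta> x" using elim by (intro mult_right_mono) auto
    finally show ?case using J(2) by (simp add: ennreal_leI flip: ennreal_mult)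
  qed
  also have "\<dots> = ennreal J * (\<integral>\<^sup>+x. ennreal (\<bar>u x / L\<bar> powr \<beta> x) \<partial>M)" by (simp add: nn_integral_cmult)
  also have "\<dots> \<le> ennreal J * ennreal I" by (intro mult_left_mono u) auto
  also have "\<dots> \<le> 1" using J by (simp add: ennreal_mult'[symmetric])
  finally show "modular M \<beta> (\<lambda>x. ennreal \<bar>u x\<bar> / ennreal (L * l)) \<le> 1" .
qed (use L l in simp)

text \<open>The class \<open>C\<close> plays the role of a unit ball of \<open>Y\<close>. Differences appear in the scaling hypothesis
because continuity is tested on them and \<open>Y\<close> carries no linear structure.\<close>

lemma compact_embedding_of_finite_colourings:
  fixes C :: "('a \<Rightarrow> real) set"
  assumes \<beta>: "\<beta> \<in> bounded_exponents M"
    and Y: "\<And>u. u \<in> fst Y \<Longrightarrow> u \<in> borel_measurable M" "\<And>u. u \<in> fst Y \<Longrightarrow> snd Y u < \<infinity>"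
    and scale: "\<And>u L. 0 < L \<Longrightarrow> u \<in> fst Y \<or> (\<exists>v\<in>fst Y. \<exists>w\<in>fst Y. u = v - w) \<Longrightarrow> snd Y u < ennreal L \<Longrightarrow>
       (\<lambda>x. u x / L) \<in> C"
    and bounded: "\<exists>K'. \<forall>u\<in>C. (\<integral>\<^sup>+x. ennreal (\<bar>u x\<bar> powr \<beta> x) \<partial>M) \<le> ennreal K'"
    and colour: "\<And>\<epsilon>. 0 < \<epsilon> \<Longrightarrow> \<exists>c :: ('a \<Rightarrow> real) \<Rightarrow> 'c. finite (c ` C) \<and> (\<forall>u\<in>C. \<forall>v\<in>C. c u = c v \<longrightarrow>
           (\<integral>\<^sup>+x. ennreal (\<bar>(u - v) x\<bar> powr \<beta> x) \<partial>M) \<le> ennreal \<epsilon>)"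
  shows "Y \<hookrightarrow>\<hookrightarrow> L_fun_space M \<beta>"
proof -
  note \<beta>m = bounded_exponentsD(1)[OF \<beta>]
  obtain a b where ab: "0 < a" "a \<le> 1" "1 \<le> b" "AE x in M. a \<le> \<beta> x \<and> \<beta> x \<le> b"
    using bounded_exponentsD(3)[OF \<beta>] by blast
  obtain K' where K': "\<And>u. u \<in> C \<Longrightarrow> (\<integral>\<^sup>+x. ennreal (\<bar>u x\<bar> powr \<beta> x) \<partial>M) \<le> ennreal K'" using bounded by blast
  define l where "l = (max 1 K') powr (1 / a)"
  have l: "1 \<le> l" unfolding l_def using ab by (intro ge_one_powr_ge_zero) auto
  have la: "l powr a = max 1 K'" using ab by (simp add: l_def powr_powr)
  have norm: "Lp_norm M \<beta> (\<lambda>x. ennreal \<bar>u x\<bar>) \<le> ennreal (L * l)"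
    if "0 < L" "(\<lambda>x. u x / L) \<in> C" "u \<in> borel_measurable M" for u L
  proof (rule Lp_norm_scaled_le[where J = "(1 / l) powr a" and I = K'])
    show "AE x in M. (1 / l) powr \<beta> x \<le> (1 / l) powr a"
      using ab(4) by eventually_elim (use l in \<open>intro powr_mono'; simp\<close>)
    have "(1 / l) powr a * K' = K' / max 1 K'" using l by (simp add: powr_divide la)
    then show "(1 / l) powr a * K' \<le> 1" by simp
    show "(\<integral>\<^sup>+x. ennreal (\<bar>u x / L\<bar> powr \<beta> x) \<partial>M) \<le> ennreal K'" by (rule K'[OF that(2)])
  qed (use that l \<beta>m in auto)
  have sub: "fst Y \<subseteq> fst (L_fun_space M \<beta>)"
  proof
    fix u assume u: "u \<in> fst Y"
    obtain k where k: "snd Y u = ennreal k" "0 \<le> k" using Y(2)[OF u] by (cases "snd Y u") auto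
    then have "snd Y u < ennreal (k + 1)" by (simp add: ennreal_lessI)
    then have "(\<lambda>x. u x / (k + 1)) \<in> C" using u k by (intro scale) auto
    from K'[OF this] have "modular M \<beta> (\<lambda>x. ennreal \<bar>1 / (k + 1) * u x\<bar>) \<le> ennreal K'"
      by (simp add: modular_def ennreal_powr_ennreal)
    then have "modular M \<beta> (\<lambda>x. ennreal \<bar>1 / (k + 1) * u x\<bar>) < \<infinity>" using le_less_trans by fastforce
    moreover have "0 < 1 / (k + 1)" using k by simp
    ultimately show "u \<in> fst (L_fun_space M \<beta>)" using Y(1)[OF u]
      unfolding L_fun_space_def Lp_space_def fst_conv by blast
  qed
  have "continuous_inclusion Y (L_fun_space M \<beta>)"
    unfolding continuous_inclusion_def
  proof (intro conjI sub ballI allI impI)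
    fix u and \<epsilon> :: real assume u: "u \<in> fst Y" and \<epsilon>: "0 < \<epsilon>"
    define \<delta> where "\<delta> = \<epsilon> / (2 * l)"
    have \<delta>: "0 < \<delta>" using \<epsilon> l by (simp add: \<delta>_def)
    show "\<exists>\<delta>>0. \<forall>v\<in>fst Y. snd Y (v - u) < ennreal \<delta> \<longrightarrow> snd (L_fun_space M \<beta>) (v - u) < ennreal \<epsilon>"
    proof (intro exI[of _ \<delta>] conjI ballI impI \<delta>)
      fix v assume v: "v \<in> fst Y" and lt: "snd Y (v - u) < ennreal \<delta>"
      have "(\<lambda>x. (v - u) x / \<delta>) \<in> C" using u v by (intro scale[OF \<delta> _ lt]) blast
      moreover have "v - u \<in> borel_measurable M" unfolding fun_diff_def using Y(1)[OF u] Y(1)[OF v] by measurable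
      ultimately have "Lp_norm M \<beta> (\<lambda>x. ennreal \<bar>(v - u) x\<bar>) \<le> ennreal (\<delta> * l)" by (intro norm \<delta>)
      also have "\<delta> * l = \<epsilon> / 2" using l by (simp add: \<delta>_def)
      also have "ennreal (\<epsilon> / 2) < ennreal \<epsilon>" using \<epsilon> by (simp add: ennreal_lessI)
      finally show "snd (L_fun_space M \<beta>) (v - u) < ennreal \<epsilon>" by (simp add: L_fun_space_def)
    qed
  qed
  moreover have "norm_totally_bounded (L_fun_space M \<beta>) B" if B: "norm_bounded Y B" for B
    unfolding norm_totally_bounded_def
  proof (intro conjI allI impI)
    show "B \<subseteq> fst (L_fun_space M \<beta>)" using B sub by (auto simp: norm_bounded_def)
    fix \<epsilon> :: real assume \<epsilon>: "0 < \<epsilon>"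
    obtain K where K: "\<And>u. u \<in> B \<Longrightarrow> snd Y u \<le> ennreal K" and BY: "B \<subseteq> fst Y" using B by (auto simp: norm_bounded_def)
    define L where "L = max K 0 + 1"
    have L: "0 < L" by (simp add: L_def)
    have BC: "(\<lambda>x. u x / L) \<in> C" if "u \<in> B" for u
    proof (intro scale L)
      have "snd Y u \<le> ennreal K" by (rule K[OF that])
      also have "\<dots> \<le> ennreal (max K 0)" by (intro ennreal_leI) simp
      also have "\<dots> < ennreal L" by (simp add: L_def ennreal_lessI)
      finally show "snd Y u < ennreal L" .
    qed (use that BY in auto)
    define r where "r = min 1 (\<epsilon> / (2 * L))"
    have r: "0 < r" "r \<le> 1" using \<epsilon> L by (auto simp: r_def)
    obtain c :: "('a \<Rightarrow> real) \<Rightarrow> 'c" where c: "finite (c ` C)" "\<And>u v. u \<in> C \<Longrightarrow> v \<in> C \<Longrightarrow> c u = c v \<Longrightarrow>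
           (\<integral>\<^sup>+x. ennreal (\<bar>(u - v) x\<bar> powr \<beta> x) \<partial>M) \<le> ennreal (r powr b)"
      using colour[of "r powr b"] r by auto
    define d where "d u = c (\<lambda>x. u x / L)" for u
    define rep where "rep k = (SOME u. u \<in> B \<and> d u = k)" for k
    have rep: "rep (d u) \<in> B \<and> d (rep (d u)) = d u" if "u \<in> B" for u
      unfolding rep_def by (rule someI[of _ u]) (use that in simp)
    show "\<exists>F. finite F \<and> F \<subseteq> fst (L_fun_space M \<beta>) \<and> (\<forall>u\<in>B. \<exists>v\<in>F. snd (L_fun_space M \<beta>) (u - v) < ennreal \<epsilon>)"
    proof (intro exI[of _ "rep ` d ` B"] conjI ballI)
      have "d ` B \<subseteq> c ` C" using BC by (auto simp: d_def)
      then show "finite (rep ` d ` B)" using c(1) finite_subset by blast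
      show "rep ` d ` B \<subseteq> fst (L_fun_space M \<beta>)" using rep BY sub by blast
      fix u assume u: "u \<in> B"
      define v where "v = rep (d u)"
      have v: "v \<in> B" "d u = d v" using rep[OF u] by (simp_all add: v_def)
      have "(\<integral>\<^sup>+x. ennreal (\<bar>((\<lambda>x. u x / L) - (\<lambda>x. v x / L)) x\<bar> powr \<beta> x) \<partial>M) \<le> ennreal (r powr b)"
        using c(2)[OF BC[OF u] BC[OF v(1)]] v(2) by (simp only: d_def)
      then have I: "(\<integral>\<^sup>+x. ennreal (\<bar>(u - v) x / L\<bar> powr \<beta> x) \<partial>M) \<le> ennreal (r powr b)"
        by (simp add: diff_divide_distrib)
      have "Lp_norm M \<beta> (\<lambda>x. ennreal \<bar>(u - v) x\<bar>) \<le> ennreal (L * r)"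
      proof (rule Lp_norm_scaled_le[OF L r(1) _ _ _ I, where J = "(1 / r) powr b"])
        show "AE x in M. (1 / r) powr \<beta> x \<le> (1 / r) powr b"
          using ab(4) by eventually_elim (use r in \<open>intro powr_mono; simp\<close>)
        show "(1 / r) powr b * r powr b \<le> 1" using r by (simp flip: powr_mult)
        show "u - v \<in> borel_measurable M" unfolding fun_diff_def
          using Y(1)[of u] Y(1)[of v] BY u v by (intro borel_measurable_diff) auto
      qed (use \<beta>m in auto)
      also have "L * r \<le> \<epsilon> / 2" using L by (auto simp: r_def min_def field_simps)
      then have "ennreal (L * r) < ennreal \<epsilon>" using \<epsilon> by (intro ennreal_lessI) auto
      finally show "\<exists>v\<in>rep ` d ` B. snd (L_fun_space M \<beta>) (u - v) < ennreal \<epsilon>"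
        using u by (auto simp: L_fun_space_def v_def intro!: bexI[of _ u])
    qed
  qed
  ultimately show ?thesis by (simp add: compactly_embedded_def)
qed

lemma Lp_norm_finite:
  assumes p: "p \<in> bounded_exponents M" and u: "u \<in> Lp_space M p"
  shows "Lp_norm M p (\<lambda>x. ennreal \<bar>u x\<bar>) < \<infinity>"
proof -
  obtain l where l: "0 < l" "modular M p (\<lambda>x. ennreal \<bar>l * u x\<bar>) < \<infinity>" and um: "u \<in> borel_measurable M"
    using u by (auto simp: Lp_space_def)
  obtain a b where ab: "0 < a" "AE x in M. a \<le> p x \<and> p x \<le> b" using bounded_exponentsD(3)[OF p] by blast
  obtain I where I: "modular M p (\<lambda>x. ennreal \<bar>l * u x\<bar>) = ennreal I" "0 \<le> I"
    using l(2) by (cases "modular M p (\<lambda>x. ennreal \<bar>l * u x\<bar>)") auto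
  have I': "(\<integral>\<^sup>+x. ennreal (\<bar>u x / (1 / l)\<bar> powr p x) \<partial>M) \<le> ennreal I"
    using I l by (simp add: modular_def ennreal_powr_ennreal mult.commute)
  define k where "k = (max 1 I) powr (1 / a)"
  have k: "1 \<le> k" unfolding k_def using ab by (intro ge_one_powr_ge_zero) auto
  have ka: "k powr a = max 1 I" using ab by (simp add: k_def powr_powr)
  have "Lp_norm M p (\<lambda>x. ennreal \<bar>u x\<bar>) \<le> ennreal (1 / l * k)"
  proof (rule Lp_norm_scaled_le[OF _ _ _ _ _ I' um bounded_exponentsD(1)[OF p], where J = "(1 / k) powr a"])
    show "AE x in M. (1 / k) powr p x \<le> (1 / k) powr a"
      using ab(2) by eventually_elim (use k in \<open>intro powr_mono'; simp\<close>)
    have "(1 / k) powr a * I = I / max 1 I" using k by (simp add: powr_divide ka)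
    then show "(1 / k) powr a * I \<le> 1" by simp
  qed (use l k in auto)
  then show ?thesis using le_less_trans by fastforce
qed

text \<open>The gradient is allowed to take the value \<open>\<infinity>\<close>; integrability confines this to a null set, which is
added to the exceptional set.\<close>

lemma hajlasz_classI:
  fixes M :: "'a::metric_space measure"
  assumes M: "sets M = sets borel" and [measurable]: "u \<in> borel_measurable M" and p: "\<And>x. 0 < p x"
    and up: "(\<integral>\<^sup>+x. ennreal (\<bar>u x\<bar> powr p x) \<partial>M) \<le> ennreal K"
    and G [measurable]: "G \<in> borel_measurable M" and GK: "modular M p G \<le> ennreal K"
    and grad: "AE x in M. P x" "\<And>x y. P x \<Longrightarrow> P y \<Longrightarrow> 0 < dist x y \<Longrightarrow> dist x y < 1 \<Longrightarrow>
        ennreal \<bar>u x - u y\<bar> \<le> ennreal (dist x y powr t x) * G x + ennreal (dist x y powr t y) * G y"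
  shows "u \<in> hajlasz_class M p t K"
proof -
  let ?Z = "{x\<in>space M. G x = \<infinity>}"
  have "\<infinity> * emeasure M ?Z = (\<integral>\<^sup>+x. \<infinity> * indicator ?Z x \<partial>M)" by (simp add: nn_integral_cmult_indicator)
  also have "\<dots> \<le> modular M p G"
    unfolding modular_def by (intro nn_integral_mono) (auto simp: indicator_def ennreal_powr_def)
  also have "\<dots> \<le> ennreal K" by (rule GK)
  finally have "emeasure M ?Z = 0" by (cases "emeasure M ?Z = 0") (auto simp: ennreal_top_mult top_unique)
  then have "AE x in M. G x \<noteq> \<infinity>" by (subst AE_iff_measurable[OF _ refl]) auto
  then have "AE x in M. P x \<and> G x \<noteq> \<infinity>" using grad(1) by eventually_elim simp
  then obtain N where N': "{x\<in>space M. \<not> (P x \<and> G x \<noteq> \<infinity>)} \<subseteq> N" "emeasure M N = 0" "N \<in> sets M"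
    by (rule AE_E)
  then have N: "N \<in> null_sets M" "{x\<in>space M. \<not> (P x \<and> G x \<noteq> \<infinity>)} \<subseteq> N" by auto
  define g where "g x = enn2real (G x)" for x
  have "(\<integral>\<^sup>+x. ennreal (g x powr p x) \<partial>M) \<le> modular M p G"
    unfolding modular_def by (intro nn_integral_mono) (simp add: ennreal_powr_def g_def)
  then have gK: "(\<integral>\<^sup>+x. ennreal (g x powr p x) \<partial>M) \<le> ennreal K" using GK by simp
  have sp: "space M = UNIV" using sets_eq_imp_space_eq[OF M] by simp
  have "\<bar>u x - u y\<bar> \<le> dist x y powr t x * g x + dist x y powr t y * g y"
    if xy: "x \<notin> N" "y \<notin> N" "dist x y < 1" for x y
  proof (cases "x = y")
    case False
    have fin: "P x" "P y" "G x = ennreal (g x)" "G y = ennreal (g y)"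
    proof -
      have "P z \<and> G z = ennreal (g z)" if "z \<notin> N" for z
      proof -
        have "P z \<and> G z \<noteq> \<infinity>" using N(2) that sp by blast
        then show ?thesis by (simp add: g_def less_top)
      qed
      then show "P x" "P y" "G x = ennreal (g x)" "G y = ennreal (g y)" using xy by blast+
    qed
    have "ennreal \<bar>u x - u y\<bar> \<le> ennreal (dist x y powr t x * g x + dist x y powr t y * g y)"
      using grad(2)[OF fin(1,2)] xy(3) False unfolding fin(3,4)
      by (simp add: ennreal_mult g_def)
    then show ?thesis by (subst (asm) ennreal_le_iff) (auto simp: g_def)
  qed (simp add: g_def)
  then show ?thesis unfolding hajlasz_class_def
    using N(1) gK up assms(2) by (auto intro!: bexI[of _ g] bexI[of _ N] simp: g_def[abs_def])
qed

section \<open>Bounded sets of the spaces M and N\<close>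

lemma dyadic_scale_exists:
  fixes d :: real
  assumes "0 < d"
  obtains k :: int where "2 powi (- k - 1) \<le> d" "d < 2 powi (- k)"
proof -
  define j where "j = \<lfloor>log 2 d\<rfloor>"
  have "2 powr of_int j \<le> 2 powr log 2 d" unfolding j_def by (intro powr_mono) auto
  moreover have "2 powr log 2 d < 2 powr of_int (j + 1)" unfolding j_def by (intro powr_less_mono) linarith+
  ultimately have "2 powi j \<le> d" "d < 2 powi (j + 1)"
    using assms by (simp_all add: powr_real_of_int'[symmetric])
  then show ?thesis using that[of "- j - 1"] by (simp add: add.commute)
qed

lemma le_lq_norm:
  assumes "0 < q"
  shows "a k \<le> lq_norm q a"
proof (cases "q = \<infinity>")
  case True then show ?thesis by (auto simp: lq_norm_def intro: SUP_upper)
next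
  case False
  then obtain r where r: "q = ereal r" "0 < r" using assms by (cases q) auto
  have "ennreal_powr (a k) r = (\<Sum>\<^sub>\<infinity>i\<in>{k}. ennreal_powr (a i) r)" by simp
  also have "\<dots> \<le> (\<Sum>\<^sub>\<infinity>i. ennreal_powr (a i) r)"
    by (rule infsum_mono_neutral) (auto intro!: nonneg_summable_on_complete)
  finally have "ennreal_powr (ennreal_powr (a k) r) (1 / r) \<le> ennreal_powr (\<Sum>\<^sub>\<infinity>i. ennreal_powr (a i) r) (1 / r)"
    using r by (intro ennreal_powr_mono) auto
  then show ?thesis using r by (simp add: ennreal_powr_inverse lq_norm_def)
qed

lemma divide_ennreal_eq_mult: "0 < L \<Longrightarrow> x / ennreal L = ennreal (1 / L) * x"
  by (simp add: divide_ennreal_def inverse_ennreal inverse_eq_divide mult.commute)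

lemma integral_powr_le_of_Lp_norm:
  assumes "\<And>x. 0 < p x" "0 < L" "Lp_norm M p (\<lambda>x. ennreal \<bar>u x\<bar>) < ennreal L"
  shows "(\<integral>\<^sup>+x. ennreal (\<bar>u x / L\<bar> powr p x) \<partial>M) \<le> 1"
  using Lp_norm_lessD[OF assms(1,3)] modular_real[OF assms(2), of M p u] assms(2) by (simp add: abs_divide)

text \<open>Since \<open>\<ell>^q\<close> dominates the supremum, \<open>sup_k g_k\<close> is a gradient for all scales at once.\<close>

lemma M_ball_scaled:
  assumes M: "sets M = sets borel" and p: "p \<in> bounded_exponents M" and q: "q \<in> exponents M"
    and u: "u \<in> borel_measurable M" and L: "0 < L"
    and lt: "Lp_norm M p (\<lambda>x. ennreal \<bar>u x\<bar>) + M_seminorm M s p q u < ennreal L"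
  shows "(\<lambda>x. u x / L) \<in> hajlasz_class M p s 1"
proof -
  note p_pos = bounded_exponentsD(2)[OF p]
  have lt1: "Lp_norm M p (\<lambda>x. ennreal \<bar>u x\<bar>) < ennreal L" and lt2: "M_seminorm M s p q u < ennreal L"
    using lt by (auto intro: le_less_trans[rotated])
  obtain g where g: "g \<in> vector_gradients M s u" "Lp_lq_norm M p q g < ennreal L"
    using lt2 unfolding M_seminorm_def INF_less_iff by blast
  have gm [measurable]: "g k \<in> borel_measurable M" for k using g(1) by (auto simp: vector_gradients_def)
  obtain N where N: "N \<in> null_sets M" and grad: "\<And>k x y. x \<notin> N \<Longrightarrow> y \<notin> N \<Longrightarrow>
      2 powi (-k-1) \<le> dist x y \<Longrightarrow> dist x y < 2 powi (-k) \<Longrightarrow>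
      ennreal \<bar>u x - u y\<bar> \<le> ennreal (dist x y powr s x) * g k x + ennreal (dist x y powr s y) * g k y"
    using g(1) unfolding vector_gradients_def by auto
  define G where "G x = (SUP k. g k x) / ennreal L" for x
  have Gm: "G \<in> borel_measurable M" unfolding G_def[abs_def] by measurable
  have q0: "0 < q x" for x using q by (simp add: exponents_def)
  have "modular M p G \<le> modular M p (\<lambda>x. lq_norm (q x) (\<lambda>k. g k x) / ennreal L)"
    unfolding G_def using p_pos le_lq_norm[OF q0]
    by (intro modular_mono AE_I2 divide_right_mono_ennreal SUP_least) (auto intro: less_imp_le)
  also have "\<dots> \<le> 1" using Lp_norm_lessD[OF p_pos g(2)[unfolded Lp_lq_norm_def]] .
  finally have GK: "modular M p G \<le> ennreal 1" by simp
  show ?thesis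
  proof (rule hajlasz_classI[OF M _ p_pos _ Gm GK AE_not_in[OF N]])
    show "(\<lambda>x. u x / L) \<in> borel_measurable M" using u by measurable
    show "(\<integral>\<^sup>+x. ennreal (\<bar>u x / L\<bar> powr p x) \<partial>M) \<le> ennreal 1"
      using integral_powr_le_of_Lp_norm[OF p_pos L lt1] by simp
    fix x y assume xy: "x \<notin> N" "y \<notin> N" "0 < dist x y" "dist x y < 1"
    obtain k where k: "2 powi (-k-1) \<le> dist x y" "dist x y < 2 powi (-k)" using dyadic_scale_exists[OF xy(3)] .
    have le: "ennreal (1 / L) * g k z \<le> G z" for z
      unfolding G_def divide_ennreal_eq_mult[OF L] by (intro mult_left_mono SUP_upper) auto
    have "ennreal \<bar>u x / L - u y / L\<bar> = ennreal (1 / L) * ennreal \<bar>u x - u y\<bar>"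
      using L by (simp add: ennreal_mult'[symmetric] abs_divide flip: diff_divide_distrib)
    also have "\<dots> \<le> ennreal (1 / L) * (ennreal (dist x y powr s x) * g k x + ennreal (dist x y powr s y) * g k y)"
      by (intro mult_left_mono grad xy k) auto
    also have "\<dots> = ennreal (dist x y powr s x) * (ennreal (1 / L) * g k x) + ennreal (dist x y powr s y) * (ennreal (1 / L) * g k y)"
      by (simp add: distrib_left mult.left_commute)
    also have "\<dots> \<le> ennreal (dist x y powr s x) * G x + ennreal (dist x y powr s y) * G y"
      by (intro add_mono mult_left_mono le) auto
    finally show "ennreal \<bar>u x / L - u y / L\<bar> \<le> ennreal (dist x y powr s x) * G x + ennreal (dist x y powr s y) * G y" .
  qed
qed

lemma modular_cmult_le:
  assumes [measurable]: "f \<in> borel_measurable M" "p \<in> borel_measurable M"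
    and r: "0 < r" and J: "AE x in M. r powr p x \<le> J" "0 \<le> J"
  shows "modular M p (\<lambda>x. ennreal r * f x) \<le> ennreal J * modular M p f"
proof -
  have mult: "ennreal_powr (ennreal r * y) e = ennreal (r powr e) * ennreal_powr y e" for y e
    using r by (cases y) (auto simp: ennreal_powr_def powr_mult ennreal_mult ennreal_mult_top ennreal_mult_eq_top_iff enn2real_mult)
  have [measurable]: "(\<lambda>x. ennreal_powr (f x) (p x)) \<in> borel_measurable M"
    unfolding ennreal_powr_def by measurable
  have "modular M p (\<lambda>x. ennreal r * f x) \<le> (\<integral>\<^sup>+x. ennreal J * ennreal_powr (f x) (p x) \<partial>M)"
    unfolding modular_def mult
    by (rule nn_integral_mono_AE, use J(1) in eventually_elim) (auto intro!: mult_right_mono ennreal_leI)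
  also have "\<dots> = ennreal J * modular M p f" unfolding modular_def by (simp add: nn_integral_cmult)
  finally show ?thesis .
qed

text \<open>Each level satisfies \<open>\<parallel>g_k\<parallel> \<le> const\<close> in \<open>L^p\<close>. For distances about \<open>2^-k\<close> one has
\<open>d^s \<le> d^t 2^-(\<delta>k)\<close>, so the level \<open>k\<close> may be damped by \<open>2^-(\<delta>k)\<close>; the damped levels have
summable modulars, and their pointwise \<open>\<ell>^p\<close>-sum is a single gradient of order \<open>t\<close>.\<close>

lemma N_ball_scaled:
  assumes M: "sets M = sets borel" and p: "p \<in> bounded_exponents M" and q: "q \<in> exponents M"
    and \<delta>: "0 < \<delta>" "AE x in M. t x + \<delta> \<le> s x"
  shows "\<exists>K>0. \<forall>u L. u \<in> borel_measurable M \<longrightarrow> 0 < L \<longrightarrow>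
     Lp_norm M p (\<lambda>x. ennreal \<bar>u x\<bar>) + N_seminorm M s p q u < ennreal L \<longrightarrow> (\<lambda>x. u x / L) \<in> hajlasz_class M p t K"
proof -
  note p_pos = bounded_exponentsD(2)[OF p]
  note pm [measurable] = bounded_exponentsD(1)[OF p]
  obtain a b where ab: "0 < a" "a \<le> 1" "1 \<le> b" "AE x in M. a \<le> p x \<and> p x \<le> b"
    using bounded_exponentsD(3)[OF p] by blast
  have q': "0 < essinf M q" using q by (simp add: exponents_def)
  obtain q1 where q1: "0 < q1" "AE x in M. ereal q1 \<le> q x" using essinf_posD[OF q'] by blast
  define c :: real where "c = 2 powr (1 / q1)"
  have c: "1 \<le> c" unfolding c_def using q1(1) by (intro ge_one_powr_ge_zero) auto
  define r :: real where "r = 2 powr (- (\<delta> * a))"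
  have r: "0 < r" "r < 1" unfolding r_def using \<delta> ab by (auto intro!: powr_less_one simp: powr_minus inverse_less_1_iff)
  define K where "K = max 1 (\<Sum>k. c powr b * r ^ k)"
  have K: "1 \<le> K" by (simp add: K_def)
  show ?thesis
  proof (intro exI[of _ K] conjI allI impI)
    fix u and L :: real assume [measurable]: "u \<in> borel_measurable M" and L: "0 < L"
      and lt: "Lp_norm M p (\<lambda>x. ennreal \<bar>u x\<bar>) + N_seminorm M s p q u < ennreal L"
    have lt1: "Lp_norm M p (\<lambda>x. ennreal \<bar>u x\<bar>) < ennreal L" and lt2: "N_seminorm M s p q u < ennreal L"
      using lt by (auto intro: le_less_trans[rotated])
    obtain g where g: "g \<in> vector_gradients M s u" "lq_Lp_norm M p q g < ennreal L"
      using lt2 unfolding N_seminorm_def INF_less_iff by blast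
    have gm [measurable]: "g k \<in> borel_measurable M" for k using g(1) by (auto simp: vector_gradients_def)
    obtain N where N: "N \<in> null_sets M" and grad: "\<And>k x y. x \<notin> N \<Longrightarrow> y \<notin> N \<Longrightarrow>
        2 powi (-k-1) \<le> dist x y \<Longrightarrow> dist x y < 2 powi (-k) \<Longrightarrow>
        ennreal \<bar>u x - u y\<bar> \<le> ennreal (dist x y powr s x) * g k x + ennreal (dist x y powr s y) * g k y"
      using g(1) unfolding vector_gradients_def by auto
    obtain m where m: "0 < m" "lq_Lp_modular M p q (\<lambda>k x. g k x / ennreal m) \<le> 1" "ennreal m < ennreal L"
      using g(2) unfolding lq_Lp_norm_def INF_less_iff by auto
    have mL: "m < L" using m by (simp add: ennreal_less_iff)
    \<comment> \<open>The infimum defining one term of the modular is at most \<open>1\<close>, so some \<open>l < 2\<close> is admissible, and \<open>l^(1/q) \<le> c\<close>.\<close>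
    have level: "modular M p (\<lambda>x. ennreal (1 / (L * c)) * g k x) \<le> 1" for k
    proof -
      let ?I = "\<lambda>k. INF l \<in> {l::real. 0 < l \<and>
        modular M p (\<lambda>x. g k x / ennreal m / ennreal (l powr real_of_ereal (1 / q x))) \<le> 1}. ennreal l"
      have "?I k = (\<Sum>\<^sub>\<infinity>i\<in>{k}. ?I i)" by simp
      also have "\<dots> \<le> (\<Sum>\<^sub>\<infinity>i. ?I i)"
        by (rule infsum_mono_neutral) (auto intro!: nonneg_summable_on_complete)
      also have "\<dots> \<le> 1" using m(2) by (simp add: lq_Lp_modular_def)
      also have "\<dots> < ennreal 2" using ennreal_lessI[of 2 1] by simp
      finally obtain l where l: "0 < l" "l < 2" and
        lm: "modular M p (\<lambda>x. g k x / ennreal m / ennreal (l powr real_of_ereal (1 / q x))) \<le> 1"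
        unfolding INF_less_iff by (auto simp: ennreal_less_iff)
      have "modular M p (\<lambda>x. ennreal (1 / (L * c)) * g k x)
          \<le> modular M p (\<lambda>x. g k x / ennreal m / ennreal (l powr real_of_ereal (1 / q x)))"
      proof (rule modular_mono)
        show "AE x in M. ennreal (1 / (L * c)) * g k x \<le> g k x / ennreal m / ennreal (l powr real_of_ereal (1 / q x))"
          using q1(2)
        proof eventually_elim
          case (elim x)
          define i where "i = real_of_ereal (1 / q x)"
          have i: "0 \<le> i \<and> i \<le> 1 / q1"
            using elim q1(1) by (cases "q x") (auto simp: i_def frac_le one_ereal_def zero_ereal_def)
          have "l powr i \<le> 2 powr i" using l i by (intro powr_mono2) auto
          also have "\<dots> \<le> c" unfolding c_def using i by (intro powr_mono) auto
          finally have lc: "l powr i \<le> c" .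
          have "g k x / ennreal m / ennreal (l powr i) = ennreal (1 / (l powr i)) * (ennreal (1 / m) * g k x)"
            using m(1) l by (simp add: divide_ennreal_eq_mult)
          also have "\<dots> = ennreal (1 / (m * l powr i)) * g k x"
          proof -
            have "ennreal (1 / (m * l powr i)) = ennreal (1 / (l powr i)) * ennreal (1 / m)"
              using m(1) l ennreal_mult[of "1 / (l powr i)" "1 / m"] by (simp add: mult.commute)
            then show ?thesis by (simp only: mult.assoc)
          qed
          finally have eq: "g k x / ennreal m / ennreal (l powr i) = ennreal (1 / (m * l powr i)) * g k x" .
          have "m * l powr i \<le> L * c" using m(1) mL lc by (intro mult_mono) auto
          moreover have "0 < m * l powr i" using m(1) l by simp
          ultimately have "1 / (L * c) \<le> 1 / (m * l powr i)" by (intro frac_le) auto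
          then show ?case unfolding i_def[symmetric] eq by (intro mult_right_mono ennreal_leI) auto
        qed
      qed (use p_pos in \<open>auto intro: less_imp_le\<close>)
      with lm show ?thesis by simp
    qed
    define h where "h k x = ennreal (2 powr (- (\<delta> * real k)) / L) * g (int k) x" for k :: nat and x
    have [measurable]: "h k \<in> borel_measurable M" for k unfolding h_def[abs_def] by measurable
    have hK: "modular M p (h k) \<le> ennreal (c powr b * r ^ k)" for k
    proof -
      define \<rho> where "\<rho> = 2 powr (- (\<delta> * real k)) * c"
      have \<rho>: "0 < \<rho>" using c by (simp add: \<rho>_def)
      have "h k = (\<lambda>x. ennreal \<rho> * (ennreal (1 / (L * c)) * g (int k) x))"
        using L c by (simp add: h_def[abs_def] \<rho>_def mult.assoc[symmetric] ennreal_mult[symmetric])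
      then have "modular M p (h k) \<le> ennreal (c powr b * r ^ k) * modular M p (\<lambda>x. ennreal (1 / (L * c)) * g (int k) x)"
      proof (simp only:, intro modular_cmult_le \<rho>)
        show "AE x in M. \<rho> powr p x \<le> c powr b * r ^ k"
          using ab(4)
        proof eventually_elim
          case (elim x)
          have "2 powr (- (\<delta> * real k * p x)) \<le> 2 powr (- (\<delta> * real k * a))"
            using elim \<delta> by (intro powr_mono) (auto intro!: mult_left_mono)
          also have "\<dots> = r ^ k" unfolding r_def by (simp add: powr_powr mult_ac flip: powr_realpow)
          finally have "2 powr (- (\<delta> * real k * p x)) \<le> r ^ k" .
          moreover have "c powr p x \<le> c powr b" using elim c by (intro powr_mono) auto
          ultimately have "2 powr (- (\<delta> * real k * p x)) * c powr p x \<le> r ^ k * c powr b"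
            using r by (intro mult_mono) auto
          then show ?case using c by (simp add: \<rho>_def powr_mult powr_powr mult.commute)
        qed
      qed (use r in auto)
      also have "\<dots> \<le> ennreal (c powr b * r ^ k) * 1" by (intro mult_left_mono level) auto
      finally show ?thesis by simp
    qed
    define S where "S x = (\<Sum>k. ennreal_powr (h k x) (p x))" for x
    have hm [measurable]: "(\<lambda>x. ennreal_powr (h k x) (p x)) \<in> borel_measurable M" for k
      unfolding ennreal_powr_def by measurable
    have Sm [measurable]: "S \<in> borel_measurable M" unfolding S_def[abs_def] by measurable
    define G where "G x = ennreal_powr (S x) (1 / p x)" for x
    have Gm: "G \<in> borel_measurable M" unfolding G_def[abs_def] ennreal_powr_def by measurable
    have hG: "h k x \<le> G x" for k x
    proof -
      have "ennreal_powr (h k x) (p x) \<le> S x"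
        unfolding S_def using sum_le_suminf[of "\<lambda>k. ennreal_powr (h k x) (p x)" "{k}"] by simp
      then have "ennreal_powr (ennreal_powr (h k x) (p x)) (1 / p x) \<le> G x"
        unfolding G_def using p_pos by (intro ennreal_powr_mono) (auto intro: less_imp_le)
      then show ?thesis using p_pos by (simp add: ennreal_powr_inverse)
    qed
    have "modular M p G = (\<integral>\<^sup>+x. S x \<partial>M)"
      unfolding modular_def G_def using p_pos ennreal_powr_inverse[of "1 / p _"] by (intro nn_integral_cong) simp
    also have "\<dots> = (\<Sum>k. modular M p (h k))" unfolding S_def modular_def by (intro nn_integral_suminf) measurable
    also have "\<dots> \<le> (\<Sum>k. ennreal (c powr b * r ^ k))" by (intro suminf_le hK) auto
    also have "\<dots> = ennreal (\<Sum>k. c powr b * r ^ k)"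
      using r by (intro suminf_ennreal2) (auto intro!: summable_mult summable_geometric)
    also have "\<dots> \<le> ennreal K" by (intro ennreal_leI) (simp add: K_def)
    finally have GK: "modular M p G \<le> ennreal K" .
    have good: "AE x in M. x \<notin> N \<and> t x + \<delta> \<le> s x" using AE_not_in[OF N] \<delta>(2) by eventually_elim simp
    show "(\<lambda>x. u x / L) \<in> hajlasz_class M p t K"
    proof (rule hajlasz_classI[OF M _ p_pos _ Gm GK good])
      show "(\<lambda>x. u x / L) \<in> borel_measurable M" by measurable
      have "(\<integral>\<^sup>+x. ennreal (\<bar>u x / L\<bar> powr p x) \<partial>M) \<le> 1" by (rule integral_powr_le_of_Lp_norm[OF p_pos L lt1])
      also have "1 \<le> ennreal K" using K by simp
      finally show "(\<integral>\<^sup>+x. ennreal (\<bar>u x / L\<bar> powr p x) \<partial>M) \<le> ennreal K" .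
      fix x y assume x: "x \<notin> N \<and> t x + \<delta> \<le> s x" and y: "y \<notin> N \<and> t y + \<delta> \<le> s y"
        and d: "0 < dist x y" "dist x y < 1"
      obtain k where k: "2 powi (-k-1) \<le> dist x y" "dist x y < 2 powi (-k)" using dyadic_scale_exists[OF d(1)] .
      have "0 \<le> k"
      proof (rule ccontr)
        assume "\<not> 0 \<le> k"
        then have "(1::real) \<le> 2 powi (- k - 1)" by (intro one_le_power_int) auto
        with k d show False by linarith
      qed
      then obtain n where n: "k = int n" using nonneg_int_cases by blast
      have k2: "dist x y < 2 powr (- real n)"
        using k(2) powr_real_of_int'[of 2 "- int n"] by (simp add: n)
      have le: "ennreal (1 / L) * (ennreal (dist x y powr s z) * g k z) \<le> ennreal (dist x y powr t z) * G z"
        if z: "t z + \<delta> \<le> s z" for z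
      proof -
        have "dist x y powr s z \<le> dist x y powr (t z + \<delta>)" using d z by (intro powr_mono') auto
        also have "\<dots> = dist x y powr t z * dist x y powr \<delta>" by (simp add: powr_add)
        also have "\<dots> \<le> dist x y powr t z * (2 powr (- real n)) powr \<delta>"
          using k2 d \<delta> by (intro mult_left_mono powr_mono2) auto
        also have "\<dots> = dist x y powr t z * 2 powr (- (\<delta> * real n))" by (simp add: powr_powr mult.commute)
        finally have "1 / L * dist x y powr s z \<le> dist x y powr t z * (2 powr (- (\<delta> * real n)) / L)"
          using L by (simp add: divide_right_mono)
        then have "ennreal (1 / L * dist x y powr s z) * g k z \<le> ennreal (dist x y powr t z * (2 powr (- (\<delta> * real n)) / L)) * g k z"
          by (intro mult_right_mono ennreal_leI) auto
        also have "\<dots> = ennreal (dist x y powr t z) * h n z"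
          unfolding h_def n using L by (subst ennreal_mult) (simp_all only: mult.assoc divide_nonneg_pos powr_ge_zero)
        also have "\<dots> \<le> ennreal (dist x y powr t z) * G z" by (intro mult_left_mono hG) auto
        finally have "ennreal (1 / L * dist x y powr s z) * g k z \<le> ennreal (dist x y powr t z) * G z" .
        moreover have "ennreal (1 / L * dist x y powr s z) = ennreal (1 / L) * ennreal (dist x y powr s z)"
          using L by (intro ennreal_mult) auto
        ultimately show ?thesis by (simp only: mult.assoc)
      qed
      have "ennreal \<bar>u x / L - u y / L\<bar> = ennreal (1 / L) * ennreal \<bar>u x - u y\<bar>"
        using L by (simp add: ennreal_mult'[symmetric] abs_divide flip: diff_divide_distrib)
      also have "\<dots> \<le> ennreal (1 / L) * (ennreal (dist x y powr s x) * g k x + ennreal (dist x y powr s y) * g k y)"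
        using x y by (intro mult_left_mono grad k) auto
      also have "\<dots> \<le> ennreal (dist x y powr t x) * G x + ennreal (dist x y powr t y) * G y"
        unfolding distrib_left using x y by (intro add_mono le) auto
      finally show "ennreal \<bar>u x / L - u y / L\<bar> \<le> ennreal (dist x y powr t x) * G x + ennreal (dist x y powr t y) * G y" .
    qed
  qed (use K in simp)
qed

section \<open>Large orbits imply compactness\<close>

lemma packing_limitD:
  fixes f :: "'a::metric_space \<Rightarrow> enat"
  assumes "((\<lambda>R. INF x\<in>UNIV - ball x0 R. f x) \<longlongrightarrow> \<infinity>) at_top"
  shows "\<exists>R. \<forall>x. x \<notin> ball x0 R \<longrightarrow> enat n < f x"
proof -
  have "eventually (\<lambda>R. enat n < (INF x\<in>UNIV - ball x0 R. f x)) at_top"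
    using assms by (rule order_tendstoD) simp
  then obtain R where "enat n < (INF x\<in>UNIV - ball x0 R. f x)"
    by (auto simp: eventually_at_top_linorder)
  then have "enat n < f x" if "x \<notin> ball x0 R" for x using that by (auto dest: less_INF_D)
  then show ?thesis by blast
qed

lemma compact_embedding_of_large_orbits:
  fixes M :: "'a::metric_space measure"
  assumes mms: "metric_measure_space M" and dbl: "geometrically_doubling TYPE('a)"
    and Q: "Q \<in> log_exponents M" and reg: "lower_Ahlfors_regular M Q" and H: "H \<subseteq> Iso M"
    and pack: "\<forall>x0. \<forall>r\<in>{0<..<1/3}. ((\<lambda>R. INF x\<in>UNIV - ball x0 R. packing_number H x r) \<longlongrightarrow> \<infinity>) at_top"
    and p: "p \<in> log_exponents M" and t: "t \<in> log_exponents M" and tp: "0 < e" "AE x in M. t x * p x + e \<le> Q x"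
    and \<beta>: "\<beta> \<in> bounded_exponents M" and p\<beta>: "exp_less M p \<beta>"
    and \<beta>\<sigma>: "exp_less M \<beta> (\<lambda>x. Q x * p x / (Q x - t x * p x))"
    and A: "A \<subseteq> borel_measurable M" "\<And>u. u \<in> A \<Longrightarrow> n u < \<infinity>" and K: "0 < K"
    and scale: "\<And>u L. u \<in> borel_measurable M \<Longrightarrow> 0 < L \<Longrightarrow> n u < ennreal L \<Longrightarrow> (\<lambda>x. u x / L) \<in> hajlasz_class M p t K"
  shows "invariant_subspace M H (A, n) \<hookrightarrow>\<hookrightarrow> L_fun_space M \<beta>"
proof -
  note pD = log_exponentsD[OF mms p] and tD = log_exponentsD[OF mms t] and QD = log_exponentsD[OF mms Q]
  obtain pl pu where pb: "0 < pl" "\<And>x. pl \<le> p x" "\<And>x. p x \<le> pu" using pD(3) by blast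
  obtain tl tu where tb: "0 < tl" "\<And>x. tl \<le> t x" "\<And>x. t x \<le> tu" using tD(3) by blast
  obtain Ql Qu where Qb: "0 < Ql" "\<And>x. Ql \<le> Q x" "\<And>x. Q x \<le> Qu" using QD(3) by blast
  have Qu: "0 < Qu" using Qb(1) Qb(2)[of undefined] Qb(3)[of undefined] by linarith
  obtain b where b: "0 < b" "\<And>x r. 0 < r \<Longrightarrow> r \<le> 1 \<Longrightarrow> ennreal (b * r powr Q x) \<le> emeasure M (ball x r)"
    using reg unfolding lower_Ahlfors_regular_def by auto
  have cont: "continuous_on UNIV (\<lambda>x. Q x - t x * p x)"
    by (intro continuous_on_diff continuous_on_mult pD(1) tD(1) QD(1))
  have "AE x in M. e \<le> Q x - t x * p x" using tp(2) by eventually_elim simp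
  then have gap: "e \<le> Q x - t x * p x" for x by (rule AE_ge_imp_ge[OF mms cont])
  define \<theta> where "\<theta> = min 1 (e / Qu)"
  have \<theta>: "0 < \<theta>" "\<theta> \<le> 1" using tp(1) Qu by (auto simp: \<theta>_def)
  have \<theta>': "t x * p x \<le> (1 - \<theta>) * Q x" for x
  proof -
    have "\<theta> * Q x \<le> e / Qu * Qu" using Qb(1) Qb(2)[of x] Qb(3)[of x] tp(1) Qu by (intro mult_mono) (auto simp: \<theta>_def)
    then show ?thesis using gap[of x] Qu by (simp add: algebra_simps)
  qed
  interpret subcritical M p t Q pl pu tl Ql Qu b \<theta>
    by unfold_locales (fact mms pD(1,2) tD(1,2) QD(1,2) pb tb(1,2) Qb \<theta> \<theta>' b)+
  obtain e1 where e1: "0 < e1" "AE x in M. p x + e1 \<le> \<beta> x" using exp_lessD[OF p\<beta>] by blast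
  obtain e2 where e2: "0 < e2" "AE x in M. \<beta> x + e2 \<le> Q x * p x / (Q x - t x * p x)" using exp_lessD[OF \<beta>\<sigma>] by blast
  have e12: "0 < min e1 e2" using e1 e2 by simp
  have \<beta>e: "AE x in M. p x + min e1 e2 \<le> \<beta> x \<and> \<beta> x + min e1 e2 \<le> Q x * p x / (Q x - t x * p x)"
    using e1(2) e2(2) by eventually_elim auto
  define C where "C = {u \<in> hajlasz_class M p t K. \<forall>\<phi>\<in>H. AE x in M. u (\<phi> x) = u x}"
  have pk: "\<exists>R. \<forall>x. x \<notin> ball x0 R \<longrightarrow> enat n < packing_number H x r" if "0 < r" "r < 1 / 3" for r n and x0 :: 'a
    using pack that by (intro packing_limitD) auto
  note compactness = subcritical_compactness[OF dbl H pk bounded_exponentsD(1)[OF \<beta>] e12 \<beta>e K C_def]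
  show ?thesis
  proof (rule compact_embedding_of_finite_colourings[OF \<beta>, where C = C])
    fix u and L :: real
    assume L: "0 < L" and lt: "snd (invariant_subspace M H (A, n)) u < ennreal L"
      and u: "u \<in> fst (invariant_subspace M H (A, n)) \<or>
        (\<exists>v\<in>fst (invariant_subspace M H (A, n)). \<exists>w\<in>fst (invariant_subspace M H (A, n)). u = v - w)"
    have good: "v \<in> borel_measurable M \<and> (\<forall>\<phi>\<in>H. AE x in M. v (\<phi> x) = v x)"
      if "v \<in> fst (invariant_subspace M H (A, n))" for v
      using that A(1) by (auto simp: invariant_subspace_def)
    have um: "u \<in> borel_measurable M \<and> (\<forall>\<phi>\<in>H. AE x in M. u (\<phi> x) = u x)"
      using u
    proof
      assume "\<exists>v\<in>fst (invariant_subspace M H (A, n)). \<exists>w\<in>fst (invariant_subspace M H (A, n)). u = v - w"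
      then obtain v w where vw: "v \<in> fst (invariant_subspace M H (A, n))" "w \<in> fst (invariant_subspace M H (A, n))"
        "u = v - w" by blast
      have "AE x in M. u (\<phi> x) = u x" if "\<phi> \<in> H" for \<phi>
      proof -
        have "AE x in M. v (\<phi> x) = v x" "AE x in M. w (\<phi> x) = w x" using good[OF vw(1)] good[OF vw(2)] that by blast+
        then show ?thesis by eventually_elim (simp add: vw(3))
      qed
      moreover have "u \<in> borel_measurable M"
        unfolding vw(3) fun_diff_def using good[OF vw(1)] good[OF vw(2)] by (intro borel_measurable_diff) auto
      ultimately show ?thesis by blast
    qed (rule good)
    have "(\<lambda>x. u x / L) \<in> hajlasz_class M p t K"
      using um L lt by (intro scale) (auto simp: invariant_subspace_def)
    moreover have "AE x in M. u (\<phi> x) / L = u x / L" if "\<phi> \<in> H" for \<phi>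
      using um[THEN conjunct2, rule_format, OF that] by eventually_elim simp
    ultimately show "(\<lambda>x. u x / L) \<in> C" by (simp add: C_def)
  next
    show "\<exists>K'. \<forall>u\<in>C. (\<integral>\<^sup>+x. ennreal (\<bar>u x\<bar> powr \<beta> x) \<partial>M) \<le> ennreal K'" by (rule compactness(1))
  next
    fix \<epsilon> :: real assume "0 < \<epsilon>"
    then show "\<exists>c :: ('a \<Rightarrow> real) \<Rightarrow> 'a \<Rightarrow> int. finite (c ` C) \<and> (\<forall>u\<in>C. \<forall>v\<in>C. c u = c v \<longrightarrow>
           (\<integral>\<^sup>+x. ennreal (\<bar>(u - v) x\<bar> powr \<beta> x) \<partial>M) \<le> ennreal \<epsilon>)"
      by - (rule compactness(2))
  qed (use A in \<open>auto simp: invariant_subspace_def\<close>)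
qed

section \<open>Localized Lipschitz functions in the spaces M and N\<close>

lemma ennreal_infsum:
  fixes f :: "'i \<Rightarrow> real"
  assumes "f summable_on A" "\<And>i. 0 \<le> f i"
  shows "(\<Sum>\<^sub>\<infinity>i\<in>A. ennreal (f i)) = ennreal (\<Sum>\<^sub>\<infinity>i\<in>A. f i)"
proof -
  have "(\<Sum>\<^sub>\<infinity>i\<in>A. ennreal (f i)) = (SUP F\<in>{F. finite F \<and> F \<subseteq> A}. (\<Sum>i\<in>F. ennreal (f i)))"
    by (rule nonneg_infsum_complete) simp
  also have "\<dots> = (SUP F\<in>{F. finite F \<and> F \<subseteq> A}. ennreal (\<Sum>i\<in>F. f i))"
    using assms(2) by (simp add: sum_ennreal)
  also have "\<dots> = ennreal (\<Sum>\<^sub>\<infinity>i\<in>A. f i)"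
    using infsum_nonneg_is_SUPREMUM_ennreal[OF assms(1)] assms(2) by simp
  finally show ?thesis .
qed

lemma two_sided_geometric_summable:
  assumes "0 < c"
  shows "(\<lambda>k::int. 2 powr (- (c * \<bar>real_of_int k\<bar>))) summable_on UNIV"
proof -
  let ?f = "\<lambda>k::int. 2 powr (- (c * \<bar>real_of_int k\<bar>))"
  have geo: "summable (\<lambda>n. (2 powr (- c)) ^ n)"
    using assms by (intro summable_geometric) (simp add: powr_minus inverse_less_1_iff)
  have pw: "2 powr (- (c * real n)) = (2 powr (- c)) ^ n" for n
    by (simp add: powr_powr flip: powr_realpow)
  have "(\<lambda>n::nat. ?f (int n)) summable_on UNIV"
    using geo by (intro norm_summable_imp_summable_on) (simp add: pw)
  then have 1: "?f summable_on range int" by (subst summable_on_reindex) (auto simp: comp_def)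
  have "summable (\<lambda>n. 2 powr (- c) * (2 powr (- c)) ^ n)" using geo by (rule summable_mult)
  moreover have "norm (?f (- int n - 1)) = 2 powr (- c) * (2 powr (- c)) ^ n" for n
  proof -
    have "- (c * \<bar>real_of_int (- int n - 1)\<bar>) = - c + - (c * real n)" by (simp add: algebra_simps)
    then have "?f (- int n - 1) = 2 powr (- c) * 2 powr (- (c * real n))" by (simp only: powr_add)
    then show ?thesis by (simp add: pw)
  qed
  ultimately have "summable (\<lambda>n. norm (?f (- int n - 1)))" by simp
  then have "(\<lambda>n::nat. ?f (- int n - 1)) summable_on UNIV" by (rule norm_summable_imp_summable_on)
  then have 2: "?f summable_on range (\<lambda>n. - int n - 1)"
    by (subst summable_on_reindex) (auto simp: comp_def inj_on_def)
  have "(UNIV::int set) = range int \<union> range (\<lambda>n. - int n - 1)"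
  proof -
    have "k \<in> range int \<union> range (\<lambda>n. - int n - 1)" for k :: int
    proof (cases "0 \<le> k")
      case True then show ?thesis by (metis UnI1 nonneg_int_cases rangeI)
    next
      case False
      then have "k = - int (nat (- k - 1)) - 1" by simp
      then show ?thesis by blast
    qed
    then show ?thesis by blast
  qed
  moreover have "range int \<inter> range (\<lambda>n. - int n - 1) = {}" by auto
  ultimately show ?thesis using summable_on_Un_disjoint[OF 1 2] by simp
qed

lemma two_sided_geometric:
  assumes "0 < c"
  obtains S where "1 \<le> S" "(\<Sum>\<^sub>\<infinity>k::int. 2 powr (- (c * \<bar>real_of_int k\<bar>))) = S"
    "(\<lambda>k::int. 2 powr (- (c * \<bar>real_of_int k\<bar>))) summable_on UNIV"
proof -
  have "(\<Sum>k\<in>{0::int}. 2 powr (- (c * \<bar>real_of_int k\<bar>))) \<le> (\<Sum>\<^sub>\<infinity>k::int. 2 powr (- (c * \<bar>real_of_int k\<bar>)))"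
    by (rule finite_sum_le_infsum[OF two_sided_geometric_summable[OF assms]]) auto
  then show ?thesis using that two_sided_geometric_summable[OF assms] by simp
qed

text \<open>The bound does not depend on \<open>q\<close>, which matters because \<open>q\<close> varies from point to point. Without
decay (\<open>\<alpha> = 0\<close>) only \<open>q = \<infinity>\<close> is admitted.\<close>

lemma lq_norm_geometric_le:
  assumes C: "0 < C" and c: "0 \<le> \<alpha>" and a: "\<And>k. a k \<le> ennreal (C * 2 powr (- (\<alpha> * \<bar>real_of_int k\<bar>)))"
    and q: "q = \<infinity> \<or> 0 < \<alpha> \<and> ereal q1 \<le> q" and q1: "0 < q1"
    and S: "0 < \<alpha> \<Longrightarrow> (\<Sum>\<^sub>\<infinity>k::int. 2 powr (- (\<alpha> * q1 * \<bar>real_of_int k\<bar>))) \<le> S" "1 \<le> S"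
  shows "lq_norm q a \<le> ennreal (C * S powr (1 / q1))"
proof -
  have S1: "1 \<le> S powr (1 / q1)" using S(2) q1 by (intro ge_one_powr_ge_zero) auto
  show ?thesis
  proof (cases "q = \<infinity>")
    case True
    have "C * 2 powr (- (\<alpha> * \<bar>real_of_int k\<bar>)) \<le> C * S powr (1 / q1)" for k
    proof (intro mult_left_mono)
      have "2 powr (- (\<alpha> * \<bar>real_of_int k\<bar>)) \<le> 2 powr 0" using c by (intro powr_mono) auto
      then show "2 powr (- (\<alpha> * \<bar>real_of_int k\<bar>)) \<le> S powr (1 / q1)" using S1 by simp
    qed (use C in simp)
    then have "a k \<le> ennreal (C * S powr (1 / q1))" for k by (meson a ennreal_leI order_trans)
    then show ?thesis using True by (auto simp: lq_norm_def intro: SUP_least)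
  next
    case False
    with q have \<alpha>: "0 < \<alpha>" and "ereal q1 \<le> q" by auto
    with False obtain r where r: "q = ereal r" "q1 \<le> r" by (cases q) auto
    have r0: "0 < r" using r q1 by simp
    have \<alpha>q: "0 < \<alpha> * q1" using \<alpha> q1 by simp
    let ?f = "\<lambda>k::int. 2 powr (- (\<alpha> * q1 * \<bar>real_of_int k\<bar>))"
    have "ennreal_powr (a k) r \<le> ennreal (C powr r * ?f k)" for k
    proof -
      have "ennreal_powr (a k) r \<le> ennreal ((C * 2 powr (- (\<alpha> * \<bar>real_of_int k\<bar>))) powr r)"
        using ennreal_powr_mono[OF less_imp_le[OF r0] a[of k]] C by (simp add: ennreal_powr_ennreal)
      also have "(C * 2 powr (- (\<alpha> * \<bar>real_of_int k\<bar>))) powr r = C powr r * 2 powr (- (\<alpha> * \<bar>real_of_int k\<bar> * r))"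
        using C by (simp add: powr_mult powr_powr)
      also have "2 powr (- (\<alpha> * \<bar>real_of_int k\<bar> * r)) \<le> ?f k"
        using r \<alpha> mult_left_mono[of q1 r "\<alpha> * \<bar>real_of_int k\<bar>"] by (intro powr_mono) (auto simp: mult_ac)
      finally show ?thesis by (simp add: ennreal_leI mult_left_mono)
    qed
    then have "(\<Sum>\<^sub>\<infinity>k. ennreal_powr (a k) r) \<le> (\<Sum>\<^sub>\<infinity>k. ennreal (C powr r * ?f k))"
      by (intro infsum_mono nonneg_summable_on_complete) auto
    also have "\<dots> = ennreal (\<Sum>\<^sub>\<infinity>k. C powr r * ?f k)"
      by (intro ennreal_infsum summable_on_cmult_right two_sided_geometric_summable \<alpha>q) simp
    also have "\<dots> = ennreal (C powr r * (\<Sum>\<^sub>\<infinity>k. ?f k))" by (simp add: infsum_cmult_right')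
    also have "\<dots> \<le> ennreal (C powr r * S)" using S(1)[OF \<alpha>] by (intro ennreal_leI mult_left_mono) auto
    finally have "lq_norm q a \<le> ennreal_powr (ennreal (C powr r * S)) (1 / r)"
      unfolding lq_norm_def r(1) using r0 by (auto intro!: ennreal_powr_mono)
    also have "\<dots> = ennreal ((C powr r * S) powr (1 / r))" using S(2) by (intro ennreal_powr_ennreal) simp
    also have "(C powr r * S) powr (1 / r) = C * S powr (1 / r)" using C S(2) r0 by (simp add: powr_mult powr_powr)
    also have "\<dots> \<le> C * S powr (1 / q1)" using C S(2) r q1 by (intro mult_left_mono powr_mono frac_le) auto
    finally show ?thesis by (simp add: ennreal_leI)
  qed
qed

lemma modular_of_bounded_localized:
  assumes p: "p \<in> bounded_exponents M" and C: "0 \<le> C" and V: "0 \<le> V"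
  shows "\<exists>m>0. \<forall>E\<in>sets M. \<forall>f. emeasure M E \<le> ennreal V \<longrightarrow> (AE x in M. f x \<le> ennreal (C * indicator E x)) \<longrightarrow>
     modular M p (\<lambda>x. f x / ennreal m) \<le> 1"
proof -
  obtain a b where ab: "0 < a" "AE x in M. a \<le> p x \<and> p x \<le> b" using bounded_exponentsD(3)[OF p] by blast
  note p_pos = bounded_exponentsD(2)[OF p]
  define \<kappa> where "\<kappa> = (1 / max 1 V) powr (1 / a)"
  have \<kappa>: "0 < \<kappa>" "\<kappa> \<le> 1" unfolding \<kappa>_def using ab by (auto intro!: powr_le1)
  have \<kappa>a: "\<kappa> powr a = 1 / max 1 V" using ab by (simp add: \<kappa>_def powr_powr)
  define m where "m = max 1 C / \<kappa>"
  have m: "0 < m" using \<kappa> by (simp add: m_def)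
  have Cm: "C / m \<le> \<kappa>" using \<kappa> C by (simp add: m_def field_simps)
  show ?thesis
  proof (intro exI[of _ m] conjI m ballI allI impI)
    fix E and f :: "'a \<Rightarrow> ennreal" assume [measurable]: "E \<in> sets M" and E: "emeasure M E \<le> ennreal V"
      and f: "AE x in M. f x \<le> ennreal (C * indicator E x)"
    have "modular M p (\<lambda>x. f x / ennreal m) \<le> (\<integral>\<^sup>+x. ennreal (1 / max 1 V) * indicator E x \<partial>M)"
      unfolding modular_def
    proof (rule nn_integral_mono_AE, use f ab(2) in eventually_elim)
      case (elim x)
      have "f x / ennreal m \<le> ennreal (C * indicator E x) / ennreal m" by (intro divide_right_mono_ennreal elim)
      also have "\<dots> = ennreal (C / m * indicator E x)" using m C by (simp add: divide_ennreal)
      finally have "ennreal_powr (f x / ennreal m) (p x) \<le> ennreal_powr (ennreal (C / m * indicator E x)) (p x)"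
        using p_pos by (intro ennreal_powr_mono) (auto intro: less_imp_le)
      also have "\<dots> = ennreal ((C / m * indicator E x) powr p x)" using C m by (intro ennreal_powr_ennreal) simp
      also have "\<dots> \<le> ennreal (1 / max 1 V) * indicator E x"
      proof (cases "x \<in> E")
        case True
        have "(C / m) powr p x \<le> \<kappa> powr p x" using Cm C m p_pos by (intro powr_mono2) (auto intro: less_imp_le)
        also have "\<dots> \<le> \<kappa> powr a" using \<kappa> elim by (intro powr_mono') auto
        finally show ?thesis using True by (simp add: \<kappa>a ennreal_leI)
      qed simp
      finally show ?case .
    qed
    also have "\<dots> = ennreal (1 / max 1 V) * emeasure M E" by (simp add: nn_integral_cmult_indicator)
    also have "\<dots> \<le> ennreal (1 / max 1 V) * ennreal V" by (intro mult_left_mono E) auto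
    also have "\<dots> \<le> 1" using V by (simp add: ennreal_mult'[symmetric])
    finally show "modular M p (\<lambda>x. f x / ennreal m) \<le> 1" .
  qed
qed

lemma essinf_top_imp_AE:
  assumes "essinf M q = \<infinity>" shows "AE x in M. q x = \<infinity>"
proof -
  have "AE x in M. \<forall>n::nat. ereal (real n) \<le> q x"
    unfolding AE_all_countable using assms by (intro allI essinf_geD) simp
  then show ?thesis
  proof eventually_elim
    case (elim x)
    show ?case
    proof (rule ccontr)
      assume "q x \<noteq> \<infinity>"
      then obtain n :: nat where "q x < ereal (real n)" using less_PInf_Ex_of_nat by auto
      with elim show False by (simp add: leD)
    qed
  qed
qed

text \<open>Combines the two alternatives on \<open>s\<close> and \<open>q\<close>: either there is a margin \<open>\<alpha> > 0\<close>, or \<open>\<alpha> = 0\<close>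
and \<open>q = \<infinity>\<close> almost everywhere.\<close>

lemma smoothness_margin:
  assumes s: "s \<in> bounded_exponents M" and q: "q \<in> exponents M"
    and sq: "esssup M (ereal \<circ> s) < 1 \<and> essinf M q < \<infinity> \<or> esssup M (ereal \<circ> s) \<le> 1 \<and> essinf M q = \<infinity>"
  obtains \<alpha> q1 where "0 \<le> \<alpha>" "AE x in M. \<alpha> \<le> s x \<and> s x \<le> 1 - \<alpha>" "0 < q1"
    "AE x in M. ereal q1 \<le> q x" "(AE x in M. q x = \<infinity>) \<or> 0 < \<alpha>"
proof -
  obtain q1 where q1: "0 < q1" "AE x in M. ereal q1 \<le> q x"
    using q essinf_posD[of M q] unfolding exponents_def by blast
  obtain s1 s2 where s1: "0 < s1" "AE x in M. s1 \<le> s x \<and> s x \<le> s2" using bounded_exponentsD(3)[OF s] by blast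
  show ?thesis
  proof (cases "esssup M (ereal \<circ> s) < 1")
    case True
    then obtain c where c: "esssup M (ereal \<circ> s) < ereal c" "ereal c < 1" using ereal_dense2 by blast
    then have "AE x in M. s x \<le> c" by (intro esssup_leD) simp
    then have "AE x in M. min s1 (1 - c) \<le> s x \<and> s x \<le> 1 - min s1 (1 - c)"
      using s1(2) by eventually_elim auto
    with s1(1) c(2) q1 show ?thesis by (intro that[of "min s1 (1 - c)" q1]) auto
  next
    case False
    then have le: "esssup M (ereal \<circ> s) \<le> ereal 1" and qi: "essinf M q = \<infinity>" using sq by auto
    have "AE x in M. 0 \<le> s x \<and> s x \<le> 1 - 0" using esssup_leD[OF le] s1(2) by eventually_elim (use s1(1) in simp)
    with q1 essinf_top_imp_AE[OF qi] show ?thesis by (intro that[of 0 q1]) auto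
  qed
qed

text \<open>At scale \<open>2^-k\<close> a function with values in \<open>[0,1]\<close> and Lipschitz constant \<open>1/r\<close> oscillates by at
most \<open>min 1 (2^-k/r)\<close>. Division by \<open>2^(-(k+1)s)\<close>, a lower bound of \<open>d^s\<close>, gives a gradient that
decays like \<open>2^(-(1-s)k)\<close> for fine scales and like \<open>2^(sk)\<close> for coarse ones.\<close>

lemma localized_lipschitz_gradient:
  fixes M :: "'a::metric_space measure" and r :: real
  assumes M: "sets M = sets borel" and s: "s \<in> bounded_exponents M"
    and E: "E \<in> sets M" and r: "0 < r" "r \<le> 1"
    and w: "\<And>y. 0 \<le> w y" "\<And>y. w y \<le> 1" "\<And>y. y \<notin> E \<Longrightarrow> w y = 0" "\<And>y z. \<bar>w y - w z\<bar> \<le> dist y z / r"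
    and \<alpha>: "0 \<le> \<alpha>" "AE x in M. \<alpha> \<le> s x \<and> s x \<le> 1 - \<alpha>"
  shows "\<exists>g\<in>vector_gradients M s w. (\<forall>k x. x \<notin> E \<longrightarrow> g k x = 0) \<and>
     (AE x in M. \<forall>k. g k x \<le> ennreal (2 / r * 2 powr (- (\<alpha> * \<bar>real_of_int k\<bar>))))"
proof -
  note sm [measurable] = bounded_exponentsD(1)[OF s] and s_pos = bounded_exponentsD(2)[OF s]
  note [measurable] = E
  define c where "c k = min 1 (2 powr (- real_of_int k) / r)" for k :: int
  have c0: "0 < c k" for k using r by (simp add: c_def)
  define g where "g k x = ennreal (indicator E x * (2 powr ((real_of_int k + 1) * s x) * c k))" for k x
  have gm: "g k \<in> borel_measurable M" for k unfolding g_def[abs_def] by measurable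
  have grad: "ennreal \<bar>w x - w y\<bar> \<le> ennreal (dist x y powr s x) * g k x + ennreal (dist x y powr s y) * g k y"
    if d: "2 powi (-k-1) \<le> dist x y" "dist x y < 2 powi (-k)" for k x y
  proof -
    have "2 powi (-k-1) = 2 powr (- (real_of_int k + 1))" "2 powi (-k) = 2 powr (- real_of_int k)"
      using powr_real_of_int'[of 2 "-k-1"] powr_real_of_int'[of 2 "-k"] by auto
    then have d': "2 powr (- (real_of_int k + 1)) \<le> dist x y" "dist x y < 2 powr (- real_of_int k)" using d by auto
    have wc: "\<bar>w x - w y\<bar> \<le> c k"
    proof -
      have "\<bar>w x - w y\<bar> \<le> 1" using w(1,2)[of x] w(1,2)[of y] by linarith
      moreover have "\<bar>w x - w y\<bar> \<le> 2 powr (- real_of_int k) / r"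
        using w(4)[of x y] d'(2) r by (meson divide_right_mono less_imp_le order_trans)
      ultimately show ?thesis by (simp add: c_def)
    qed
    have part: "ennreal \<bar>w x - w y\<bar> \<le> ennreal (dist x y powr s z) * g k z" if z: "z \<in> E" for z
    proof -
      have "1 = (2 powr (- (real_of_int k + 1))) powr s z * 2 powr ((real_of_int k + 1) * s z)"
        unfolding powr_powr powr_add[symmetric] by (simp add: algebra_simps)
      also have "\<dots> \<le> dist x y powr s z * 2 powr ((real_of_int k + 1) * s z)"
        using d'(1) s_pos by (intro mult_right_mono powr_mono2) (auto intro: less_imp_le)
      finally have "c k * 1 \<le> c k * (dist x y powr s z * 2 powr ((real_of_int k + 1) * s z))"
        using c0 by (intro mult_left_mono) (auto intro: less_imp_le)
      then have "\<bar>w x - w y\<bar> \<le> dist x y powr s z * (2 powr ((real_of_int k + 1) * s z) * c k)"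
        using wc by (simp add: mult_ac)
      then have "ennreal \<bar>w x - w y\<bar> \<le> ennreal (dist x y powr s z * (2 powr ((real_of_int k + 1) * s z) * c k))"
        by (rule ennreal_leI)
      also have "\<dots> = ennreal (dist x y powr s z) * g k z"
        using z c0[of k] unfolding g_def by (subst ennreal_mult) auto
      finally show ?thesis .
    qed
    show ?thesis
    proof (cases "x \<in> E")
      case True then show ?thesis using part by (simp add: add_increasing2)
    next
      case False
      show ?thesis
      proof (cases "y \<in> E")
        case True then show ?thesis using part by (simp add: add_increasing)
      qed (use w(3) False in simp)
    qed
  qed
  have "AE x in M. \<forall>k. g k x \<le> ennreal (2 / r * 2 powr (- (\<alpha> * \<bar>real_of_int k\<bar>)))"
    using \<alpha>(2)
  proof eventually_elim
    case (elim x)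
    have "2 powr ((real_of_int k + 1) * s x) * c k \<le> 2 / r * 2 powr (- (\<alpha> * \<bar>real_of_int k\<bar>))" for k
    proof (cases "0 \<le> k")
      case True
      have "2 powr ((real_of_int k + 1) * s x) * c k \<le> 2 powr ((real_of_int k + 1) * s x) * (2 powr (- real_of_int k) / r)"
        by (intro mult_left_mono) (auto simp: c_def)
      also have "\<dots> = 2 powr (real_of_int k * s x + s x - real_of_int k) / r"
        by (simp add: powr_add powr_diff powr_minus field_simps)
      also have "\<dots> \<le> 2 powr (1 - \<alpha> * real_of_int k) / r"
      proof -
        have "real_of_int k * s x \<le> real_of_int k * (1 - \<alpha>)" using True elim by (intro mult_left_mono) auto
        then have "real_of_int k * s x + s x - real_of_int k \<le> 1 - \<alpha> * real_of_int k"
          using elim \<alpha>(1) by (simp add: algebra_simps)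
        then show ?thesis using r by (intro divide_right_mono powr_mono) auto
      qed
      also have "\<dots> = 2 / r * 2 powr (- (\<alpha> * \<bar>real_of_int k\<bar>))" using True by (simp add: powr_diff powr_minus field_simps)
      finally show ?thesis .
    next
      case False
      have "2 powr ((real_of_int k + 1) * s x) * c k \<le> 2 powr ((real_of_int k + 1) * s x) * 1"
        by (intro mult_left_mono) (auto simp: c_def)
      also have "\<dots> \<le> 2 powr (1 + \<alpha> * real_of_int k)"
      proof -
        have "real_of_int (- k) * \<alpha> \<le> real_of_int (- k) * s x" using False elim by (intro mult_left_mono) auto
        then have "(real_of_int k + 1) * s x \<le> 1 + \<alpha> * real_of_int k"
          using elim \<alpha>(1) by (simp add: algebra_simps)
        then show ?thesis by (simp add: powr_mono)
      qed
      also have "\<dots> = 2 * 2 powr (- (\<alpha> * \<bar>real_of_int k\<bar>))" using False by (simp add: powr_add)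
      also have "\<dots> \<le> 2 / r * 2 powr (- (\<alpha> * \<bar>real_of_int k\<bar>))" using r by (intro mult_right_mono) (auto simp: field_simps)
      finally show ?thesis .
    qed
    then show ?case by (auto simp: g_def indicator_def intro!: ennreal_leI)
  qed
  moreover have "g \<in> vector_gradients M s w"
    using gm grad unfolding vector_gradients_def by (auto intro!: bexI[of _ "{}"])
  moreover have "\<forall>k x. x \<notin> E \<longrightarrow> g k x = 0" by (simp add: g_def)
  ultimately show ?thesis by blast
qed

text \<open>The bound \<open>m\<close> is uniform over all supports \<open>E\<close> of measure at most \<open>V\<close>, so it applies to a whole
sequence of bumps escaping to infinity.\<close>

lemma localized_lipschitz_bounded:
  fixes M :: "'a::metric_space measure" and r V :: real
  assumes M: "sets M = sets borel" and p: "p \<in> bounded_exponents M" and s: "s \<in> bounded_exponents M" and q: "q \<in> exponents M"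
    and sq: "esssup M (ereal \<circ> s) < 1 \<and> essinf M q < \<infinity> \<or> esssup M (ereal \<circ> s) \<le> 1 \<and> essinf M q = \<infinity>"
    and r: "0 < r" "r \<le> 1" and V: "0 \<le> V"
  shows "\<exists>m>0. \<forall>E\<in>sets M. \<forall>w\<in>borel_measurable M. emeasure M E \<le> ennreal V \<longrightarrow>
     (\<forall>y. 0 \<le> w y \<and> w y \<le> 1) \<longrightarrow> (\<forall>y. y \<notin> E \<longrightarrow> w y = 0) \<longrightarrow> (\<forall>y z. \<bar>w y - w z\<bar> \<le> dist y z / r) \<longrightarrow>
     w \<in> Lp_space M p \<and> Lp_norm M p (\<lambda>x. ennreal \<bar>w x\<bar>) \<le> ennreal m \<and>
     M_seminorm M s p q w \<le> ennreal m \<and> N_seminorm M s p q w \<le> ennreal m"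
proof -
  note p_pos = bounded_exponentsD(2)[OF p]
  obtain \<alpha> q1 where \<alpha>: "0 \<le> \<alpha>" "AE x in M. \<alpha> \<le> s x \<and> s x \<le> 1 - \<alpha>" and q1: "0 < q1" "AE x in M. ereal q1 \<le> q x"
    and q\<alpha>: "(AE x in M. q x = \<infinity>) \<or> 0 < \<alpha>" using smoothness_margin[OF s q sq] by blast
  obtain S where S1: "1 \<le> S" and S: "0 < \<alpha> \<Longrightarrow> (\<Sum>\<^sub>\<infinity>k::int. 2 powr (- (\<alpha> * q1 * \<bar>real_of_int k\<bar>))) = S"
  proof (cases "0 < \<alpha>")
    case True
    then have "0 < \<alpha> * q1" using q1 by simp
    from two_sided_geometric[OF this] that show ?thesis by blast
  qed (use that[of 1] in auto)
  define C where "C = 2 / r * S powr (1 / q1)"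
  have r2: "0 < 2 / r" using r by simp
  have S1': "1 \<le> S powr (1 / q1)" using S1 q1 by (intro ge_one_powr_ge_zero) auto
  have rC: "2 / r \<le> C" unfolding C_def using mult_left_mono[OF S1', of "2 / r"] r by simp
  have C1: "1 \<le> C" using rC r by (smt (verit) divide_le_eq_1_pos le_divide_eq_1_pos)
  obtain m where m: "0 < m" and mod: "\<And>E f. E \<in> sets M \<Longrightarrow> emeasure M E \<le> ennreal V \<Longrightarrow>
      (AE x in M. f x \<le> ennreal (C * indicator E x)) \<Longrightarrow> modular M p (\<lambda>x. f x / ennreal m) \<le> 1"
    using modular_of_bounded_localized[OF p _ V, of C] C1 by auto
  show ?thesis
  proof (intro exI[of _ m] conjI[OF m] ballI allI impI)
    fix E w assume E: "E \<in> sets M" and wm [measurable]: "w \<in> borel_measurable M" and EV: "emeasure M E \<le> ennreal V"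
      and w: "\<forall>y. 0 \<le> w y \<and> w y \<le> 1" "\<forall>y. y \<notin> E \<longrightarrow> w y = 0" "\<forall>y z. \<bar>w y - w z\<bar> \<le> dist y z / r"
    have wE: "ennreal \<bar>w x\<bar> \<le> ennreal (C * indicator E x)" for x
      using w(1)[rule_format, of x] w(2)[rule_format, of x] C1
      by (cases "x \<in> E") (auto intro!: ennreal_leI)
    have wmod: "modular M p (\<lambda>x. ennreal \<bar>w x\<bar> / ennreal m) \<le> 1" using wE by (intro mod[OF E EV] AE_I2)
    have 1: "Lp_norm M p (\<lambda>x. ennreal \<bar>w x\<bar>) \<le> ennreal m" by (rule Lp_norm_le[OF m wmod])
    have "modular M p (\<lambda>x. ennreal \<bar>1 / m * w x\<bar>) \<le> 1"
      using wmod m by (simp add: divide_ennreal abs_mult)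
    then have "modular M p (\<lambda>x. ennreal \<bar>1 / m * w x\<bar>) < \<infinity>" using le_less_trans by fastforce
    moreover have "0 < 1 / m" using m by simp
    ultimately have 2: "w \<in> Lp_space M p" using wm unfolding Lp_space_def by blast
    obtain g where g: "g \<in> vector_gradients M s w" and g0: "\<And>k x. x \<notin> E \<Longrightarrow> g k x = 0"
      and gb: "AE x in M. \<forall>k. g k x \<le> ennreal (2 / r * 2 powr (- (\<alpha> * \<bar>real_of_int k\<bar>)))"
      using localized_lipschitz_gradient[OF M s E r, of w \<alpha>] w \<alpha> by auto
    have "AE x in M. lq_norm (q x) (\<lambda>k. g k x) \<le> ennreal (C * indicator E x)"
    proof -
      have qq: "AE x in M. q x = \<infinity> \<or> 0 < \<alpha> \<and> ereal q1 \<le> q x"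
        using q\<alpha> q1(2) by (elim disjE) (auto elim: eventually_mono)
      show ?thesis
        using gb qq
      proof eventually_elim
        case (elim x)
        show ?case
        proof (cases "x \<in> E")
          case True
          have "lq_norm (q x) (\<lambda>k. g k x) \<le> ennreal (2 / r * S powr (1 / q1))"
            using elim S S1 by (intro lq_norm_geometric_le[OF r2 \<alpha>(1) _ _ q1(1)]) auto
          then show ?thesis using True by (simp add: C_def)
        next
          case False
          then show ?thesis by (auto simp: g0 lq_norm_def ennreal_powr_def)
        qed
      qed
    qed
    then have "modular M p (\<lambda>x. lq_norm (q x) (\<lambda>k. g k x) / ennreal m) \<le> 1" by (rule mod[OF E EV])
    then have "Lp_lq_norm M p q g \<le> ennreal m" unfolding Lp_lq_norm_def by (intro Lp_norm_le m)
    then have 3: "M_seminorm M s p q w \<le> ennreal m" unfolding M_seminorm_def using g by (auto intro: INF_lower2)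
    let ?I = "\<lambda>k. INF l \<in> {l::real. 0 < l \<and>
        modular M p (\<lambda>x. g k x / ennreal m / ennreal (l powr real_of_ereal (1 / q x))) \<le> 1}. ennreal l"
    have I: "?I k \<le> ennreal l" if l: "0 < l" "AE x in M. g k x / ennreal (l powr real_of_ereal (1 / q x)) \<le> ennreal (C * indicator E x)" for k l
    proof (intro INF_lower CollectI conjI l(1))
      have "modular M p (\<lambda>x. g k x / ennreal (l powr real_of_ereal (1 / q x)) / ennreal m) \<le> 1"
        by (rule mod[OF E EV l(2)])
      moreover have "g k x / ennreal (l powr real_of_ereal (1 / q x)) / ennreal m = g k x / ennreal m / ennreal (l powr real_of_ereal (1 / q x))" for x
        using l m by (simp add: divide_ennreal_eq_mult mult.left_commute)
      ultimately show "modular M p (\<lambda>x. g k x / ennreal m / ennreal (l powr real_of_ereal (1 / q x))) \<le> 1" by simp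
    qed
    have gb': "AE x in M. \<forall>k. g k x \<le> ennreal (2 / r * 2 powr (- (\<alpha> * \<bar>real_of_int k\<bar>)) * indicator E x)"
      using gb
    proof eventually_elim
      case (elim x) then show ?case using g0[of x] by (cases "x \<in> E") auto
    qed
    have "(\<Sum>\<^sub>\<infinity>k. ?I k) \<le> 1"
    proof (cases "0 < \<alpha>")
      case True
      \<comment> \<open>Weights with total sum \<open>1\<close> whose \<open>1/q1\<close>-th power is comparable to the decay of the gradient.\<close>
      define l where "l k = 2 powr (- (\<alpha> * q1 * \<bar>real_of_int k\<bar>)) * (1 / S)" for k :: int
      have l0: "0 < l k" for k using S1 by (simp add: l_def)
      have l1: "l k \<le> 1" for k
      proof -
        have "2 powr (- (\<alpha> * q1 * \<bar>real_of_int k\<bar>)) \<le> 2 powr 0" using True q1 by (intro powr_mono) auto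
        then have "l k \<le> 1 * 1" unfolding l_def using S1 by (intro mult_mono) auto
        then show ?thesis by simp
      qed
      have "?I k \<le> ennreal (l k)" for k
      proof (rule I[OF l0])
        show "AE x in M. g k x / ennreal (l k powr real_of_ereal (1 / q x)) \<le> ennreal (C * indicator E x)"
          using gb' q1(2)
        proof eventually_elim
          case (elim x)
          define i where "i = real_of_ereal (1 / q x)"
          have i: "0 \<le> i \<and> i \<le> 1 / q1"
            using elim(2) q1(1) by (cases "q x") (auto simp: i_def frac_le one_ereal_def zero_ereal_def)
          have root: "l k powr (1 / q1) = 2 powr (- (\<alpha> * \<bar>real_of_int k\<bar>)) / S powr (1 / q1)"
            using q1(1) S1 by (simp add: l_def powr_mult powr_powr powr_divide)
          have "2 / r * 2 powr (- (\<alpha> * \<bar>real_of_int k\<bar>)) = C * l k powr (1 / q1)"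
            using S1 S1' by (simp add: root C_def)
          also have "\<dots> \<le> C * l k powr i" using i l0[of k] l1[of k] C1 by (intro mult_left_mono powr_mono') auto
          finally have "2 / r * 2 powr (- (\<alpha> * \<bar>real_of_int k\<bar>)) * indicator E x \<le> C * l k powr i * indicator E x"
            by (intro mult_right_mono) auto
          then have "g k x \<le> ennreal (C * l k powr i * indicator E x)"
            using elim(1) by (meson ennreal_leI order_trans)
          then have "g k x / ennreal (l k powr i) \<le> ennreal (C * l k powr i * indicator E x) / ennreal (l k powr i)"
            by (rule divide_right_mono_ennreal)
          also have "\<dots> = ennreal (C * indicator E x)" using l0[of k] C1 by (subst divide_ennreal) auto
          finally show ?case by (simp add: i_def)
        qed
      qed
      then have "(\<Sum>\<^sub>\<infinity>k. ?I k) \<le> (\<Sum>\<^sub>\<infinity>k. ennreal (l k))" by (intro infsum_mono nonneg_summable_on_complete) auto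
      also have "\<dots> = ennreal (\<Sum>\<^sub>\<infinity>k. l k)"
        unfolding l_def using S1 True q1 by (intro ennreal_infsum summable_on_cmult_left two_sided_geometric_summable) auto
      also have "(\<Sum>\<^sub>\<infinity>k. l k) = 1" using S[OF True] S1 unfolding l_def by (subst infsum_cmult_left') simp
      finally show ?thesis by simp
    next
      case False
      then have \<alpha>0: "\<alpha> = 0" and qi: "AE x in M. q x = \<infinity>" using \<alpha>(1) q\<alpha> by auto
      \<comment> \<open>With \<open>q = \<infinity>\<close> the factor \<open>l^(1/q)\<close> is \<open>1\<close>, so every \<open>l > 0\<close> is admissible and each term vanishes.\<close>
      have small: "?I k \<le> ennreal l" if l: "0 < l" for k l
      proof (rule I[OF l])
        show "AE x in M. g k x / ennreal (l powr real_of_ereal (1 / q x)) \<le> ennreal (C * indicator E x)"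
          using gb' qi
        proof eventually_elim
          case (elim x)
          have "g k x \<le> ennreal (2 / r * indicator E x)" using elim(1) by (simp add: \<alpha>0)
          also have "\<dots> \<le> ennreal (C * indicator E x)" using rC by (intro ennreal_leI mult_right_mono) auto
          finally show ?case using elim(2) l divide_ennreal_eq_mult[of 1 "g k x"] by simp
        qed
      qed
      have "?I k \<le> 0" for k
      proof (rule ennreal_le_epsilon)
        fix l :: real assume "0 < l"
        from small[OF this] show "?I k \<le> 0 + ennreal l" by (simp only: add_0)
      qed
      then have "?I k = 0" for k by (simp only: le_zero_eq)
      then show ?thesis by (simp only: infsum_0_simp zero_le_one)
    qed
    then have "lq_Lp_norm M p q g \<le> ennreal m"
      unfolding lq_Lp_norm_def lq_Lp_modular_def using m by (intro INF_lower CollectI conjI)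
    then have 4: "N_seminorm M s p q w \<le> ennreal m" unfolding N_seminorm_def using g by (auto intro: INF_lower2)
    from 1 2 3 4 show "w \<in> Lp_space M p \<and> Lp_norm M p (\<lambda>x. ennreal \<bar>w x\<bar>) \<le> ennreal m \<and>
      M_seminorm M s p q w \<le> ennreal m \<and> N_seminorm M s p q w \<le> ennreal m" by blast
  qed
qed

section \<open>Compactness implies large orbits\<close>

text \<open>Compactness of the group controls orbits: the sets \<open>{f. f x0 \<in> B(x0,n)}\<close> are open in the
compact-open topology and cover it.\<close>

lemma compact_subgroup_displacement_bounded:
  fixes M :: "'a::metric_space measure"
  assumes "compact_subgroup_Iso M H"
  obtains D where "0 \<le> D" "\<And>h. h \<in> H \<Longrightarrow> dist x0 (h x0) \<le> D"
proof -
  let ?U = "\<lambda>n::nat. {f :: 'a \<Rightarrow> 'a. f ` {x0} \<subseteq> ball x0 (real n)}"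
  have comp: "compactin compact_open_topology H" using assms by (simp add: compact_subgroup_Iso_def)
  have "openin compact_open_topology (?U n)" for n
    unfolding compact_open_topology_def
    by (rule topology_generated_by_Basis, rule CollectI, rule exI[of _ "{x0}"], rule exI[of _ "ball x0 (real n)"]) simp
  moreover have "H \<subseteq> \<Union>(range ?U)"
  proof
    fix f
    obtain n :: nat where "dist x0 (f x0) < real n" using reals_Archimedean2 by blast
    then have "f \<in> ?U n" by simp
    then show "f \<in> \<Union>(range ?U)" by blast
  qed
  ultimately obtain \<F> where F: "finite \<F>" "\<F> \<subseteq> range ?U" "H \<subseteq> \<Union>\<F>"
    using comp unfolding compactin_def by (metis (no_types, lifting) imageE)
  obtain I where I: "finite I" "\<F> = ?U ` I" using finite_subset_image[OF F(1,2)] by blast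
  define D where "D = real (Max (insert 0 I))"
  have "dist x0 (h x0) \<le> D" if "h \<in> H" for h
  proof -
    have "h \<in> \<Union>(?U ` I)" using that F(3) I(2) by blast
    then obtain n where n: "n \<in> I" "h \<in> ?U n" by blast
    then have "dist x0 (h x0) < real n" by simp
    also have "\<dots> \<le> D" unfolding D_def using n(1) I(1) by (intro of_nat_mono Max_ge) auto
    finally show ?thesis by simp
  qed
  moreover have "0 \<le> D" by (simp add: D_def)
  ultimately show ?thesis by (rule that[rotated])
qed

text \<open>A packing with the largest number of points is maximal, so every point of the orbit is closer than \<open>2r\<close> to it.\<close>

lemma orbit_cover_of_packing_number:
  assumes "packing_number H x r \<le> enat N" and r: "0 < r"
  obtains A where "finite A" "card A \<le> N" "\<And>\<xi>. \<xi> \<in> orbit H x \<Longrightarrow> \<exists>a\<in>A. dist a \<xi> < 2 * r"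
proof -
  let ?P = "\<lambda>A. A \<subseteq> orbit H x \<and> (\<forall>\<xi>\<in>A. \<forall>\<eta>\<in>A. \<xi> \<noteq> \<eta> \<longrightarrow> ball \<xi> r \<inter> ball \<eta> r = {})"
  have fin: "finite A \<and> card A \<le> N" if "?P A" for A
  proof -
    have "(if finite A then enat (card A) else \<infinity>) \<le> packing_number H x r"
      unfolding packing_number_def using that by (intro SUP_upper) auto
    then have "(if finite A then enat (card A) else \<infinity>) \<le> enat N" using assms(1) by (rule order_trans)
    then show ?thesis by (cases "finite A") auto
  qed
  have empty: "?P {}" by simp
  have "\<forall>A. ?P A \<longrightarrow> card A < Suc N"
  proof (intro allI impI)
    fix A assume "?P A"
    from fin[OF this] show "card A < Suc N" by simp
  qed
  from Lattices_Big.ex_has_greatest_nat[of ?P, OF empty this]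
  obtain A where A': "?P A \<and> (\<forall>B. ?P B \<longrightarrow> card B \<le> card A)" ..
  note A = A'[THEN conjunct1] and max' = A'[THEN conjunct2]
  have max: "card B \<le> card A" if "?P B" for B using max'[rule_format, of B] that by simp
  have "\<exists>a\<in>A. dist a \<xi> < 2 * r" if \<xi>: "\<xi> \<in> orbit H x" for \<xi>
  proof (rule ccontr)
    assume neg: "\<not> ?thesis"
    then have far: "\<And>a. a \<in> A \<Longrightarrow> 2 * r \<le> dist a \<xi>" by (auto simp: not_less)
    have "\<xi> \<notin> A" using far[of \<xi>] r by auto
    have disj: "ball a r \<inter> ball \<xi> r = {}" if "a \<in> A" for a
    proof (rule ccontr)
      assume "ball a r \<inter> ball \<xi> r \<noteq> {}"
      then obtain z where "dist a z < r" "dist \<xi> z < r" by auto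
      then have "dist a \<xi> < 2 * r" using dist_triangle2[of a \<xi> z] by simp
      with far[OF that] show False by simp
    qed
    then have "?P (insert \<xi> A)" using A \<xi> by (auto simp: Int_commute)
    then have "card (insert \<xi> A) \<le> card A" by (rule max)
    with \<open>\<xi> \<notin> A\<close> fin[OF A] show False by simp
  qed
  with fin[OF A] that show ?thesis by blast
qed

definition orbit_bump :: "('a::metric_space \<Rightarrow> 'a) set \<Rightarrow> 'a \<Rightarrow> real \<Rightarrow> 'a \<Rightarrow> real" where
  "orbit_bump H x r y = max 0 (1 - infdist y (orbit H x) / r)"

lemma infdist_orbit_invariant:
  fixes M :: "'a::metric_space measure"
  assumes H: "compact_subgroup_Iso M H" and \<phi>: "\<phi> \<in> H"
  shows "infdist (\<phi> y) (orbit H x) = infdist y (orbit H x)"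
proof (rule antisym)
  have ne: "orbit H x \<noteq> {}" using \<phi> by (auto simp: orbit_def)
  have le: "infdist (\<psi> z) (orbit H x) \<le> infdist z (orbit H x)" if \<psi>: "\<psi> \<in> H" for \<psi> z
    unfolding infdist_notempty[OF ne, of z]
  proof (rule cINF_greatest[OF ne])
    fix \<xi> assume "\<xi> \<in> orbit H x"
    then obtain h where h: "h \<in> H" "\<xi> = h x" by (auto simp: orbit_def)
    have "\<psi> \<circ> h \<in> H" using H \<psi> h(1) by (simp add: compact_subgroup_Iso_def)
    then have "(\<psi> \<circ> h) x \<in> orbit H x" unfolding orbit_def by blast
    then have "infdist (\<psi> z) (orbit H x) \<le> dist (\<psi> z) ((\<psi> \<circ> h) x)" by (rule infdist_le)
    also have "\<dots> = dist z \<xi>" using H \<psi> h(2) by (auto simp: compact_subgroup_Iso_def Iso_def)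
    finally show "infdist (\<psi> z) (orbit H x) \<le> dist z \<xi>" .
  qed
  show "infdist (\<phi> y) (orbit H x) \<le> infdist y (orbit H x)" by (rule le[OF \<phi>])
  have iso: "\<phi> \<in> Iso M" using H \<phi> by (auto simp: compact_subgroup_Iso_def)
  then have "inj \<phi>" by (intro injI) (metis (mono_tags, lifting) Iso_def dist_eq_0_iff mem_Collect_eq)
  then have "inv \<phi> (\<phi> y) = y" by simp
  moreover have "inv \<phi> \<in> H" using H \<phi> by (simp add: compact_subgroup_Iso_def)
  ultimately show "infdist y (orbit H x) \<le> infdist (\<phi> y) (orbit H x)" using le[of "inv \<phi>" "\<phi> y"] by simp
qed

lemma exists_near_orbit_point:
  assumes "infdist y (orbit H x) < r" "id \<in> H"
  obtains h where "h \<in> H" "dist y (h x) < r"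
proof -
  have "orbit H x \<noteq> {}" using assms(2) by (auto simp: orbit_def)
  then obtain \<xi> where "\<xi> \<in> orbit H x" "dist y \<xi> < r"
    using assms(1) by (auto simp: infdist_notempty cINF_less_iff)
  then show ?thesis using that by (auto simp: orbit_def)
qed

text \<open>Otherwise there are points \<open>z n\<close> going to infinity whose orbits are covered by \<open>N\<close> balls of radius
\<open>2r\<close>. The bump about such an orbit lives in \<open>N\<close> balls of radius \<open>3r < 1\<close>, which is why \<open>r < 1/3\<close>
and the bound on the measure of unit balls appear. Orbits stay within \<open>D\<close> of spheres about \<open>x0\<close>, so
widely spaced \<open>z n\<close> give disjoint supports. In a totally bounded set two bumps would be
\<open>\<epsilon>\<close>-close to the same function, although one of them is at least \<open>1/2\<close> and the other vanishes on
a ball of measure at least \<open>v\<close>.\<close>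

lemma large_orbits_of_compact_embedding:
  fixes M :: "'a::metric_space measure"
  assumes mms: "metric_measure_space M" and unb: "\<not> bounded (UNIV :: 'a set)"
    and sup1: "(SUP x. emeasure M (ball x 1)) < \<infinity>"
    and Q: "Q \<in> log_exponents M" and reg: "lower_Ahlfors_regular M Q"
    and H: "compact_subgroup_Iso M H" and \<beta>: "\<beta> \<in> bounded_exponents M"
    and Y: "\<And>r V. 0 < r \<Longrightarrow> r \<le> 1 \<Longrightarrow> 0 \<le> V \<Longrightarrow> \<exists>m. \<forall>E\<in>sets M. \<forall>w\<in>borel_measurable M. emeasure M E \<le> ennreal V \<longrightarrow>
     (\<forall>y. 0 \<le> w y \<and> w y \<le> 1) \<longrightarrow> (\<forall>y. y \<notin> E \<longrightarrow> w y = 0) \<longrightarrow> (\<forall>y z. \<bar>w y - w z\<bar> \<le> dist y z / r) \<longrightarrow>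
     (\<forall>\<phi>\<in>H. \<forall>y. w (\<phi> y) = w y) \<longrightarrow> w \<in> fst Y \<and> snd Y w \<le> ennreal m"
    and emb: "Y \<hookrightarrow>\<hookrightarrow> L_fun_space M \<beta>"
    and r: "0 < r" "r < 1 / 3"
  shows "((\<lambda>R. INF x\<in>UNIV - ball x0 R. packing_number H x r) \<longlongrightarrow> \<infinity>) at_top"
proof (rule ccontr)
  assume not_lim: "\<not> ?thesis"
  have sM: "sets M = sets borel" and sp: "space M = UNIV"
    using mms sets_eq_imp_space_eq[of M borel] by (auto simp: metric_measure_space_def)
  have "\<exists>N. \<not> eventually (\<lambda>R. enat N < (INF x\<in>UNIV - ball x0 R. packing_number H x r)) at_top"
  proof (rule ccontr)
    assume *: "\<not> ?thesis"
    have "((\<lambda>R. INF x\<in>UNIV - ball x0 R. packing_number H x r) \<longlongrightarrow> \<infinity>) at_top"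
    proof (rule order_tendstoI)
      fix a :: enat assume "a < \<infinity>"
      then obtain N where "a = enat N" by (cases a) auto
      with * show "eventually (\<lambda>R. a < (INF x\<in>UNIV - ball x0 R. packing_number H x r)) at_top" by blast
    qed simp
    with not_lim show False by contradiction
  qed
  then obtain N where N: "\<not> eventually (\<lambda>R. enat N < (INF x\<in>UNIV - ball x0 R. packing_number H x r)) at_top" by blast
  have "\<exists>x. R \<le> dist x0 x \<and> packing_number H x r \<le> enat N" for R :: real
  proof -
    obtain R' where R': "R \<le> R'" "\<not> enat N < (INF x\<in>UNIV - ball x0 R'. packing_number H x r)"
      using N unfolding eventually_at_top_linorder by blast
    then have "(INF x\<in>UNIV - ball x0 R'. packing_number H x r) < enat (Suc N)"
      by (auto simp: not_less intro: le_less_trans)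
    then obtain x where "x \<notin> ball x0 R'" "packing_number H x r < enat (Suc N)" by (auto simp: INF_less_iff)
    moreover from this(2) have "packing_number H x r \<le> enat N" by (cases "packing_number H x r") auto
    ultimately show ?thesis using R'(1) by (intro exI[of _ x]) auto
  qed
  then have "\<exists>X. \<forall>R. R \<le> dist x0 (X R) \<and> packing_number H (X R) r \<le> enat N" by (intro choice) blast
  then obtain X where X: "\<And>R::real. R \<le> dist x0 (X R)" "\<And>R. packing_number H (X R) r \<le> enat N" by blast
  obtain D where D: "0 \<le> D" "\<And>h. h \<in> H \<Longrightarrow> dist x0 (h x0) \<le> D" using compact_subgroup_displacement_bounded[OF H] by blast
  define z where "z = rec_nat (X 0) (\<lambda>_ y. X (dist x0 y + 2 * D + 2))"
  have zS: "z (Suc n) = X (dist x0 (z n) + 2 * D + 2)" for n by (simp add: z_def)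
  have zN: "packing_number H (z n) r \<le> enat N" for n by (cases n) (auto simp: z_def X(2))
  have zfar: "dist x0 (z m) + 2 * D + 2 \<le> dist x0 (z n)" if "m < n" for m n
    using that
  proof (induction n)
    case (Suc n)
    have step: "dist x0 (z n) + 2 * D + 2 \<le> dist x0 (z (Suc n))" unfolding zS by (rule X(1))
    show ?case
    proof (cases "m = n")
      case False
      with Suc have "dist x0 (z m) + 2 * D + 2 \<le> dist x0 (z n)" by simp
      with step D(1) show ?thesis by linarith
    qed (use step in simp)
  qed simp
  have idH: "id \<in> H" and HI: "H \<subseteq> Iso M" using H by (auto simp: compact_subgroup_Iso_def)
  have iso: "dist (h x) (h y) = dist x y" if "h \<in> H" for h x y using that HI by (auto simp: Iso_def)
  have orb: "\<bar>dist x0 (h y) - dist x0 y\<bar> \<le> D" if h: "h \<in> H" for h y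
  proof -
    have "dist x0 (h y) \<le> dist x0 (h x0) + dist (h x0) (h y)" "dist (h x0) (h y) \<le> dist x0 (h x0) + dist x0 (h y)"
      by (rule dist_triangle, rule dist_triangle3)
    then show ?thesis using D(2)[OF h] iso[OF h, of x0 y] by linarith
  qed
  obtain V0 where V0: "(SUP x. emeasure M (ball x 1)) = ennreal V0" "0 \<le> V0"
    using sup1 by (cases "SUP x. emeasure M (ball x 1)") auto
  define V where "V = real N * V0"
  define E where "E n = {y. infdist y (orbit H (z n)) < r}" for n
  define w where "w n = orbit_bump H (z n) r" for n
  have icont: "continuous_on UNIV (\<lambda>y. infdist y (orbit H (z n)))" for n by (intro continuous_intros)
  have "open (E n)" for n unfolding E_def by (intro open_Collect_less icont continuous_on_const)
  then have Em [measurable]: "E n \<in> sets M" for n by (simp add: sM)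
  have "continuous_on UNIV (w n)" for n
    unfolding w_def orbit_bump_def[abs_def] using icont r by (intro continuous_intros) auto
  then have wm [measurable]: "w n \<in> borel_measurable M" for n
    using borel_measurable_continuous_onI measurable_cong_sets[OF sM] by blast
  have EV: "emeasure M (E n) \<le> ennreal V" for n
  proof -
    obtain A where A: "finite A" "card A \<le> N" "\<And>\<xi>. \<xi> \<in> orbit H (z n) \<Longrightarrow> \<exists>a\<in>A. dist a \<xi> < 2 * r"
      using orbit_cover_of_packing_number[OF zN r(1)] by blast
    have "E n \<subseteq> (\<Union>a\<in>A. ball a 1)"
    proof
      fix y assume "y \<in> E n"
      then obtain h where h: "h \<in> H" "dist y (h (z n)) < r" using exists_near_orbit_point[of y H "z n" r] idH by (auto simp: E_def)
      then obtain a where a: "a \<in> A" "dist a (h (z n)) < 2 * r" using A(3)[of "h (z n)"] by (auto simp: orbit_def)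
      have "dist a y < 1" using dist_triangle2[of a y "h (z n)"] h(2) a(2) r(2) by simp
      with a(1) show "y \<in> (\<Union>a\<in>A. ball a 1)" by auto
    qed
    then have "emeasure M (E n) \<le> emeasure M (\<Union>a\<in>A. ball a 1)" using A(1) by (intro emeasure_mono) (auto simp: sM)
    also have "\<dots> \<le> (\<Sum>a\<in>A. emeasure M (ball a 1))" using A(1) by (intro emeasure_subadditive_finite) (auto simp: sM)
    also have "\<dots> \<le> (\<Sum>a\<in>A. ennreal V0)" unfolding V0(1)[symmetric] by (intro sum_mono SUP_upper) auto
    also have "\<dots> = ennreal (real (card A) * V0)" using V0(2) by (simp add: ennreal_mult ennreal_of_nat_eq_real_of_nat)
    also have "\<dots> \<le> ennreal V" unfolding V_def using A(2) V0(2) by (intro ennreal_leI mult_right_mono) auto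
    finally show ?thesis .
  qed
  have w01: "0 \<le> w n y \<and> w n y \<le> 1" for n y
    unfolding w_def orbit_bump_def using r infdist_nonneg[of y "orbit H (z n)"] by auto
  have w0: "w n y = 0" if "y \<notin> E n" for n y
    using that r unfolding w_def orbit_bump_def E_def by (simp add: le_divide_eq)
  have trunc: "\<bar>max 0 (1 - a) - max 0 (1 - b)\<bar> \<le> \<bar>a - b\<bar>" for a b :: real by (simp add: max_def abs_if)
  have wL: "\<bar>w n y - w n y'\<bar> \<le> dist y y' / r" for n y y'
  proof -
    have "\<bar>w n y - w n y'\<bar> \<le> \<bar>infdist y (orbit H (z n)) / r - infdist y' (orbit H (z n)) / r\<bar>"
      unfolding w_def orbit_bump_def by (rule trunc)
    also have "\<dots> = \<bar>infdist y (orbit H (z n)) - infdist y' (orbit H (z n))\<bar> / r"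
      using r by (simp add: abs_divide flip: diff_divide_distrib)
    also have "\<dots> \<le> dist y y' / r" using r by (intro divide_right_mono infdist_triangle_abs) auto
    finally show ?thesis .
  qed
  have winv: "\<forall>\<phi>\<in>H. \<forall>y. w n (\<phi> y) = w n y" for n
    unfolding w_def orbit_bump_def using infdist_orbit_invariant[OF H] by simp
  have V: "0 \<le> V" using V0(2) by (simp add: V_def)
  obtain m where m: "\<And>n. w n \<in> fst Y \<and> snd Y (w n) \<le> ennreal m"
  proof -
    obtain m where m: "\<forall>E\<in>sets M. \<forall>w\<in>borel_measurable M. emeasure M E \<le> ennreal V \<longrightarrow>
     (\<forall>y. 0 \<le> w y \<and> w y \<le> 1) \<longrightarrow> (\<forall>y. y \<notin> E \<longrightarrow> w y = 0) \<longrightarrow> (\<forall>y z. \<bar>w y - w z\<bar> \<le> dist y z / r) \<longrightarrow>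
     (\<forall>\<phi>\<in>H. \<forall>y. w (\<phi> y) = w y) \<longrightarrow> w \<in> fst Y \<and> snd Y w \<le> ennreal m"
      using Y[OF r(1) _ V] r(2) by auto
    show ?thesis
      by (rule that[of m], rule m[rule_format, OF Em wm EV]) (use w01 w0 wL winv in auto)
  qed
  have "norm_bounded Y (range w)" unfolding norm_bounded_def using m by blast
  then have tb: "norm_totally_bounded (L_fun_space M \<beta>) (range w)" using emb by (simp add: compactly_embedded_def)
  obtain Ql Qu where Qb: "0 < Ql" "\<And>x. Ql \<le> Q x" "\<And>x. Q x \<le> Qu" using log_exponentsD(3)[OF mms Q] by blast
  obtain b where b: "0 < b" "\<And>x \<rho>. 0 < \<rho> \<Longrightarrow> \<rho> \<le> 1 \<Longrightarrow> ennreal (b * \<rho> powr Q x) \<le> emeasure M (ball x \<rho>)"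
    using reg unfolding lower_Ahlfors_regular_def by auto
  define v where "v = b * (r / 2) powr Qu"
  have v: "0 < v" using b(1) r by (simp add: v_def)
  have ballv: "ennreal v \<le> emeasure M (ball (z n) (r / 2))" for n
  proof -
    have "ennreal v \<le> ennreal (b * (r / 2) powr Q (z n))"
      unfolding v_def using b(1) r Qb by (intro ennreal_leI mult_left_mono powr_mono') auto
    also have "\<dots> \<le> emeasure M (ball (z n) (r / 2))" using r by (intro b(2)) auto
    finally show ?thesis .
  qed
  have wball: "1 / 2 \<le> w n y" "y \<in> E n" if "y \<in> ball (z n) (r / 2)" for n y
  proof -
    have "z n \<in> orbit H (z n)" using idH unfolding orbit_def by (metis id_apply imageI)
    then have "infdist y (orbit H (z n)) \<le> dist y (z n)" by (rule infdist_le)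
    then have i: "infdist y (orbit H (z n)) \<le> r / 2" using that by (simp add: dist_commute)
    then have "infdist y (orbit H (z n)) / r \<le> 1 / 2" using r by (simp add: field_simps)
    then show "1 / 2 \<le> w n y" unfolding w_def orbit_bump_def by linarith
    show "y \<in> E n" using i r by (simp add: E_def)
  qed
  have disjoint: "E n \<inter> E k = {}" if "k < n" for n k
  proof (rule ccontr)
    assume "E n \<inter> E k \<noteq> {}"
    then obtain y where y: "y \<in> E n" "y \<in> E k" by blast
    obtain h where h: "h \<in> H" "dist y (h (z n)) < r" using exists_near_orbit_point[of y H "z n" r] idH y by (auto simp: E_def)
    obtain h' where h': "h' \<in> H" "dist y (h' (z k)) < r" using exists_near_orbit_point[of y H "z k" r] idH y by (auto simp: E_def)
    have "dist x0 (h (z n)) \<le> dist x0 y + dist y (h (z n))" "dist x0 y \<le> dist x0 (h' (z k)) + dist y (h' (z k))"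
      by (rule dist_triangle, rule dist_triangle2)
    then have "dist x0 (z n) \<le> dist x0 (z k) + 2 * D + 2 * r"
      using orb[OF h(1), of "z n"] orb[OF h'(1), of "z k"] h(2) h'(2) by linarith
    with zfar[OF that] r(2) show False by simp
  qed
  note \<beta>m [measurable] = bounded_exponentsD(1)[OF \<beta>] and \<beta>_pos = bounded_exponentsD(2)[OF \<beta>]
  obtain a c where ac: "0 < a" "AE x in M. a \<le> \<beta> x \<and> \<beta> x \<le> c" using bounded_exponentsD(3)[OF \<beta>] by blast
  define J where "J = max 1 (3 / v) powr (1 / a)"
  have J: "1 \<le> J" unfolding J_def using ac by (intro ge_one_powr_ge_zero) auto
  have Ja: "3 / v \<le> J powr a" using ac by (simp add: J_def powr_powr)
  \<comment> \<open>With this \<open>\<epsilon>\<close> a deviation of \<open>1/4\<close> on a set of measure \<open>v\<close> has modular at least \<open>3\<close>, more than the two units available.\<close>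
  define \<epsilon> where "\<epsilon> = 1 / (4 * J)"
  have \<epsilon>: "0 < \<epsilon>" using J by (simp add: \<epsilon>_def)
  obtain F where F: "finite F" "F \<subseteq> fst (L_fun_space M \<beta>)"
    "\<forall>u\<in>range w. \<exists>f\<in>F. snd (L_fun_space M \<beta>) (u - f) < ennreal \<epsilon>"
    using tb \<epsilon> unfolding norm_totally_bounded_def by blast
  have "\<forall>n. \<exists>f. f \<in> F \<and> Lp_norm M \<beta> (\<lambda>x. ennreal \<bar>(w n - f) x\<bar>) < ennreal \<epsilon>"
    using F(3) by (auto simp: L_fun_space_def)
  from choice[OF this] obtain f where f: "\<And>n. f n \<in> F" "\<And>n. Lp_norm M \<beta> (\<lambda>x. ennreal \<bar>(w n - f n) x\<bar>) < ennreal \<epsilon>"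
    by blast
  have "range f \<subseteq> F" using f(1) by blast
  then have "finite (range f)" using F(1) finite_subset by blast
  then have "\<not> inj f" using finite_imageD[of f UNIV] infinite_UNIV_nat by blast
  then obtain i j where ij: "i \<noteq> j" "f i = f j" by (auto simp: inj_def)
  obtain k n where kn: "k < n" "f k = f n"
    using ij by (cases i j rule: linorder_cases) auto
  define g where "g = f n"
  have gm [measurable]: "g \<in> borel_measurable M"
    using f(1)[of n] F(2) by (auto simp: g_def L_fun_space_def Lp_space_def)
  have mod: "(\<integral>\<^sup>+x. ennreal ((\<bar>w i x - g x\<bar> / \<epsilon>) powr \<beta> x) \<partial>M) \<le> 1" if "i = n \<or> i = k" for i
  proof -
    have "f i = g" using that kn(2) by (auto simp: g_def)
    then have "Lp_norm M \<beta> (\<lambda>x. ennreal \<bar>w i x - g x\<bar>) < ennreal \<epsilon>" using f(2)[of i] by simp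
    from Lp_norm_lessD[OF \<beta>_pos this] show ?thesis
      using modular_real[OF \<epsilon>, of M \<beta> "\<lambda>x. w i x - g x"] by simp
  qed
  let ?B = "ball (z n) (r / 2)"
  have [measurable]: "?B \<in> sets M" by (simp add: sM)
  have "ennreal 3 = ennreal (3 / v) * ennreal v" using v by (simp flip: ennreal_mult'')
  also have "\<dots> \<le> ennreal (3 / v) * emeasure M ?B" by (intro mult_left_mono ballv) auto
  also have "\<dots> = (\<integral>\<^sup>+x. ennreal (3 / v) * indicator ?B x \<partial>M)" by (simp add: nn_integral_cmult_indicator)
  also have "\<dots> \<le> (\<integral>\<^sup>+x. ennreal ((\<bar>w n x - g x\<bar> / \<epsilon>) powr \<beta> x) + ennreal ((\<bar>w k x - g x\<bar> / \<epsilon>) powr \<beta> x) \<partial>M)"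
  proof (rule nn_integral_mono_AE, use ac(2) in eventually_elim)
    case (elim x)
    show ?case
    proof (cases "x \<in> ?B")
      case True
      have big: "3 / v \<le> (d / \<epsilon>) powr \<beta> x" if "1 / 4 \<le> d" for d
      proof -
        have "J \<le> d / \<epsilon>" using that J by (simp add: \<epsilon>_def)
        then have "J powr a \<le> (d / \<epsilon>) powr a" using J ac by (intro powr_mono2) auto
        also have "\<dots> \<le> (d / \<epsilon>) powr \<beta> x" using elim J \<open>J \<le> d / \<epsilon>\<close> by (intro powr_mono) auto
        finally show ?thesis using Ja by simp
      qed
      have "w k x = 0" using wball(2)[OF True] disjoint[OF kn(1)] by (intro w0) blast
      with wball(1)[OF True] have "1 / 4 \<le> \<bar>w n x - g x\<bar> \<or> 1 / 4 \<le> \<bar>w k x - g x\<bar>" by linarith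
      then have "3 / v \<le> (\<bar>w n x - g x\<bar> / \<epsilon>) powr \<beta> x + (\<bar>w k x - g x\<bar> / \<epsilon>) powr \<beta> x"
        using big by (auto intro: add_increasing add_increasing2)
      then show ?thesis using True by (simp add: ennreal_leI flip: ennreal_plus)
    qed simp
  qed
  also have "\<dots> = (\<integral>\<^sup>+x. ennreal ((\<bar>w n x - g x\<bar> / \<epsilon>) powr \<beta> x) \<partial>M) + (\<integral>\<^sup>+x. ennreal ((\<bar>w k x - g x\<bar> / \<epsilon>) powr \<beta> x) \<partial>M)"
    by (rule nn_integral_add) measurable
  also have "\<dots> \<le> ennreal 1 + ennreal 1" by (intro add_mono) (use mod in simp_all)
  also have "\<dots> = ennreal 2" by (simp flip: ennreal_plus)
  finally show False by (subst (asm) ennreal_le_iff) auto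
qed

lemma invariant_bumps_in_space:
  fixes M :: "'a::metric_space measure"
  assumes M: "sets M = sets borel" and p: "p \<in> bounded_exponents M" and s: "s \<in> bounded_exponents M" and q: "q \<in> exponents M"
    and sq: "esssup M (ereal \<circ> s) < 1 \<and> essinf M q < \<infinity> \<or> esssup M (ereal \<circ> s) \<le> 1 \<and> essinf M q = \<infinity>"
    and Y: "Y = invariant_subspace M H (M_fun_space M s p q) \<or> Y = invariant_subspace M H (N_fun_space M s p q)"
    and r: "0 < r" "r \<le> 1" and V: "0 \<le> V"
  shows "\<exists>m. \<forall>E\<in>sets M. \<forall>w\<in>borel_measurable M. emeasure M E \<le> ennreal V \<longrightarrow>
     (\<forall>y. 0 \<le> w y \<and> w y \<le> 1) \<longrightarrow> (\<forall>y. y \<notin> E \<longrightarrow> w y = 0) \<longrightarrow> (\<forall>y z. \<bar>w y - w z\<bar> \<le> dist y z / r) \<longrightarrow>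
     (\<forall>\<phi>\<in>H. \<forall>y. w (\<phi> y) = w y) \<longrightarrow> w \<in> fst Y \<and> snd Y w \<le> ennreal m"
proof -
  obtain m where m: "0 < m" "\<forall>E\<in>sets M. \<forall>w\<in>borel_measurable M. emeasure M E \<le> ennreal V \<longrightarrow>
     (\<forall>y. 0 \<le> w y \<and> w y \<le> 1) \<longrightarrow> (\<forall>y. y \<notin> E \<longrightarrow> w y = 0) \<longrightarrow> (\<forall>y z. \<bar>w y - w z\<bar> \<le> dist y z / r) \<longrightarrow>
     w \<in> Lp_space M p \<and> Lp_norm M p (\<lambda>x. ennreal \<bar>w x\<bar>) \<le> ennreal m \<and>
     M_seminorm M s p q w \<le> ennreal m \<and> N_seminorm M s p q w \<le> ennreal m"
    using localized_lipschitz_bounded[OF M p s q sq r V] by blast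
  show ?thesis
  proof (intro exI[of _ "m + m"] ballI impI)
    fix E w assume *: "E \<in> sets M" "w \<in> borel_measurable M" "emeasure M E \<le> ennreal V"
     "\<forall>y. 0 \<le> w y \<and> w y \<le> 1" "\<forall>y. y \<notin> E \<longrightarrow> w y = 0" "\<forall>y z. \<bar>w y - w z\<bar> \<le> dist y z / r"
     and inv: "\<forall>\<phi>\<in>H. \<forall>y. w (\<phi> y) = w y"
    have w: "w \<in> Lp_space M p" "Lp_norm M p (\<lambda>x. ennreal \<bar>w x\<bar>) \<le> ennreal m"
      "M_seminorm M s p q w \<le> ennreal m" "N_seminorm M s p q w \<le> ennreal m"
      using m(2)[rule_format, OF *(1,2,3)] *(4,5,6) by auto
    have fin: "M_seminorm M s p q w < \<infinity>" "N_seminorm M s p q w < \<infinity>"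
      using w(3,4) le_less_trans by fastforce+
    have sum: "ennreal (m + m) = ennreal m + ennreal m" using m(1) by (intro ennreal_plus) auto
    show "w \<in> fst Y \<and> snd Y w \<le> ennreal (m + m)"
      using Y unfolding sum
      by (elim disjE) (use w fin inv in \<open>auto simp: invariant_subspace_def M_fun_space_def N_fun_space_def intro!: add_mono\<close>)
  qed
qed

section \<open>The equivalence\<close>

lemma constant_exponents:
  fixes M :: "'a::metric_space measure"
  assumes "emeasure M (space M) \<noteq> 0" "0 < c"
  shows "(\<lambda>x. c) \<in> bounded_exponents M" and "(\<lambda>x. c) \<in> log_exponents M"
proof -
  have "(\<lambda>x. ereal c) \<in> borel_measurable M" by simp
  then have "ereal c \<le> essinf M (\<lambda>x. ereal c)" by (rule essinf_geI) simp
  then have "0 < essinf M (\<lambda>x. ereal c)" using assms(2) by (metis ereal_less(2) less_le_trans)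
  then show b: "(\<lambda>x. c) \<in> bounded_exponents M"
    using assms esssup_const[OF assms(1), of "ereal c"] by (simp add: bounded_exponents_def exponents_def comp_def)
  then show "(\<lambda>x. c) \<in> log_exponents M"
  proof -
    have "\<forall>x y :: 'a. \<bar>1 / c - 1 / c\<bar> \<le> 1 / ln (exp 1 + 1 / dist x y)"
    proof (intro allI)
      fix x y :: 'a
      have "1 \<le> exp 1 + 1 / dist x y" using exp_ge_add_one_self[of 1] by (simp add: add_increasing2)
      then show "\<bar>1 / c - 1 / c\<bar> \<le> 1 / ln (exp 1 + 1 / dist x y)" by simp
    qed
    with b show ?thesis unfolding log_exponents_def by (auto intro!: exI[of _ 1])
  qed
qed

text \<open>Constant exponents witness that the universal statements have instances. With \<open>p = 1\<close> the upper
bound \<open>Q/(Q - c) = 1 + c/(Q - c)\<close> is at least \<open>1 + s0/(2 Qu)\<close> for \<open>c\<close> equal to \<open>s0\<close> or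
\<open>s0/2\<close>, and \<open>\<beta>0\<close> is placed halfway.\<close>

lemma exists_subcritical_constants:
  fixes M :: "'a::metric_space measure"
  assumes mms: "metric_measure_space M" and Q: "Q \<in> log_exponents M"
  obtains s0 \<beta>0 :: real where "0 < s0" "s0 \<le> 1 / 2" "(\<lambda>x. s0) \<in> log_exponents M" "(\<lambda>x. s0 / 2) \<in> log_exponents M"
    "(\<lambda>x. 1 :: real) \<in> log_exponents M" "(\<lambda>x. \<beta>0) \<in> bounded_exponents M"
    "esssup M (ereal \<circ> (\<lambda>x. s0)) \<le> 1" "(\<lambda>x. \<infinity>) \<in> exponents M" "essinf M (\<lambda>x. \<infinity>) = \<infinity>"
    "exp_less M (\<lambda>x. s0 * 1) Q" "exp_less M (\<lambda>x. s0 / 2) (\<lambda>x. s0)" "exp_less M (\<lambda>x. 1) (\<lambda>x. \<beta>0)"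
    "exp_less M (\<lambda>x. \<beta>0) (\<lambda>x. Q x * 1 / (Q x - s0 * 1))" "exp_less M (\<lambda>x. \<beta>0) (\<lambda>x. Q x * 1 / (Q x - s0 / 2 * 1))"
proof -
  have sM: "sets M = sets borel" and sp: "space M = UNIV"
    using mms sets_eq_imp_space_eq[of M borel] by (auto simp: metric_measure_space_def)
  have pos: "emeasure M (space M) \<noteq> 0"
  proof -
    have "0 < emeasure M (ball undefined 1)" using mms by (simp add: metric_measure_space_def)
    also have "\<dots> \<le> emeasure M (space M)" by (rule emeasure_space)
    finally show ?thesis by simp
  qed
  obtain Ql Qu where Qb: "0 < Ql" "Ql \<le> 1" "1 \<le> Qu" "\<And>x. Ql \<le> Q x" "\<And>x. Q x \<le> Qu"
    using log_exponentsD(3)[OF mms Q] by blast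
  have Qm [measurable]: "Q \<in> borel_measurable M"
    using Q bounded_exponentsD(1)[of Q M] by (simp add: log_exponents_def)
  define s0 where "s0 = Ql / 2"
  define \<beta>0 where "\<beta>0 = 1 + s0 / (4 * Qu)"
  have s0: "0 < s0" "s0 \<le> 1 / 2" "s0 \<le> Q x / 2" for x using Qb(1,2) Qb(4)[of x] by (auto simp: s0_def)
  have \<beta>0: "1 < \<beta>0" using s0 Qb by (simp add: \<beta>0_def)
  have less: "exp_less M f g" if "f \<in> borel_measurable M" "g \<in> borel_measurable M" "0 < e" "\<And>x. f x + e \<le> g x" for f g e
  proof -
    have "ereal e \<le> essinf M (\<lambda>x. ereal (g x - f x))"
    proof (rule essinf_geI)
      show "(\<lambda>x. ereal (g x - f x)) \<in> borel_measurable M" using that by measurable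
      show "AE x in M. ereal e \<le> ereal (g x - f x)" using that(4) by (intro AE_I2) (simp add: le_diff_eq add.commute)
    qed
    then show ?thesis unfolding exp_less_def using that(3) by (metis ereal_less(2) less_le_trans)
  qed
  have gap: "\<beta>0 + s0 / (4 * Qu) \<le> Q x * 1 / (Q x - c * 1)" if c: "s0 / 2 \<le> c" "c \<le> s0" for c x
  proof -
    have Qx: "0 < Q x" "Q x \<le> Qu" using Qb(1) Qb(4,5)[of x] by auto
    have d: "0 < Q x - c" using s0(3)[of x] c Qx by linarith
    have "s0 / (2 * Qu) \<le> (s0 / 2) / Q x" using Qx s0(1) by (simp add: frac_le)
    also have "\<dots> \<le> c / (Q x - c)" using c d s0(1) Qx by (intro frac_le) auto
    finally have "1 + s0 / (2 * Qu) \<le> 1 + c / (Q x - c)" by simp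
    also have "\<dots> = Q x / (Q x - c)" using d by (simp add: field_simps)
    finally show ?thesis using Qx by (simp add: \<beta>0_def)
  qed
  have eta: "0 < s0 / (4 * Qu)" using s0 Qb by simp
  show ?thesis
  proof (rule that[of s0 \<beta>0])
    show "exp_less M (\<lambda>x. s0 * 1) Q" using Qb(1,4) by (intro less[where e = "Ql / 2"]) (auto simp: s0_def)
    show "exp_less M (\<lambda>x. s0 / 2) (\<lambda>x. s0)" using s0 by (intro less[where e = "s0 / 2"]) auto
    show "exp_less M (\<lambda>x. 1) (\<lambda>x. \<beta>0)" using \<beta>0 by (intro less[where e = "\<beta>0 - 1"]) auto
    show "exp_less M (\<lambda>x. \<beta>0) (\<lambda>x. Q x * 1 / (Q x - s0 * 1))"
      by (rule less[OF _ _ eta gap]) (use s0(1) in auto)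
    show "exp_less M (\<lambda>x. \<beta>0) (\<lambda>x. Q x * 1 / (Q x - s0 / 2 * 1))"
      by (rule less[OF _ _ eta gap]) (use s0(1) in auto)
    show "(\<lambda>x. \<infinity>) \<in> exponents M" "essinf M (\<lambda>x. \<infinity>) = \<infinity>"
      using essinf_geI[of "\<lambda>x. \<infinity>" M \<infinity>] by (auto simp: exponents_def)
    show "esssup M (ereal \<circ> (\<lambda>x. s0)) \<le> 1"
      using esssup_const[OF pos, of "ereal s0"] s0(2) by (simp add: comp_def one_ereal_def)
    show "0 < s0" "s0 \<le> 1 / 2" by (rule s0)+
    show "(\<lambda>x. s0) \<in> log_exponents M" "(\<lambda>x. s0 / 2) \<in> log_exponents M" "(\<lambda>x. 1 :: real) \<in> log_exponents M"
      "(\<lambda>x. \<beta>0) \<in> bounded_exponents M"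
      using s0(1) \<beta>0 by (auto intro: constant_exponents[OF pos])
  qed
qed

lemma all_equivalent_of_cycles:
  assumes "a \<Longrightarrow> b" "b \<Longrightarrow> c" "c \<Longrightarrow> a" "a \<Longrightarrow> d" "d \<Longrightarrow> e" "e \<Longrightarrow> a"
  shows "all_equivalent [a, b, c, d, e]"
proof -
  have "b = a" by (rule iffI) (rule assms(3), rule assms(2), assumption, rule assms(1))
  moreover have "c = a" by (rule iffI) (rule assms(3), assumption, rule assms(2), rule assms(1))
  moreover have "d = a" by (rule iffI) (rule assms(6), rule assms(5), assumption, rule assms(4))
  moreover have "e = a" by (rule iffI) (rule assms(6), assumption, rule assms(5), rule assms(4))
  ultimately show ?thesis by (simp add: all_equivalent_def)
qed

theorem theorem3p14:
  fixes M :: "'a::metric_space measure"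
    and Q :: "'a \<Rightarrow> real"
    and H :: "('a \<Rightarrow> 'a) set"
  assumes "metric_measure_space M"
    and "\<not> bounded (UNIV :: 'a set)"
    and "geometrically_doubling TYPE('a)"
    and "(SUP x. emeasure M (ball x 1)) < \<infinity>"
    and "Q \<in> log_exponents M"
    and "lower_Ahlfors_regular M Q"
    and "compact_subgroup_Iso M H"
  shows "all_equivalent
    [\<forall>x0. \<forall>r\<in>{0<..<1/3}.
       ((\<lambda>R. INF x\<in>UNIV - ball x0 R. packing_number H x r) \<longlongrightarrow> \<infinity>) at_top,
     \<forall>p q s. p \<in> log_exponents M \<and> ereal \<circ> p \<in> invariant_exponents M H \<and>
        q \<in> exponents M \<and> s \<in> log_exponents M \<and>
        esssup M (ereal \<circ> s) \<le> 1 \<and> exp_less M (\<lambda>x. s x * p x) Q \<longrightarrow>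
        (\<forall>\<beta>\<in>bounded_exponents M.
           exp_less M p \<beta> \<and> exp_less M \<beta> (\<lambda>x. Q x * p x / (Q x - s x * p x)) \<longrightarrow>
           invariant_subspace M H (M_fun_space M s p q) \<hookrightarrow>\<hookrightarrow> L_fun_space M \<beta>),
     \<exists>s\<in>bounded_exponents M. \<exists>p\<in>bounded_exponents M. \<exists>\<beta>\<in>bounded_exponents M. \<exists>q\<in>exponents M.
        (esssup M (ereal \<circ> s) < 1 \<and> essinf M q < \<infinity> \<or>
         esssup M (ereal \<circ> s) \<le> 1 \<and> essinf M q = \<infinity>) \<and>
        invariant_subspace M H (M_fun_space M s p q) \<hookrightarrow>\<hookrightarrow> L_fun_space M \<beta>,
     \<forall>p q s. p \<in> log_exponents M \<and> ereal \<circ> p \<in> invariant_exponents M H \<and>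
        q \<in> exponents M \<and> s \<in> log_exponents M \<and>
        esssup M (ereal \<circ> s) \<le> 1 \<and> exp_less M (\<lambda>x. s x * p x) Q \<longrightarrow>
        (\<forall>t\<in>log_exponents M. exp_less M t s \<longrightarrow>
          (\<forall>\<beta>\<in>bounded_exponents M.
             exp_less M p \<beta> \<and> exp_less M \<beta> (\<lambda>x. Q x * p x / (Q x - t x * p x)) \<longrightarrow>
             invariant_subspace M H (N_fun_space M s p q) \<hookrightarrow>\<hookrightarrow> L_fun_space M \<beta>)),
     \<exists>s\<in>bounded_exponents M. \<exists>p\<in>bounded_exponents M. \<exists>\<beta>\<in>bounded_exponents M. \<exists>q\<in>exponents M.
        (esssup M (ereal \<circ> s) < 1 \<and> essinf M q < \<infinity> \<or>
         esssup M (ereal \<circ> s) \<le> 1 \<and> essinf M q = \<infinity>) \<and>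
        invariant_subspace M H (N_fun_space M s p q) \<hookrightarrow>\<hookrightarrow> L_fun_space M \<beta>]"
proof -
  note mms = assms(1) and unb = assms(2) and dbl = assms(3) and sup1 = assms(4) and Q = assms(5)
    and reg = assms(6) and cH = assms(7)
  have sM: "sets M = sets borel" using mms by (simp add: metric_measure_space_def)
  have HI: "H \<subseteq> Iso M" using cH by (simp add: compact_subgroup_Iso_def)
  let ?i = "\<forall>x0. \<forall>r\<in>{0<..<1/3}.
       ((\<lambda>R. INF x\<in>UNIV - ball x0 R. packing_number H x r) \<longlongrightarrow> \<infinity>) at_top"
  let ?ii = "\<forall>p q s. p \<in> log_exponents M \<and> ereal \<circ> p \<in> invariant_exponents M H \<and>
        q \<in> exponents M \<and> s \<in> log_exponents M \<and>
        esssup M (ereal \<circ> s) \<le> 1 \<and> exp_less M (\<lambda>x. s x * p x) Q \<longrightarrow>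
        (\<forall>\<beta>\<in>bounded_exponents M.
           exp_less M p \<beta> \<and> exp_less M \<beta> (\<lambda>x. Q x * p x / (Q x - s x * p x)) \<longrightarrow>
           invariant_subspace M H (M_fun_space M s p q) \<hookrightarrow>\<hookrightarrow> L_fun_space M \<beta>)"
  let ?iii = "\<exists>s\<in>bounded_exponents M. \<exists>p\<in>bounded_exponents M. \<exists>\<beta>\<in>bounded_exponents M. \<exists>q\<in>exponents M.
        (esssup M (ereal \<circ> s) < 1 \<and> essinf M q < \<infinity> \<or>
         esssup M (ereal \<circ> s) \<le> 1 \<and> essinf M q = \<infinity>) \<and>
        invariant_subspace M H (M_fun_space M s p q) \<hookrightarrow>\<hookrightarrow> L_fun_space M \<beta>"
  let ?iv = "\<forall>p q s. p \<in> log_exponents M \<and> ereal \<circ> p \<in> invariant_exponents M H \<and>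
        q \<in> exponents M \<and> s \<in> log_exponents M \<and>
        esssup M (ereal \<circ> s) \<le> 1 \<and> exp_less M (\<lambda>x. s x * p x) Q \<longrightarrow>
        (\<forall>t\<in>log_exponents M. exp_less M t s \<longrightarrow>
          (\<forall>\<beta>\<in>bounded_exponents M.
             exp_less M p \<beta> \<and> exp_less M \<beta> (\<lambda>x. Q x * p x / (Q x - t x * p x)) \<longrightarrow>
             invariant_subspace M H (N_fun_space M s p q) \<hookrightarrow>\<hookrightarrow> L_fun_space M \<beta>))"
  let ?v = "\<exists>s\<in>bounded_exponents M. \<exists>p\<in>bounded_exponents M. \<exists>\<beta>\<in>bounded_exponents M. \<exists>q\<in>exponents M.
        (esssup M (ereal \<circ> s) < 1 \<and> essinf M q < \<infinity> \<or>
         esssup M (ereal \<circ> s) \<le> 1 \<and> essinf M q = \<infinity>) \<and>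
        invariant_subspace M H (N_fun_space M s p q) \<hookrightarrow>\<hookrightarrow> L_fun_space M \<beta>"
  have i_ii: ?ii if i: ?i
  proof (intro allI impI ballI)
    fix p s \<beta> :: "'a \<Rightarrow> real" and q
    assume A: "p \<in> log_exponents M \<and> ereal \<circ> p \<in> invariant_exponents M H \<and>
        q \<in> exponents M \<and> s \<in> log_exponents M \<and> esssup M (ereal \<circ> s) \<le> 1 \<and> exp_less M (\<lambda>x. s x * p x) Q"
      and \<beta>: "\<beta> \<in> bounded_exponents M"
      and B: "exp_less M p \<beta> \<and> exp_less M \<beta> (\<lambda>x. Q x * p x / (Q x - s x * p x))"
    have p: "p \<in> log_exponents M" and q: "q \<in> exponents M" and s: "s \<in> log_exponents M"
      and sp: "exp_less M (\<lambda>x. s x * p x) Q" using A by blast+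
    have pb: "p \<in> bounded_exponents M" using p by (simp add: log_exponents_def)
    obtain e where e: "0 < e" "AE x in M. s x * p x + e \<le> Q x" using exp_lessD[OF sp] by blast
    show "invariant_subspace M H (M_fun_space M s p q) \<hookrightarrow>\<hookrightarrow> L_fun_space M \<beta>"
      unfolding M_fun_space_def
    proof (rule compact_embedding_of_large_orbits[OF mms dbl Q reg HI i p s e \<beta> B[THEN conjunct1] B[THEN conjunct2] _ _ zero_less_one])
      show "(\<lambda>x. u x / L) \<in> hajlasz_class M p s 1"
        if "u \<in> borel_measurable M" "0 < L" "Lp_norm M p (\<lambda>x. ennreal \<bar>u x\<bar>) + M_seminorm M s p q u < ennreal L" for u L
        using M_ball_scaled[OF sM pb q that] .
    qed (use Lp_norm_finite[OF pb] in \<open>auto simp: Lp_space_def\<close>)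
  qed
  have i_iv: ?iv if i: ?i
  proof (intro allI impI ballI)
    fix p s t \<beta> :: "'a \<Rightarrow> real" and q
    assume A: "p \<in> log_exponents M \<and> ereal \<circ> p \<in> invariant_exponents M H \<and>
        q \<in> exponents M \<and> s \<in> log_exponents M \<and> esssup M (ereal \<circ> s) \<le> 1 \<and> exp_less M (\<lambda>x. s x * p x) Q"
      and t: "t \<in> log_exponents M" and ts: "exp_less M t s" and \<beta>: "\<beta> \<in> bounded_exponents M"
      and B: "exp_less M p \<beta> \<and> exp_less M \<beta> (\<lambda>x. Q x * p x / (Q x - t x * p x))"
    have p: "p \<in> log_exponents M" and q: "q \<in> exponents M"
      and sp: "exp_less M (\<lambda>x. s x * p x) Q" using A by blast+
    have pb: "p \<in> bounded_exponents M" using p by (simp add: log_exponents_def)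
    obtain \<delta> where \<delta>: "0 < \<delta>" "AE x in M. t x + \<delta> \<le> s x" using exp_lessD[OF ts] by blast
    obtain e where e: "0 < e" "AE x in M. s x * p x + e \<le> Q x" using exp_lessD[OF sp] by blast
    have e': "AE x in M. t x * p x + e \<le> Q x"
      using e(2) \<delta>(2)
    proof eventually_elim
      case (elim x)
      have "t x * p x \<le> s x * p x"
        using elim(2) \<delta>(1) bounded_exponentsD(2)[OF pb, of x] by (intro mult_right_mono) auto
      with elim(1) show ?case by simp
    qed
    obtain K where K: "0 < K" "\<And>u L. u \<in> borel_measurable M \<Longrightarrow> 0 < L \<Longrightarrow>
        Lp_norm M p (\<lambda>x. ennreal \<bar>u x\<bar>) + N_seminorm M s p q u < ennreal L \<Longrightarrow> (\<lambda>x. u x / L) \<in> hajlasz_class M p t K"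
      using N_ball_scaled[OF sM pb q \<delta>] by blast
    show "invariant_subspace M H (N_fun_space M s p q) \<hookrightarrow>\<hookrightarrow> L_fun_space M \<beta>"
      unfolding N_fun_space_def
      by (rule compact_embedding_of_large_orbits[OF mms dbl Q reg HI i p t e(1) e' \<beta> B[THEN conjunct1] B[THEN conjunct2] _ _ K])
         (use Lp_norm_finite[OF pb] in \<open>auto simp: Lp_space_def\<close>)
  qed
  have converse: ?i if s: "s \<in> bounded_exponents M" and p: "p \<in> bounded_exponents M" and \<beta>: "\<beta> \<in> bounded_exponents M"
      and q: "q \<in> exponents M" and sq: "esssup M (ereal \<circ> s) < 1 \<and> essinf M q < \<infinity> \<or> esssup M (ereal \<circ> s) \<le> 1 \<and> essinf M q = \<infinity>"
      and Y: "Y = invariant_subspace M H (M_fun_space M s p q) \<or> Y = invariant_subspace M H (N_fun_space M s p q)"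
      and emb: "Y \<hookrightarrow>\<hookrightarrow> L_fun_space M \<beta>" for s p \<beta> q Y
  proof (intro allI ballI)
    fix x0 :: 'a and r :: real assume r: "r \<in> {0<..<1/3}"
    show "((\<lambda>R. INF x\<in>UNIV - ball x0 R. packing_number H x r) \<longlongrightarrow> \<infinity>) at_top"
      using r by (intro large_orbits_of_compact_embedding[OF mms unb sup1 Q reg cH \<beta> _ emb]
          invariant_bumps_in_space[OF sM p s q sq Y]) auto
  qed
  have iii_i: ?i if ?iii using that converse by blast
  have v_i: ?i if ?v using that converse by blast
  obtain s0 \<beta>0 :: real where c: "0 < s0" "s0 \<le> 1 / 2" "(\<lambda>x. s0) \<in> log_exponents M" "(\<lambda>x. s0 / 2) \<in> log_exponents M"
    "(\<lambda>x. 1 :: real) \<in> log_exponents M" "(\<lambda>x. \<beta>0) \<in> bounded_exponents M"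
    "esssup M (ereal \<circ> (\<lambda>x. s0)) \<le> 1" "(\<lambda>x. \<infinity>) \<in> exponents M" "essinf M (\<lambda>x. \<infinity>) = \<infinity>"
    "exp_less M (\<lambda>x. s0 * 1) Q" "exp_less M (\<lambda>x. s0 / 2) (\<lambda>x. s0)" "exp_less M (\<lambda>x. 1) (\<lambda>x. \<beta>0)"
    "exp_less M (\<lambda>x. \<beta>0) (\<lambda>x. Q x * 1 / (Q x - s0 * 1))" "exp_less M (\<lambda>x. \<beta>0) (\<lambda>x. Q x * 1 / (Q x - s0 / 2 * 1))"
    by (rule exists_subcritical_constants[OF mms Q])
  have bd: "(\<lambda>x. s0) \<in> bounded_exponents M" "(\<lambda>x. 1 :: real) \<in> bounded_exponents M"
    using c(3,5) by (simp_all add: log_exponents_def)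
  have inv1: "ereal \<circ> (\<lambda>x. 1) \<in> invariant_exponents M H"
    using bd(2) by (auto simp: invariant_exponents_def bounded_exponents_def comp_def)
  have hyp: "(\<lambda>x. 1 :: real) \<in> log_exponents M \<and> ereal \<circ> (\<lambda>x. 1) \<in> invariant_exponents M H \<and>
        (\<lambda>x. \<infinity>) \<in> exponents M \<and> (\<lambda>x. s0) \<in> log_exponents M \<and>
        esssup M (ereal \<circ> (\<lambda>x. s0)) \<le> 1 \<and> exp_less M (\<lambda>x. s0 * 1) Q"
    using c inv1 by blast
  have ii_iii: ?iii if ii: ?ii
  proof -
    have "invariant_subspace M H (M_fun_space M (\<lambda>x. s0) (\<lambda>x. 1) (\<lambda>x. \<infinity>)) \<hookrightarrow>\<hookrightarrow> L_fun_space M (\<lambda>x. \<beta>0)"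
      by (rule ii[rule_format, OF hyp c(6)]) (use c(12,13) in blast)
    then show ?thesis using bd c(6,7,8,9) by blast
  qed
  have iv_v: ?v if iv: ?iv
  proof -
    have "invariant_subspace M H (N_fun_space M (\<lambda>x. s0) (\<lambda>x. 1) (\<lambda>x. \<infinity>)) \<hookrightarrow>\<hookrightarrow> L_fun_space M (\<lambda>x. \<beta>0)"
      by (rule iv[rule_format, OF hyp c(4) c(11) c(6)]) (use c(12,14) in blast)
    then show ?thesis using bd c(6,7,8,9) by blast
  qed
  show ?thesis by (rule all_equivalent_of_cycles[OF i_ii ii_iii iii_i i_iv iv_v v_i])
qed

end
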